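(* Let $\mathbf{v}=(v_1,\ldots,v_N)\in(0,1)^N$ with $\sum_{k=1}^N v_k=1$ (with $\mathbf{v}=(1)$ when $N=1$). Let $\mathcal{B}$ be a standard unital C*-subalgebra of $\mathcal{A}=\bigoplus_{k=1}^N\mathcal{M}_{d_k}$, and let $r,\ell,m,\alpha,\gamma$ be the constants associated to $\mathcal{B}$ and $\mathbf{v}$ (defined in the context). If $X\in\mathcal{A}$ is positive, then \[ \frac{\alpha}{r\ell m\gamma}\|X\|_{\mathrm{op}}\le\|P^{\mathbf{v}}_{\mathcal{B}}(X)\|_{\mathrm{op}}, \] and, moreover, \[ \frac{\sqrt{\alpha}}{\sqrt{r\ell m\gamma}}\|X\|_{\mathrm{op}}\le\|X\|_{\mathbf{v},\mathcal{B}} \] for all $X\in\mathcal{A}$.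
   Context: Notation: $[N]=\{1,\ldots,N\}$; $\mathcal{M}_n$ is the C*-algebra of complex $n\times n$ matrices with the operator norm. $\bigoplus_{k=1}^N\mathcal{M}_{d_k}$ ($N,d_k\in\{1,2,\ldots\}$) is a unital C*-algebra with coordinatewise operations; its norm $\|\cdot\|_{\mathrm{op}}$ is the maximum of the operator norms of the coordinates; elements are written $A=(A^{(1)},\ldots,A^{(N)})$. Positive means every coordinate is positive semidefinite. A unital C*-subalgebra contains the unit of the ambient algebra. A refined partition of $n$ is a formal expression $\lambda=(n_1^{m_1},\ldots,n_L^{m_L})$ with $L,n_i,m_i\in\{1,2,\ldots\}$ and $n=\sum_i m_in_i$ (the $n_i$ need not be distinct); put $\mathcal{B}^n_\lambda=\bigoplus_{i=1}^L(I_{m_i}\otimes\mathcal{M}_{n_i})\subseteq\mathcal{M}_n$, i.e. the block-diagonal matrices $\mathrm{diag}(A_1,\ldots,A_1,\ldots,A_L,\ldots,A_L)$ with $A_i\in\mathcal{M}_{n_i}$ repeated $m_i$ times. Standard subalgebras: a unital C*-subalgebra $\mathcal{B}\subseteq\mathcal{A}$ is standard if for each $k\in[N]$ its image under the projection $p_k$ onto the $k$th summand is $p_k(\mathcal{B})=\mathcal{B}^{d_k}_{\lambda_k}$ for a refined partition $\lambda_k=(n_{k,1}^{m_{k,1}},\ldots,n_{k,L_k}^{m_{k,L_k}})$ of $d_k$. Let $E^{(k)}_{i,j}$ be the element with $1$ in the $(i,j)$-entry of the $k$th summand and zeros elsewhere (a matrix unit). A standard subalgebra is understood to have a standard basis $\beta_{\mathcal{B}}=\{b_1,\ldots,b_M\}$: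 a linear basis of $\mathcal{B}$ each of whose elements is a matrix unit or a sum of distinct matrix units, the supports (sets of positions of nonzero entries, in all summands) of distinct basis elements being disjoint. Constants: (1) $\ell=\mathrm{lcm}\{m_{k,i}:k\in[N],\,i\in[L_k]\}$; (2) $r=\mathrm{lcm}\{r_1,\ldots,r_N\}$, where $r_k=\sum_{i=1}^{L_k}m_{k,i}$ is the number of diagonal blocks of $\mathcal{B}$ in the $k$th summand of $\mathcal{A}$; (3) $m=\mathrm{lcm}\{m_{b_1},\ldots,m_{b_M}\}$, where $m_{b_i}$ is the number of nonzero entries of $b_i$ (counted over all summands); (4) $\alpha=\min\{v_k/d_k:k\in[N]\}$; (5) $\gamma=\max\left\{\sum_{k=1}^N\frac{\rho_{k,i}v_k}{d_k}:i\in[M]\right\}$, where $\rho_{k,i}$ is the number of nonzero entries of $b_i$ in the $k$th summand. Norm: for $\mathbf{v}$ as in the claim, $\tau_{\mathbf{v}}(A)=\sum_{k=1}^N\frac{v_k}{d_k}\mathrm{Tr}(A^{(k)})$ is a faithful tracial state. $P^{\mathbf{v}}_{\mathcal{B}}:\mathcal{A}\to\mathcal{B}$ is the unique conditional expectation onto $\mathcal{B}$ (linear map $P$ with $P(B)=B$ for $B\in\mathcal{B}$ and $\|P(A)\|_{\mathrm{op}}\le\|A\|_{\mathrm{op}}$) with $\tau_{\mathbf{v}}\circ P^{\mathbf{v}}_{\mathcal{B}}=\tau_{\mathbf{v}}$; equivalently, the orthogonal projection onto $\mathcal{B}$ for the inner product $\langle A,B\rangle=\tau_{\mathbf{v}}(B^*A)$.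 The Frobenius--Rieffel norm is $\|A\|_{\mathbf{v},\mathcal{B}}=\sqrt{\|P^{\mathbf{v}}_{\mathcal{B}}(A^*A)\|_{\mathrm{op}}}$. *)

theory Defs
  imports
    "Jordan_Normal_Form.Schur_Decomposition"
    "HOL-Analysis.L2_Norm"
    "HOL-Library.FuncSet"
    "HOL-Library.Disjoint_Sets"
begin

section \<open>Complex matrices\<close>

definition mat_trace :: "complex mat \<Rightarrow> complex" where
  "mat_trace A = (\<Sum>i<dim_row A. A $$ (i, i))"

definition euclid_norm :: "complex vec \<Rightarrow> real" where
  "euclid_norm x = L2_set (\<lambda>i. cmod (x $ i)) {..<dim_vec x}"

definition op_norm :: "complex mat \<Rightarrow> real" where
  "op_norm A = (SUP x \<in> {x \<in> carrier_vec (dim_col A). euclid_norm x \<le> 1}. euclid_norm (A *\<^sub>v x))"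

text \<open>The order on \<^typ>\<open>complex\<close> is the one of Complex_Order:
  \<open>0 \<le> z\<close> says that \<open>z\<close> is real and nonnegative.\<close>

definition psd_mat :: "complex mat \<Rightarrow> bool" where
  "psd_mat A \<longleftrightarrow> mat_adjoint A = A \<and> (\<forall>x \<in> carrier_vec (dim_row A). 0 \<le> (A *\<^sub>v x) \<bullet>c x)"


section \<open>Direct sums of full matrix algebras\<close>

text \<open>An element \<open>A\<close> of the direct sum of the matrix algebras of sizes \<open>d 1, \<dots>, d N\<close> is the
  function mapping \<open>k \<in> {1..N}\<close> to its \<open>k\<close>-th coordinate, and is \<^const>\<open>undefined\<close> outside
  \<open>{1..N}\<close>. Rows and columns of each coordinate are numbered from \<open>0\<close>.\<close>

type_synonym msum = "nat \<Rightarrow> complex mat"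

definition msum_carrier :: "nat \<Rightarrow> (nat \<Rightarrow> nat) \<Rightarrow> msum set" where
  "msum_carrier N d = (\<Pi>\<^sub>E k\<in>{1..N}. carrier_mat (d k) (d k))"

definition msum_zero :: "nat \<Rightarrow> (nat \<Rightarrow> nat) \<Rightarrow> msum" where
  "msum_zero N d = (\<lambda>k\<in>{1..N}. 0\<^sub>m (d k) (d k))"

definition msum_one :: "nat \<Rightarrow> (nat \<Rightarrow> nat) \<Rightarrow> msum" where
  "msum_one N d = (\<lambda>k\<in>{1..N}. 1\<^sub>m (d k))"

definition msum_add :: "nat \<Rightarrow> msum \<Rightarrow> msum \<Rightarrow> msum" where
  "msum_add N A B = (\<lambda>k\<in>{1..N}. A k + B k)"

definition msum_diff :: "nat \<Rightarrow> msum \<Rightarrow> msum \<Rightarrow> msum" where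
  "msum_diff N A B = (\<lambda>k\<in>{1..N}. A k - B k)"

definition msum_smult :: "nat \<Rightarrow> complex \<Rightarrow> msum \<Rightarrow> msum" where
  "msum_smult N c A = (\<lambda>k\<in>{1..N}. c \<cdot>\<^sub>m A k)"

definition msum_mult :: "nat \<Rightarrow> msum \<Rightarrow> msum \<Rightarrow> msum" where
  "msum_mult N A B = (\<lambda>k\<in>{1..N}. A k * B k)"

definition msum_adjoint :: "nat \<Rightarrow> msum \<Rightarrow> msum" where
  "msum_adjoint N A = (\<lambda>k\<in>{1..N}. mat_adjoint (A k))"

definition msum_norm :: "nat \<Rightarrow> msum \<Rightarrow> real" where
  "msum_norm N A = Max ((\<lambda>k. op_norm (A k)) ` {1..N})"

definition msum_positive :: "nat \<Rightarrow> msum \<Rightarrow> bool" where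
  "msum_positive N A \<longleftrightarrow> (\<forall>k\<in>{1..N}. psd_mat (A k))"

definition msum_lincomb ::
  "nat \<Rightarrow> (nat \<Rightarrow> nat) \<Rightarrow> (msum \<Rightarrow> complex) \<Rightarrow> msum set \<Rightarrow> msum" where
  "msum_lincomb N d c S =
     (\<lambda>k\<in>{1..N}. mat (d k) (d k) (\<lambda>(i, j). \<Sum>b\<in>S. c b * b k $$ (i, j)))"

definition matrix_unit :: "nat \<Rightarrow> (nat \<Rightarrow> nat) \<Rightarrow> nat \<Rightarrow> nat \<Rightarrow> nat \<Rightarrow> msum" where
  "matrix_unit N d k i j =
     (\<lambda>k'\<in>{1..N}. mat (d k') (d k') (\<lambda>(i', j'). if k' = k \<and> i' = i \<and> j' = j then 1 else 0))"

definition matrix_units :: "nat \<Rightarrow> (nat \<Rightarrow> nat) \<Rightarrow> msum set" where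
  "matrix_units N d = {matrix_unit N d k i j | k i j. k \<in> {1..N} \<and> i < d k \<and> j < d k}"

definition msum_supp :: "nat \<Rightarrow> msum \<Rightarrow> (nat \<times> nat \<times> nat) set" where
  "msum_supp N A = {(k, i, j). k \<in> {1..N} \<and> i < dim_row (A k) \<and> j < dim_col (A k) \<and> A k $$ (i, j) \<noteq> 0}"


section \<open>Standard subalgebras\<close>

definition unital_cstar_subalgebra :: "nat \<Rightarrow> (nat \<Rightarrow> nat) \<Rightarrow> msum set \<Rightarrow> bool" where
  "unital_cstar_subalgebra N d \<B> \<longleftrightarrow>
     \<B> \<subseteq> msum_carrier N d \<and>
     msum_one N d \<in> \<B> \<and>
     (\<forall>A\<in>\<B>. \<forall>B\<in>\<B>. msum_add N A B \<in> \<B>) \<and>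
     (\<forall>c. \<forall>A\<in>\<B>. msum_smult N c A \<in> \<B>) \<and>
     (\<forall>A\<in>\<B>. \<forall>B\<in>\<B>. msum_mult N A B \<in> \<B>) \<and>
     (\<forall>A\<in>\<B>. msum_adjoint N A \<in> \<B>) \<and>
     (\<forall>X. \<forall>A\<in>msum_carrier N d. (\<forall>t::nat. X t \<in> \<B>) \<and>
        (\<lambda>t. msum_norm N (msum_diff N (X t) A)) \<longlonglongrightarrow> 0 \<longrightarrow> A \<in> \<B>)"

text \<open>A refined partition \<open>(n\<^sub>1^m\<^sub>1, \<dots>, n\<^sub>L^m\<^sub>L)\<close> is the list of the pairs \<open>(n\<^sub>i, m\<^sub>i)\<close>:
  size first, multiplicity second.\<close>

definition refined_partition :: "nat \<Rightarrow> (nat \<times> nat) list \<Rightarrow> bool" where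
  "refined_partition n \<nu> \<longleftrightarrow>
     \<nu> \<noteq> [] \<and> (\<forall>(s, q) \<in> set \<nu>. 1 \<le> s \<and> 1 \<le> q) \<and> n = (\<Sum>(s, q) \<leftarrow> \<nu>. q * s)"

definition block_algebra :: "(nat \<times> nat) list \<Rightarrow> complex mat set" where
  "block_algebra \<nu> =
     {diag_block_mat (concat (map2 (\<lambda>(s, q) A. replicate q A) \<nu> As)) | As.
        length As = length \<nu> \<and>
        (\<forall>i<length \<nu>. As ! i \<in> carrier_mat (fst (\<nu> ! i)) (fst (\<nu> ! i)))}"

definition standard_basis :: "nat \<Rightarrow> (nat \<Rightarrow> nat) \<Rightarrow> msum set \<Rightarrow> msum set \<Rightarrow> bool" where
  "standard_basis N d \<B> \<beta> \<longleftrightarrow>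
     finite \<beta> \<and>
     \<B> = {msum_lincomb N d c \<beta> | c. True} \<and>
     (\<forall>c. msum_lincomb N d c \<beta> = msum_zero N d \<longrightarrow> (\<forall>b\<in>\<beta>. c b = 0)) \<and>
     (\<forall>b\<in>\<beta>. \<exists>U. U \<noteq> {} \<and> U \<subseteq> matrix_units N d \<and> b = msum_lincomb N d (\<lambda>_. 1) U) \<and>
     disjoint_family_on (msum_supp N) \<beta>"

definition standard_subalgebra ::
  "nat \<Rightarrow> (nat \<Rightarrow> nat) \<Rightarrow> msum set \<Rightarrow> (nat \<Rightarrow> (nat \<times> nat) list) \<Rightarrow> msum set \<Rightarrow> bool" where
  "standard_subalgebra N d \<B> \<nu> \<beta> \<longleftrightarrow>
     unital_cstar_subalgebra N d \<B> \<and>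
     (\<forall>k\<in>{1..N}. refined_partition (d k) (\<nu> k) \<and> (\<lambda>A. A k) ` \<B> = block_algebra (\<nu> k)) \<and>
     \<beta> \<subseteq> \<B> \<and> standard_basis N d \<B> \<beta>"


section \<open>The constants\<close>

definition const_l :: "nat \<Rightarrow> (nat \<Rightarrow> (nat \<times> nat) list) \<Rightarrow> nat" where
  "const_l N \<nu> = Lcm (\<Union>k\<in>{1..N}. snd ` set (\<nu> k))"

definition const_r :: "nat \<Rightarrow> (nat \<Rightarrow> (nat \<times> nat) list) \<Rightarrow> nat" where
  "const_r N \<nu> = Lcm ((\<lambda>k. sum_list (map snd (\<nu> k))) ` {1..N})"

definition const_m :: "nat \<Rightarrow> msum set \<Rightarrow> nat" where
  "const_m N \<beta> = Lcm ((\<lambda>b. card (msum_supp N b)) ` \<beta>)"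

definition const_alpha :: "nat \<Rightarrow> (nat \<Rightarrow> nat) \<Rightarrow> (nat \<Rightarrow> real) \<Rightarrow> real" where
  "const_alpha N d v = Min ((\<lambda>k. v k / real (d k)) ` {1..N})"

definition supp_count :: "nat \<Rightarrow> nat \<Rightarrow> msum \<Rightarrow> nat" where
  "supp_count N k b = card {(i, j). (k, i, j) \<in> msum_supp N b}"

definition const_gamma :: "nat \<Rightarrow> (nat \<Rightarrow> nat) \<Rightarrow> (nat \<Rightarrow> real) \<Rightarrow> msum set \<Rightarrow> real" where
  "const_gamma N d v \<beta> =
     Max ((\<lambda>b. \<Sum>k=1..N. real (supp_count N k b) * v k / real (d k)) ` \<beta>)"


section \<open>Conditional expectation and Frobenius--Rieffel norm\<close>

definition weight_vector :: "nat \<Rightarrow> (nat \<Rightarrow> real) \<Rightarrow> bool" where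
  "weight_vector N v \<longleftrightarrow>
     (if N = 1 then v 1 = 1
      else (\<forall>k\<in>{1..N}. 0 < v k \<and> v k < 1) \<and> (\<Sum>k=1..N. v k) = 1)"

definition tracial_state :: "nat \<Rightarrow> (nat \<Rightarrow> nat) \<Rightarrow> (nat \<Rightarrow> real) \<Rightarrow> msum \<Rightarrow> complex" where
  "tracial_state N d v A = (\<Sum>k=1..N. complex_of_real (v k / real (d k)) * mat_trace (A k))"

definition is_cond_exp ::
  "nat \<Rightarrow> (nat \<Rightarrow> nat) \<Rightarrow> msum set \<Rightarrow> (msum \<Rightarrow> msum) \<Rightarrow> bool" where
  "is_cond_exp N d \<B> P \<longleftrightarrow>
     P \<in> msum_carrier N d \<rightarrow>\<^sub>E \<B> \<and>
     (\<forall>A\<in>msum_carrier N d. \<forall>B\<in>msum_carrier N d. P (msum_add N A B) = msum_add N (P A) (P B)) \<and>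
     (\<forall>c. \<forall>A\<in>msum_carrier N d. P (msum_smult N c A) = msum_smult N c (P A)) \<and>
     (\<forall>B\<in>\<B>. P B = B) \<and>
     (\<forall>A\<in>msum_carrier N d. msum_norm N (P A) \<le> msum_norm N A)"

text \<open>The state-preserving conditional expectation onto a unital C*-subalgebra exists and is
  unique; it is made extensional on the direct sum, so that the description below is definite.\<close>

definition cond_exp ::
  "nat \<Rightarrow> (nat \<Rightarrow> nat) \<Rightarrow> (nat \<Rightarrow> real) \<Rightarrow> msum set \<Rightarrow> msum \<Rightarrow> msum" where
  "cond_exp N d v \<B> =
     (THE P. is_cond_exp N d \<B> P \<and>
        (\<forall>A\<in>msum_carrier N d. tracial_state N d v (P A) = tracial_state N d v A))"

definition fr_norm :: "nat \<Rightarrow> (nat \<Rightarrow> nat) \<Rightarrow> (nat \<Rightarrow> real) \<Rightarrow> msum set \<Rightarrow> msum \<Rightarrow> real" where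
  "fr_norm N d v \<B> A =
     sqrt (msum_norm N (cond_exp N d v \<B> (msum_mult N (msum_adjoint N A) A)))"

end

theory Submission
  imports Defs
begin

text \<open>
  Write \<open>\<tau>\<close> for the tracial state and \<open>E\<close> for the orthogonal projection onto \<open>\<B>\<close> with respect to
  \<open>\<langle>A, B\<rangle> = \<tau> (B* A)\<close>. For \<open>C \<in> \<B>\<close> and \<open>X\<close> positive,
  \<open>\<tau> (C* X C) = \<tau> (C* E(X) C) \<le> \<parallel>E(X)\<parallel> \<tau> (C* C)\<close>. Let \<open>u\<close> be the restriction of a vector to one
  diagonal block of the \<open>k\<close>-th summand. There is \<open>C \<in> \<B>\<close> that has \<open>u\<close> as a column and only
  involves basis elements touching the \<open>k\<close>-th summand, so that
  \<open>\<tau> (C* C) \<le> \<gamma> l \<parallel>u\<parallel>\<^sup>2\<close>, while \<open>\<tau> (C* X C) \<ge> \<alpha> \<langle>X u, u\<rangle>\<close>. Summing over the at most \<open>r\<close> blocks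
  and using \<open>\<langle>X (\<Sum>u), \<Sum>u\<rangle> \<le> r \<Sum> \<langle>X u, u\<rangle>\<close> bounds \<open>\<parallel>X\<parallel>\<close>.

  \<open>E\<close> is contractive because \<open>E(A) B = E(A B)\<close> for \<open>B \<in> \<B>\<close>. Conversely a trace-preserving
  contractive projection \<open>P\<close> onto \<open>\<B>\<close> equals \<open>E\<close>: for self-adjoint \<open>b \<in> \<B>\<close> and \<open>a\<close>, expanding
  contractivity of \<open>P\<close> at perturbations of the unit and of \<open>exp (\<i> s b)\<close> in the direction of \<open>a\<close>
  gives \<open>\<tau> (P(a) b) = \<tau> (a b)\<close>.
\<close>

section \<open>Direct sums of matrices of arbitrary finite size\<close>

text \<open>\<open>cond_exp\<close> is a definite description, so nothing is known about it before
  existence and uniqueness are both proved. Uniqueness is the obstacle: \<open>is_cond_exp\<close>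
  grants linearity, idempotence and contractivity, whereas orthogonality of the projection would
  usually come from the module property P(A B) = P(A) B for B in \<B>. Expanding contractivity to
  second order and using the trace yields orthogonality without passing through Tomiyama's theorem.
  All estimates take place in one inner product space, \<open>bmat\<close> with the weighted trace
  form, on which the direct sum acts by left multiplication. This action is columnwise, so its norm
  is the operator norm, and a vector is an element with a single column. No spectral theory or
  functional calculus is used: growth of powers replaces the spectral radius, and a quadratic
  polynomial replaces the exponential. As for the constants: l bounds the number of copies of a
  block that C must carry, r the number of pieces of a vector, \<gamma> the squared norms of the
  basis elements, and \<alpha> bounds the weights from below.\<close>

definition inside :: "nat \<Rightarrow> (nat \<Rightarrow> nat \<Rightarrow> nat \<Rightarrow> complex) \<Rightarrow> bool" where
  "inside n f \<longleftrightarrow> (\<forall>k i j. f k i j \<noteq> 0 \<longrightarrow> k < n \<and> i < n \<and> j < n)"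

text \<open>Families of matrices supported at finitely many positions: a ring type that contains every
  direct sum, for all \<open>N\<close> and \<open>d\<close>, as a corner.\<close>
typedef bmat = "{f :: nat \<Rightarrow> nat \<Rightarrow> nat \<Rightarrow> complex. \<exists>n. inside n f}"
  morphisms entry Bmat
  by (rule exI[of _ "\<lambda>k i j. 0"]) (auto simp: inside_def)


lemma inside_mono: "inside n f \<Longrightarrow> n \<le> n' \<Longrightarrow> inside n' f"
  unfolding inside_def by (meson order_less_le_trans)

lemma ex_inside: "\<exists>n. inside n (entry x)"
  using entry[of x] by simp

lemma ex_inside2: "\<exists>n. inside n (entry x) \<and> inside n (entry y)"
proof -
  obtain a b where "inside a (entry x)" "inside b (entry y)" using ex_inside by blast
  then show ?thesis using inside_mono[of _ _ "max a b"] by (meson max.cobounded1 max.cobounded2)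
qed

lemma ex_inside3: "\<exists>n. inside n (entry x) \<and> inside n (entry y) \<and> inside n (entry z)"
proof -
  obtain a b where "inside a (entry x)" "inside a (entry y)" "inside b (entry z)" 
    using ex_inside ex_inside2 by meson
  then show ?thesis using inside_mono[of _ _ "max a b"] by (meson max.cobounded1 max.cobounded2)
qed

lemma bmat_eqI: "(\<And>k i j. entry x k i j = entry y k i j) \<Longrightarrow> x = y"
  by (metis entry_inject ext)

lemma entry_Bmat: "inside n f \<Longrightarrow> entry (Bmat f) = f"
  by (rule Bmat_inverse) auto

definition bsize :: "bmat \<Rightarrow> nat" where "bsize x = (SOME n. inside n (entry x))"

lemma inside_bsize: "inside (bsize x) (entry x)"
  unfolding bsize_def using someI_ex[OF ex_inside] .

text \<open>Products and inner products are defined by sums up to the arbitrarily chosen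
  \<open>bsize x\<close>; this makes them independent of that choice.\<close>

lemma sum_bound_eq:
  fixes f :: "nat \<Rightarrow> 'a::comm_monoid_add"
  assumes "\<And>l. f l \<noteq> 0 \<Longrightarrow> l < a \<and> l < b"
  shows "sum f {..<a} = sum f {..<b}"
proof -
  have "sum f {..<a} = sum f {l. l < a \<and> l < b}" using assms by (intro sum.mono_neutral_right) auto
  also have "\<dots> = sum f {..<b}" using assms by (intro sum.mono_neutral_left) auto
  finally show ?thesis .
qed

instantiation bmat :: ring
begin

definition zero_bmat :: bmat where "0 = Bmat (\<lambda>k i j. 0)"
definition plus_bmat :: "bmat \<Rightarrow> bmat \<Rightarrow> bmat" where
  "x + y = Bmat (\<lambda>k i j. entry x k i j + entry y k i j)"
definition minus_bmat :: "bmat \<Rightarrow> bmat \<Rightarrow> bmat" where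
  "x - y = Bmat (\<lambda>k i j. entry x k i j - entry y k i j)"
definition uminus_bmat :: "bmat \<Rightarrow> bmat" where
  "- x = Bmat (\<lambda>k i j. - entry x k i j)"
definition times_bmat :: "bmat \<Rightarrow> bmat \<Rightarrow> bmat" where
  "x * y = Bmat (\<lambda>k i j. \<Sum>l<bsize x. entry x k i l * entry y k l j)"

lemma entry_zero [simp]: "entry 0 k i j = 0"
  unfolding zero_bmat_def by (subst entry_Bmat[of 0]) (auto simp: inside_def)

lemma entry_plus [simp]: "entry (x + y) k i j = entry x k i j + entry y k i j"
proof -
  obtain n where "inside n (entry x)" "inside n (entry y)" using ex_inside2 by blast
  then show ?thesis unfolding plus_bmat_def 
    by (subst entry_Bmat[of n]) (auto simp: inside_def, (metis add.right_neutral)+)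
qed

lemma entry_minus [simp]: "entry (x - y) k i j = entry x k i j - entry y k i j"
proof -
  obtain n where "inside n (entry x)" "inside n (entry y)" using ex_inside2 by blast
  then show ?thesis unfolding minus_bmat_def 
    by (subst entry_Bmat[of n]) (auto simp: inside_def, (metis diff_zero)+)
qed

lemma entry_uminus [simp]: "entry (- x) k i j = - entry x k i j"
proof -
  obtain n where "inside n (entry x)" using ex_inside by blast
  then show ?thesis unfolding uminus_bmat_def 
    by (subst entry_Bmat[of n]) (auto simp: inside_def)
qed

lemma entry_times_bsize: "entry (x * y) k i j = (\<Sum>l<bsize x. entry x k i l * entry y k l j)"
proof -
  obtain n where n: "inside n (entry x)" "inside n (entry y)" using ex_inside2 by blast
  have "inside n (\<lambda>k i j. \<Sum>l<bsize x. entry x k i l * entry y k l j)"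
    unfolding inside_def
  proof (intro allI impI)
    fix k i j assume "(\<Sum>l<bsize x. entry x k i l * entry y k l j) \<noteq> 0"
    then obtain l where "entry x k i l * entry y k l j \<noteq> 0" by (meson sum.neutral)
    then show "k < n \<and> i < n \<and> j < n" using n by (auto simp: inside_def)
  qed
  then show ?thesis unfolding times_bmat_def by (subst entry_Bmat) auto
qed

lemma entry_times:
  assumes "\<And>l. entry x k i l * entry y k l j \<noteq> 0 \<Longrightarrow> l < n"
  shows "entry (x * y) k i j = (\<Sum>l<n. entry x k i l * entry y k l j)"
  unfolding entry_times_bsize
  by (rule sum_bound_eq) (use assms inside_bsize[of x] in \<open>auto simp: inside_def\<close>)

lemma entry_times_inside:
  assumes "inside n (entry x) \<or> inside n (entry y)"
  shows "entry (x * y) k i j = (\<Sum>l<n. entry x k i l * entry y k l j)"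
  by (rule entry_times) (use assms in \<open>auto simp: inside_def\<close>)

lemma inside_times: "inside n (entry x) \<Longrightarrow> inside n (entry y) \<Longrightarrow> inside n (entry (x * y))"
  unfolding inside_def 
proof (intro allI impI)
    fix k i j assume "entry (x * y) k i j \<noteq> 0" and n: "\<forall>k i j. entry x k i j \<noteq> 0 \<longrightarrow> k < n \<and> i < n \<and> j < n"
      "\<forall>k i j. entry y k i j \<noteq> 0 \<longrightarrow> k < n \<and> i < n \<and> j < n"
    then obtain l where "entry x k i l * entry y k l j \<noteq> 0" 
      unfolding entry_times_bsize by (meson sum.neutral)
    then show "k < n \<and> i < n \<and> j < n" using n by auto
qed

instance
proof
  fix a b c :: bmat
  obtain n where n: "inside n (entry a)" "inside n (entry b)" "inside n (entry c)" using ex_inside3 by blast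
  note nn = entry_times_inside[of n]
  show "a * b * c = a * (b * c)"
  proof (rule bmat_eqI)
    fix k i j
    have "entry (a * b * c) k i j = (\<Sum>l<n. \<Sum>t<n. entry a k i t * entry b k t l * entry c k l j)"
      by (simp add: nn n sum_distrib_right)
    also have "\<dots> = (\<Sum>t<n. \<Sum>l<n. entry a k i t * entry b k t l * entry c k l j)" by (rule sum.swap)
    also have "\<dots> = entry (a * (b * c)) k i j"
      by (simp add: nn n sum_distrib_left mult.assoc)
    finally show "entry (a * b * c) k i j = entry (a * (b * c)) k i j" .
  qed
  show "(a + b) * c = a * c + b * c"
    by (rule bmat_eqI) (simp add: nn[OF disjI2[OF n(3)]] distrib_right sum.distrib)
  show "a * (b + c) = a * b + a * c"
    by (rule bmat_eqI) (simp add: nn[OF disjI1[OF n(1)]] distrib_left sum.distrib)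
  show "a + b + c = a + (b + c)" by (rule bmat_eqI) simp
  show "a + b = b + a" by (rule bmat_eqI) simp
  show "0 + a = a" by (rule bmat_eqI) simp
  show "- a + a = 0" by (rule bmat_eqI) simp
  show "a - b = a + - b" by (rule bmat_eqI) simp
qed

end

definition cscale :: "complex \<Rightarrow> bmat \<Rightarrow> bmat" (infixr "*\<^sub>C" 75) where
  "c *\<^sub>C x = Bmat (\<lambda>k i j. c * entry x k i j)"

lemma entry_cscale [simp]: "entry (c *\<^sub>C x) k i j = c * entry x k i j"
proof -
  obtain n where "inside n (entry x)" using ex_inside by blast
  then show ?thesis unfolding cscale_def 
    by (subst entry_Bmat[of n]) (auto simp: inside_def)
qed

definition adj :: "bmat \<Rightarrow> bmat" where
  "adj x = Bmat (\<lambda>k i j. cnj (entry x k j i))"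

lemma entry_adj [simp]: "entry (adj x) k i j = cnj (entry x k j i)"
proof -
  obtain n where "inside n (entry x)" using ex_inside by blast
  then show ?thesis unfolding adj_def 
    by (subst entry_Bmat[of n]) (auto simp: inside_def)
qed

lemma inside_adj: "inside n (entry x) \<Longrightarrow> inside n (entry (adj x))"
  by (auto simp: inside_def)

lemma cscale_add_left: "(c + d) *\<^sub>C x = c *\<^sub>C x + d *\<^sub>C x"
  by (rule bmat_eqI) (simp add: algebra_simps)
lemma cscale_cscale [simp]: "c *\<^sub>C d *\<^sub>C x = (c * d) *\<^sub>C x"
  by (rule bmat_eqI) simp
lemma cscale_one [simp]: "1 *\<^sub>C x = x"
  by (rule bmat_eqI) simp
lemma cscale_zero [simp]: "0 *\<^sub>C x = 0"
  by (rule bmat_eqI) simp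
lemma cscale_minus_one: "(-1) *\<^sub>C x = - x"
  by (rule bmat_eqI) simp
lemma entry_sum [simp]: "entry (\<Sum>a\<in>A. f a) k i j = (\<Sum>a\<in>A. entry (f a) k i j)"
  by (induction A rule: infinite_finite_induct) auto
lemma cscale_times_left [simp]: "(c *\<^sub>C x) * y = c *\<^sub>C (x * y)"
proof -
  obtain n where n: "inside n (entry x)" "inside n (entry y)" using ex_inside2 by blast
  show ?thesis by (rule bmat_eqI) (simp add: entry_times_inside[of n] n sum_distrib_left mult.assoc)
qed
lemma cscale_times_right [simp]: "x * (c *\<^sub>C y) = c *\<^sub>C (x * y)"
proof -
  obtain n where n: "inside n (entry x)" "inside n (entry y)" using ex_inside2 by blast
  show ?thesis 
    by (rule bmat_eqI) (simp add: entry_times_inside[of n] n sum_distrib_left mult.left_commute)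
qed
lemma adj_adj [simp]: "adj (adj x) = x"
  by (rule bmat_eqI) simp
lemma adj_add: "adj (x + y) = adj x + adj y"
  by (rule bmat_eqI) simp
lemma adj_diff: "adj (x - y) = adj x - adj y"
  by (rule bmat_eqI) simp
lemma adj_cscale: "adj (c *\<^sub>C x) = cnj c *\<^sub>C adj x"
  by (rule bmat_eqI) simp
lemma adj_times: "adj (x * y) = adj y * adj x"
proof -
  obtain n where n: "inside n (entry x)" "inside n (entry y)" using ex_inside2 by blast
  show ?thesis 
    by (rule bmat_eqI) (simp add: entry_times_inside[of n] n inside_adj mult.commute)
qed

lemma sum_mult_square_le:
  fixes f g :: "'a \<Rightarrow> real"
  assumes "\<And>i. i \<in> A \<Longrightarrow> 0 \<le> f i" "\<And>i. i \<in> A \<Longrightarrow> 0 \<le> g i"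
  shows "(\<Sum>i\<in>A. f i * g i)\<^sup>2 \<le> (\<Sum>i\<in>A. (f i)\<^sup>2) * (\<Sum>i\<in>A. (g i)\<^sup>2)"
proof -
  have "(\<Sum>i\<in>A. f i * g i) = (\<Sum>i\<in>A. \<bar>f i\<bar> * \<bar>g i\<bar>)" using assms by (intro sum.cong) auto
  also have "\<dots> \<le> L2_set f A * L2_set g A" by (rule L2_set_mult_ineq)
  finally have "(\<Sum>i\<in>A. f i * g i)\<^sup>2 \<le> (L2_set f A * L2_set g A)\<^sup>2"
    using assms by (intro power_mono sum_nonneg mult_nonneg_nonneg) auto
  also have "\<dots> = (\<Sum>i\<in>A. (f i)\<^sup>2) * (\<Sum>i\<in>A. (g i)\<^sup>2)"
    by (simp add: power_mult_distrib L2_set_def sum_nonneg)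
  finally show ?thesis .
qed

section \<open>The weighted trace form and the norm of left multiplications\<close>

locale weighted =
  fixes w :: "nat \<Rightarrow> real"
  assumes w_pos: "w k > 0"
begin

text \<open>With the weights \<open>v k / d k\<close> this is \<tau>(y* x) on the direct sum. It is
  defined on all of \<open>bmat\<close>, so that single columns can serve as test elements.\<close>

definition ip :: "bmat \<Rightarrow> bmat \<Rightarrow> complex" where
  "ip x y = (\<Sum>k<bsize x. \<Sum>j<bsize x. \<Sum>i<bsize x. of_real (w k) * (entry x k i j * cnj (entry y k i j)))"

text \<open>Separate bounds for summand, column and row are allowed because left multiplication by
  the direct sum confines summand and row but not the column.\<close>

lemma ip_inside_gen:
  assumes "\<And>k i j. entry x k i j * entry y k i j \<noteq> 0 \<Longrightarrow> k < n \<and> j < n' \<and> i < n''"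
  shows "ip x y = (\<Sum>k<n. \<Sum>j<n'. \<Sum>i<n''. of_real (w k) * (entry x k i j * cnj (entry y k i j)))"
proof -
  let ?t = "\<lambda>k i j. of_real (w k) * (entry x k i j * cnj (entry y k i j))"
  have t: "k < n \<and> j < n' \<and> i < n'' \<and> k < bsize x \<and> j < bsize x \<and> i < bsize x" if "?t k i j \<noteq> 0" for k i j
    using that assms[of k i j] inside_bsize[of x] by (auto simp: inside_def)
  have "(\<Sum>i<bsize x. ?t k i j) = (\<Sum>i<n''. ?t k i j)" for k j
    using t by (intro sum_bound_eq) blast
  then have "ip x y = (\<Sum>k<bsize x. \<Sum>j<bsize x. \<Sum>i<n''. ?t k i j)" unfolding ip_def by simp
  also have "(\<Sum>j<bsize x. \<Sum>i<n''. ?t k i j) = (\<Sum>j<n'. \<Sum>i<n''. ?t k i j)" for k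
    using t by (intro sum_bound_eq) (meson sum.neutral)
  then have "(\<Sum>k<bsize x. \<Sum>j<bsize x. \<Sum>i<n''. ?t k i j) = (\<Sum>k<bsize x. \<Sum>j<n'. \<Sum>i<n''. ?t k i j)" by simp
  also have "\<dots> = (\<Sum>k<n. \<Sum>j<n'. \<Sum>i<n''. ?t k i j)"
    using t by (intro sum_bound_eq) (meson sum.neutral)
  finally show ?thesis .
qed

lemma ip_inside:
  assumes "inside n (entry x) \<or> inside n (entry y)"
  shows "ip x y = (\<Sum>k<n. \<Sum>j<n. \<Sum>i<n. of_real (w k) * (entry x k i j * cnj (entry y k i j)))"
  by (rule ip_inside_gen) (use assms in \<open>auto simp: inside_def\<close>)

lemma ip_commute: "ip y x = cnj (ip x y)"
proof -
  obtain n where n: "inside n (entry x)" "inside n (entry y)" using ex_inside2 by blast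
  then show ?thesis by (simp add: ip_inside[of n] mult.commute)
qed

lemma ip_add_left: "ip (x + y) z = ip x z + ip y z"
proof -
  obtain n where n: "inside n (entry x)" "inside n (entry y)"  "inside n (entry z)" using ex_inside3 by blast
  then show ?thesis by (simp add: ip_inside[of n] algebra_simps sum.distrib)
qed

lemma ip_cscale_left [simp]: "ip (c *\<^sub>C x) z = c * ip x z"
proof -
  obtain n where n: "inside n (entry x)" "inside n (entry z)" using ex_inside2 by blast
  then show ?thesis by (simp add: ip_inside[of n] sum_distrib_left mult.left_commute mult.assoc)
qed

lemma ip_add_right: "ip z (x + y) = ip z x + ip z y"
  using ip_add_left[of x y z] by (metis complex_cnj_add ip_commute)

lemma ip_cscale_right [simp]: "ip z (c *\<^sub>C x) = cnj c * ip z x"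
  by (metis complex_cnj_mult ip_commute ip_cscale_left)

lemma ip_minus_left [simp]: "ip (- x) z = - ip x z"
  using ip_cscale_left[of "-1" x z] by (simp add: cscale_minus_one)
lemma ip_minus_right [simp]: "ip z (- x) = - ip z x"
  using ip_cscale_right[of z "-1" x] by (simp add: cscale_minus_one)
lemma ip_diff_left: "ip (x - y) z = ip x z - ip y z"
  using ip_add_left[of x "-y" z] by simp
lemma ip_diff_right: "ip z (x - y) = ip z x - ip z y"
  using ip_add_right[of z x "-y"] by simp
lemma ip_zero_left [simp]: "ip 0 z = 0"
  using ip_cscale_left[of 0 0 z] by simp
lemma ip_zero_right [simp]: "ip z 0 = 0"
  using ip_cscale_right[of z 0 0] by simp
lemma ip_sum_left: "ip (\<Sum>a\<in>A. f a) z = (\<Sum>a\<in>A. ip (f a) z)"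
  by (induction A rule: infinite_finite_induct) (auto simp: ip_add_left)
lemma ip_sum_right: "ip z (\<Sum>a\<in>A. f a) = (\<Sum>a\<in>A. ip z (f a))"
  by (induction A rule: infinite_finite_induct) (auto simp: ip_add_right)

lemma ip_times_left: "ip (a * x) y = ip x (adj a * y)"
proof -
  obtain n where n: "inside n (entry a)" "inside n (entry x)"  "inside n (entry y)" using ex_inside3 by blast
  have "ip (a * x) y = (\<Sum>k<n. \<Sum>j<n. \<Sum>i<n. \<Sum>l<n. of_real (w k) * (entry a k i l * entry x k l j * cnj (entry y k i j)))"
    by (simp add: ip_inside[of n] n entry_times_inside[of n] sum_distrib_left sum_distrib_right mult.assoc)
  also have "\<dots> = (\<Sum>k<n. \<Sum>j<n. \<Sum>l<n. \<Sum>i<n. of_real (w k) * (entry a k i l * entry x k l j * cnj (entry y k i j)))"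
    by (subst sum.swap) (rule refl)
  also have "\<dots> = ip x (adj a * y)"
    by (simp add: ip_inside[of n] n inside_adj entry_times_inside[of n] sum_distrib_left sum_distrib_right mult_ac)
  finally show ?thesis .
qed

text \<open>This is traciality: right multiplication has the expected adjoint because the weight
  depends on the summand \<open>k\<close> and not on the position inside it.\<close>

lemma ip_times_right: "ip (x * b) y = ip x (y * adj b)"
proof -
  obtain n where n: "inside n (entry b)" "inside n (entry x)"  "inside n (entry y)" using ex_inside3 by blast
  have "ip (x * b) y = (\<Sum>k<n. \<Sum>j<n. \<Sum>i<n. \<Sum>l<n. of_real (w k) * (entry x k i l * entry b k l j * cnj (entry y k i j)))"
    by (simp add: ip_inside[of n] n entry_times_inside[of n] sum_distrib_left sum_distrib_right mult.assoc)
  also have "\<dots> = (\<Sum>k<n. \<Sum>l<n. \<Sum>i<n. \<Sum>j<n. of_real (w k) * (entry x k i l * entry b k l j * cnj (entry y k i j)))"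
  proof (rule sum.cong[OF refl])
    fix k
    let ?f = "\<lambda>i j l. of_real (w k) * (entry x k i l * entry b k l j * cnj (entry y k i j))"
    have "(\<Sum>j<n. \<Sum>i<n. \<Sum>l<n. ?f i j l) = (\<Sum>j<n. \<Sum>l<n. \<Sum>i<n. ?f i j l)" by (subst sum.swap) (rule refl)
    also have "\<dots> = (\<Sum>l<n. \<Sum>j<n. \<Sum>i<n. ?f i j l)" by (rule sum.swap)
    also have "\<dots> = (\<Sum>l<n. \<Sum>i<n. \<Sum>j<n. ?f i j l)" by (rule sum.cong[OF refl], rule sum.swap)
    finally show "(\<Sum>j<n. \<Sum>i<n. \<Sum>l<n. ?f i j l) = (\<Sum>l<n. \<Sum>i<n. \<Sum>j<n. ?f i j l)" .
  qed
  also have "\<dots> = ip x (y * adj b)"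
    by (simp add: ip_inside[of n] n inside_adj entry_times_inside[of n] sum_distrib_left sum_distrib_right mult_ac)
  finally show ?thesis .
qed

definition nrm2 :: "bmat \<Rightarrow> real" where "nrm2 x = sqrt (Re (ip x x))"

lemma ip_self: 
  assumes "inside n (entry x)"
  shows "ip x x = of_real (\<Sum>k<n. \<Sum>j<n. \<Sum>i<n. w k * (cmod (entry x k i j))\<^sup>2)"
  unfolding ip_inside[OF disjI1[OF assms]] of_real_sum of_real_mult complex_norm_square ..

lemma ip_self_ge: "Re (ip x x) \<ge> 0"
proof -
  obtain n where n: "inside n (entry x)" using ex_inside by blast
  show ?thesis by (subst ip_self[OF n]) (auto intro!: sum_nonneg mult_nonneg_nonneg less_imp_le[OF w_pos])
qed

lemma nrm2_ge [simp]: "nrm2 x \<ge> 0" by (simp add: nrm2_def ip_self_ge)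

lemma nrm2_sq: "(nrm2 x)\<^sup>2 = Re (ip x x)" by (simp add: nrm2_def ip_self_ge)

lemma ip_eq_nrm2: "ip x x = of_real ((nrm2 x)\<^sup>2)"
proof -
  obtain n where n: "inside n (entry x)" using ex_inside by blast
  show ?thesis unfolding nrm2_sq by (subst (1 2) ip_self[OF n]) simp
qed

lemma ip_self_eq_0: "ip x x = 0 \<longleftrightarrow> x = 0"
proof
  assume x: "ip x x = 0"
  obtain n where n: "inside n (entry x)" using ex_inside by blast
  let ?t = "\<lambda>k i j. w k * (cmod (entry x k i j))\<^sup>2"
  have t: "?t k i j \<ge> 0" for k i j by (auto intro!: mult_nonneg_nonneg less_imp_le[OF w_pos])
  have "(\<Sum>k<n. \<Sum>j<n. \<Sum>i<n. ?t k i j) = 0"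
    using x unfolding ip_self[OF n] of_real_eq_0_iff .
  then have 0: "\<forall>k<n. \<forall>j<n. \<forall>i<n. ?t k i j = 0"
    using t by (simp only: sum_nonneg_eq_0_iff sum_nonneg finite_lessThan) auto
  show "x = 0"
  proof (rule bmat_eqI)
    fix k i j
    show "entry x k i j = entry 0 k i j"
    proof (rule ccontr)
      assume e: "entry x k i j \<noteq> entry 0 k i j"
      then have "w k * (cmod (entry x k i j))\<^sup>2 \<noteq> 0" using w_pos[of k] by simp
      moreover have "k < n \<and> i < n \<and> j < n" using e n by (auto simp: inside_def)
      ultimately show False using 0 by blast
    qed
  qed
qed simp

lemma ip_cauchy: "cmod (ip x y) \<le> nrm2 x * nrm2 y"
proof (cases "y = 0")
  case True then show ?thesis by (simp add: nrm2_def)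
next
  case False
  then have y: "(nrm2 y)\<^sup>2 \<noteq> 0" using ip_self_eq_0[of y] by (simp add: ip_eq_nrm2)
  let ?c = "ip x y / of_real ((nrm2 y)\<^sup>2)"
  have yx: "ip y x = cnj (ip x y)" by (rule ip_commute)
  have "ip (x - ?c *\<^sub>C y) (x - ?c *\<^sub>C y) = ip x x - ip x y * cnj (ip x y) / of_real ((nrm2 y)\<^sup>2)"
    using y by (simp add: ip_diff_left ip_diff_right ip_eq_nrm2[of y] yx field_simps)
  also have "\<dots> = of_real ((nrm2 x)\<^sup>2 - (cmod (ip x y))\<^sup>2 / (nrm2 y)\<^sup>2)"
    by (simp only: ip_eq_nrm2[of x] complex_norm_square of_real_diff of_real_divide)
  finally have "0 \<le> (nrm2 x)\<^sup>2 - (cmod (ip x y))\<^sup>2 / (nrm2 y)\<^sup>2"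
    using ip_self_ge[of "x - ?c *\<^sub>C y"] by simp
  then have "(cmod (ip x y))\<^sup>2 \<le> (nrm2 x * nrm2 y)\<^sup>2"
    using y by (simp add: field_simps power_mult_distrib)
  then show ?thesis by (rule power2_le_imp_le) simp
qed

text \<open>c bounds the operator norm of left multiplication by \<open>a\<close>, without a
  supremum being formed.\<close>

definition bnd :: "real \<Rightarrow> bmat \<Rightarrow> bool" where
  "bnd c a \<longleftrightarrow> 0 \<le> c \<and> (\<forall>x. nrm2 (a * x) \<le> c * nrm2 x)"

lemma nrm2_adj: "nrm2 (adj x) = nrm2 x"
proof -
  obtain n where n: "inside n (entry x)" using ex_inside by blast
  have "(\<Sum>k<n. \<Sum>j<n. \<Sum>i<n. w k * (cmod (entry x k i j))\<^sup>2) = (\<Sum>k<n. \<Sum>j<n. \<Sum>i<n. w k * (cmod (entry x k j i))\<^sup>2)"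
    by (rule sum.cong[OF refl], rule sum.swap)
  then show ?thesis unfolding nrm2_def ip_self[OF n] ip_self[OF inside_adj[OF n]] by simp
qed

text \<open>Cauchy-Schwarz in each entry bounds left multiplication by the Hilbert-Schmidt norm.
  Multiplication stays inside each summand, so \<open>h\<close> needs no weights.\<close>

lemma ex_bnd: "\<exists>c. bnd c a"
proof -
  obtain m where m: "inside m (entry a)" using ex_inside by blast
  define h where "h = (\<Sum>k<m. \<Sum>l<m. \<Sum>i<m. (cmod (entry a k i l))\<^sup>2)"
  \<comment> \<open>The bound must not depend on n, because n will also have to enclose the support
    of the test element x.\<close>
  have h: "(\<Sum>i<n. \<Sum>l<n. (cmod (entry a k i l))\<^sup>2) \<le> h" for k n
  proof (cases "k < m")
    case True
    have "(\<Sum>i<n. \<Sum>l<n. (cmod (entry a k i l))\<^sup>2) = (\<Sum>(i,l)\<in>{..<n}\<times>{..<n}. (cmod (entry a k i l))\<^sup>2)"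
      by (simp add: sum.cartesian_product)
    also have "\<dots> \<le> (\<Sum>(i,l)\<in>{..<max m n}\<times>{..<max m n}. (cmod (entry a k i l))\<^sup>2)"
      by (intro sum_mono2) auto
    also have "\<dots> = (\<Sum>(i,l)\<in>{..<m}\<times>{..<m}. (cmod (entry a k i l))\<^sup>2)"
      using m by (intro sum.mono_neutral_right) (auto simp: inside_def)
    also have "\<dots> = (\<Sum>i<m. \<Sum>l<m. (cmod (entry a k i l))\<^sup>2)" by (simp add: sum.cartesian_product)
    also have "\<dots> = (\<Sum>l<m. \<Sum>i<m. (cmod (entry a k i l))\<^sup>2)" by (rule sum.swap)
    also have "\<dots> \<le> h" unfolding h_def using True by (intro member_le_sum) (auto intro!: sum_nonneg)
    finally show ?thesis .
  next
    case False
    then have "entry a k i l = 0" for i l using m by (auto simp: inside_def)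
    then show ?thesis by (simp add: h_def sum_nonneg)
  qed
  have "bnd (sqrt h) a"
    unfolding bnd_def
  proof (intro conjI allI)
    show "0 \<le> sqrt h" by (simp add: h_def sum_nonneg)
    fix x
    obtain n where n: "inside n (entry a)" "inside n (entry x)" using ex_inside2 by blast
    have *: "(cmod (entry (a * x) k i j))\<^sup>2 \<le> (\<Sum>l<n. (cmod (entry a k i l))\<^sup>2) * (\<Sum>l<n. (cmod (entry x k l j))\<^sup>2)" for k i j
    proof -
      have "cmod (entry (a * x) k i j) \<le> (\<Sum>l<n. cmod (entry a k i l) * cmod (entry x k l j))"
        unfolding entry_times_inside[OF disjI1[OF n(1)]] by (rule sum_norm_le) (simp add: norm_mult)
      then have "(cmod (entry (a * x) k i j))\<^sup>2 \<le> (\<Sum>l<n. cmod (entry a k i l) * cmod (entry x k l j))\<^sup>2"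
        by (rule power_mono) simp
      also have "\<dots> \<le> (\<Sum>l<n. (cmod (entry a k i l))\<^sup>2) * (\<Sum>l<n. (cmod (entry x k l j))\<^sup>2)"
        by (rule sum_mult_square_le) auto
      finally show ?thesis .
    qed
    have "(nrm2 (a * x))\<^sup>2 = (\<Sum>k<n. \<Sum>j<n. \<Sum>i<n. w k * (cmod (entry (a * x) k i j))\<^sup>2)"
      unfolding nrm2_sq ip_self[OF inside_times[OF n]] by simp
    also have "\<dots> \<le> (\<Sum>k<n. \<Sum>j<n. \<Sum>i<n. w k * ((\<Sum>l<n. (cmod (entry a k i l))\<^sup>2) * (\<Sum>l<n. (cmod (entry x k l j))\<^sup>2)))"
      by (intro sum_mono mult_left_mono * less_imp_le[OF w_pos])
    also have "\<dots> = (\<Sum>k<n. \<Sum>j<n. (\<Sum>i<n. \<Sum>l<n. (cmod (entry a k i l))\<^sup>2) * (w k * (\<Sum>l<n. (cmod (entry x k l j))\<^sup>2)))"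
    proof -
      have "(\<Sum>i<n. c * (f i * e)) = (\<Sum>i<n. f i) * (c * e)" for c e :: real and f
        by (simp add: sum_distrib_left mult_ac)
      then show ?thesis by simp
    qed
    also have "\<dots> \<le> (\<Sum>k<n. \<Sum>j<n. h * (w k * (\<Sum>l<n. (cmod (entry x k l j))\<^sup>2)))"
      by (intro sum_mono mult_right_mono h mult_nonneg_nonneg less_imp_le[OF w_pos] sum_nonneg) auto
    also have "\<dots> = h * (nrm2 x)\<^sup>2"
      unfolding nrm2_sq ip_self[OF n(2)] by (simp add: sum_distrib_left)
    finally show "nrm2 (a * x) \<le> sqrt h * nrm2 x"
      by (metis abs_of_nonneg nrm2_ge real_le_rsqrt real_sqrt_abs real_sqrt_mult)
  qed
  then show ?thesis ..
qed

end

section \<open>Trace-preserving conditional expectations\<close>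

text \<open>Log-convexity makes the ratios u (n+1) / u n nondecreasing, so u grows at least like the
  powers of \<mu> = u 1 / u 0; growth at rate q then forces \<mu> \<le> q. Applied to the norms of
  h^n x, it takes the place of the spectral radius formula.\<close>

lemma log_convex_growth:
  fixes u :: "nat \<Rightarrow> real"
  assumes u: "\<And>n. 0 \<le> u n" and convex: "\<And>n. (u (Suc n))\<^sup>2 \<le> u n * u (Suc (Suc n))"
    and growth: "\<And>n. u (Suc n) \<le> M * q ^ n" and q: "0 \<le> q"
  shows "u 1 \<le> q * u 0"
proof (rule ccontr)
  assume "\<not> ?thesis"
  then have gt: "q * u 0 < u 1" by simp
  have u0: "u 0 \<noteq> 0"
  proof
    assume "u 0 = 0"
    then have "u 1 = 0" using convex[of 0] by simp
    then show False using gt \<open>u 0 = 0\<close> by simp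
  qed
  then have u0: "u 0 > 0" using u[of 0] by linarith
  define \<mu> where "\<mu> = u 1 / u 0"
  have \<mu>: "q < \<mu>" using gt u0 by (simp add: \<mu>_def field_simps)
  have step: "0 < u n \<and> \<mu> * u n \<le> u (Suc n)" for n
  proof (induction n)
    case 0
    then show ?case using u0 by (simp add: \<mu>_def)
  next
    case (Suc n)
    have pos: "0 < u (Suc n)" using Suc \<mu> q by (smt (verit) mult_pos_pos)
    have "(\<mu> * u n) * u (Suc n) \<le> u (Suc n) * u (Suc n)"
      using Suc pos by (intro mult_right_mono) auto
    also have "\<dots> \<le> u n * u (Suc (Suc n))" using convex[of n] by (simp add: power2_eq_square)
    finally have "u n * (\<mu> * u (Suc n)) \<le> u n * u (Suc (Suc n))" by (simp add: mult_ac)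
    then have "\<mu> * u (Suc n) \<le> u (Suc (Suc n))" using Suc by simp
    then show ?case using pos by simp
  qed
  have pw: "\<mu> ^ n * u 0 \<le> u n" for n
  proof (induction n)
    case (Suc n)
    have "\<mu> ^ Suc n * u 0 = \<mu> * (\<mu> ^ n * u 0)" by simp
    also have "\<dots> \<le> \<mu> * u n" using Suc \<mu> q by (intro mult_left_mono) auto
    also have "\<dots> \<le> u (Suc n)" using step by blast
    finally show ?case .
  qed simp
  have le: "\<mu> ^ Suc n * u 0 \<le> M * q ^ n" for n using pw[of "Suc n"] growth[of n] by linarith
  show False
  proof (cases "q = 0")
    case True
    \<comment> \<open>For n = 0 the factor q ^ n is 1 even though q = 0, so n = 1 is the first
      useful instance.\<close>
    then have "\<mu> ^ Suc 1 * u 0 \<le> 0" using le[of 1] by simp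
    moreover have "0 < \<mu> ^ Suc 1 * u 0" using \<mu> q u0 by (intro mult_pos_pos zero_less_power) auto
    ultimately show False by linarith
  next
    case False
    then have q: "q > 0" using q by simp
    have "1 < \<mu> / q" using \<mu> q by simp
    then obtain n where n: "M / (\<mu> * u 0) < (\<mu> / q) ^ n" using real_arch_pow by blast
    have "(\<mu> / q) ^ n * (\<mu> * u 0) \<le> M"
      using le[of n] q by (simp add: power_divide field_simps)
    moreover have "\<mu> * u 0 > 0" using \<mu> q u0 by simp
    ultimately show False using n by (simp add: field_simps)
  qed
qed

text \<open>Letting t tend to 0 kills y. The hypothesis is what remains of a perturbation inequality
  once its first-order term has been divided by t.\<close>

lemma linear_le_quadratic_imp_zero:
  fixes y \<kappa> :: real
  assumes "\<And>t. 0 < t \<Longrightarrow> t \<le> 1 \<Longrightarrow> \<bar>y\<bar> \<le> t * \<kappa>"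
  shows "y = 0"
proof (rule ccontr)
  assume y: "y \<noteq> 0"
  have \<kappa>: "\<bar>y\<bar> \<le> \<kappa>" using assms[of 1] by simp
  then have "\<bar>y\<bar> / (2 * \<kappa>) \<le> 1" "0 < \<bar>y\<bar> / (2 * \<kappa>)" using y by (auto simp: field_simps)
  from assms[OF this(2,1)] show False using y \<kappa> by (cases "\<kappa> = 0") auto
qed

lemma sqrt_one_plus_le: "0 \<le> x \<Longrightarrow> sqrt (1 + x) \<le> 1 + x / 2"
  by (rule real_le_lsqrt) (auto simp: power2_eq_square field_simps)

context weighted
begin

lemma bndD: "bnd c a \<Longrightarrow> nrm2 (a * x) \<le> c * nrm2 x" and bnd_nonneg: "bnd c a \<Longrightarrow> 0 \<le> c"
  by (auto simp: bnd_def)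

lemma bnd_times: "bnd c a \<Longrightarrow> bnd d b \<Longrightarrow> bnd (c * d) (a * b)"
  unfolding bnd_def
proof (intro conjI allI)
  fix x assume a: "0 \<le> c \<and> (\<forall>x. nrm2 (a * x) \<le> c * nrm2 x)" "0 \<le> d \<and> (\<forall>x. nrm2 (b * x) \<le> d * nrm2 x)"
  have "nrm2 (a * b * x) \<le> c * nrm2 (b * x)" using a by (simp add: mult.assoc)
  also have "\<dots> \<le> c * (d * nrm2 x)" using a by (intro mult_left_mono) auto
  finally show "nrm2 (a * b * x) \<le> c * d * nrm2 x" by (simp add: mult.assoc)
qed auto

lemma bndI_sq:
  assumes "0 \<le> c" "\<And>x. (nrm2 (a * x))\<^sup>2 \<le> c * (nrm2 x)\<^sup>2"
  shows "bnd (sqrt c) a"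
  unfolding bnd_def
proof (intro conjI allI)
  fix x 
  have "(nrm2 (a * x))\<^sup>2 \<le> (sqrt c * nrm2 x)\<^sup>2" using assms by (simp add: power_mult_distrib)
  then show "nrm2 (a * x) \<le> sqrt c * nrm2 x" by (rule power2_le_imp_le) (use assms in simp)
qed (use assms in auto)

lemma nrm2_le_of_sq_le:
  assumes "(nrm2 x)\<^sup>2 \<le> c * nrm2 x" "0 \<le> c"
  shows "nrm2 x \<le> c"
proof (cases "nrm2 x = 0")
  case False
  then have "nrm2 x > 0" using nrm2_ge[of x] by linarith
  then show ?thesis using assms(1) by (simp add: power2_eq_square)
qed (use assms in simp)

lemma Re_ip_le: "Re (ip x y) \<le> nrm2 x * nrm2 y"
  using ip_cauchy[of x y] complex_Re_le_cmod[of "ip x y"] by linarith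

lemma nrm2_projection_times:
  assumes "adj e = e" "e * e = e"
  shows "nrm2 (e * x) \<le> nrm2 x"
proof (rule nrm2_le_of_sq_le)
  have "ip (e * x) (e * x) = ip x (e * x)" by (simp add: ip_times_left assms mult.assoc[symmetric])
  then show "(nrm2 (e * x))\<^sup>2 \<le> nrm2 x * nrm2 (e * x)" unfolding nrm2_sq by (simp add: Re_ip_le)
qed simp

text \<open>On the subalgebra \<open>S\<close> itself \<open>t\<close> is contractive because \<open>t * c\<close> is the projection of
  \<open>a * c\<close>; the powers of \<open>adj t * t\<close> transfer this to the whole algebra.\<close>
lemma bnd_projection:
  assumes t: "t \<in> S" and S_times: "\<And>x y. x \<in> S \<Longrightarrow> y \<in> S \<Longrightarrow> x * y \<in> S"
    and S_adj: "\<And>x. x \<in> S \<Longrightarrow> adj x \<in> S"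
    and orth: "\<And>c. c \<in> S \<Longrightarrow> ip t c = ip a c"
    and a: "bnd \<rho> a"
  shows "bnd \<rho> t"
proof -
  have \<rho>: "0 \<le> \<rho>" using a by (rule bnd_nonneg)
  have tc: "nrm2 (t * c) \<le> \<rho> * nrm2 c" if "c \<in> S" for c
  proof (rule nrm2_le_of_sq_le)
    have "ip (t * c) (t * c) = ip t (t * c * adj c)" by (simp add: ip_times_right)
    also have "\<dots> = ip a (t * c * adj c)" using that t by (intro orth S_times S_adj)
    also have "\<dots> = ip (a * c) (t * c)" by (simp add: ip_times_right)
    finally have "(nrm2 (t * c))\<^sup>2 \<le> nrm2 (a * c) * nrm2 (t * c)"
      unfolding nrm2_sq by (simp add: Re_ip_le)
    also have "\<dots> \<le> \<rho> * nrm2 c * nrm2 (t * c)" using bndD[OF a] by (intro mult_right_mono) auto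
    finally show "(nrm2 (t * c))\<^sup>2 \<le> \<rho> * nrm2 c * nrm2 (t * c)" .
  qed (use \<rho> in auto)
  have t'c: "nrm2 (adj t * c) \<le> \<rho> * nrm2 c" if "c \<in> S" for c
  proof (rule nrm2_le_of_sq_le)
    have "ip (adj t * c) (adj t * c) = ip c (t * (adj t * c))" by (simp add: ip_times_left)
    then have "(nrm2 (adj t * c))\<^sup>2 \<le> nrm2 c * nrm2 (t * (adj t * c))"
      unfolding nrm2_sq by (simp add: Re_ip_le)
    also have "\<dots> \<le> nrm2 c * (\<rho> * nrm2 (adj t * c))"
      using that t by (intro mult_left_mono tc S_times S_adj) auto
    finally show "(nrm2 (adj t * c))\<^sup>2 \<le> \<rho> * nrm2 c * nrm2 (adj t * c)" by (simp add: mult_ac)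
  qed (use \<rho> in auto)
  define h where "h = adj t * t"
  have h: "h \<in> S" "adj h = h" using t by (auto simp: h_def S_times S_adj adj_times)
  have hc: "nrm2 (h * c) \<le> \<rho>\<^sup>2 * nrm2 c" if "c \<in> S" for c
  proof -
    have "nrm2 (h * c) \<le> \<rho> * nrm2 (t * c)" unfolding h_def mult.assoc using that t by (intro t'c S_times)
    also have "\<dots> \<le> \<rho> * (\<rho> * nrm2 c)" using that \<rho> by (intro mult_left_mono tc)
    finally show ?thesis by (simp add: power2_eq_square mult_ac)
  qed
  \<comment> \<open>The power h^(n+1), written as an iterate since \<open>bmat\<close> has no
    unit.\<close>
  define g where "g n = (((*) h) ^^ n) h" for n
  have g: "g n \<in> S \<and> nrm2 (g n) \<le> (\<rho>\<^sup>2) ^ n * nrm2 h" for n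
  proof (induction n)
    case (Suc n)
    have "nrm2 (g (Suc n)) \<le> \<rho>\<^sup>2 * nrm2 (g n)" using hc Suc by (simp add: g_def)
    also have "\<dots> \<le> \<rho>\<^sup>2 * ((\<rho>\<^sup>2) ^ n * nrm2 h)" using Suc by (intro mult_left_mono) auto
    finally show ?case using Suc h by (simp add: g_def S_times mult_ac)
  qed (simp add: g_def h)
  show ?thesis
    unfolding bnd_def
  proof (intro conjI allI \<rho>)
    fix x
    define u where "u n = nrm2 ((((*) h) ^^ n) x)" for n
    \<comment> \<open>Here x is arbitrary, while the growth of \<open>g n\<close> is known only for
      its own norm. Taking adjoints moves x to the left, where it is a bounded operator; K depends
      on x but not on n.\<close>
    obtain K where K: "bnd K (adj x)" using ex_bnd by blast
    have gx: "(((*) h) ^^ Suc n) x = g n * x" for n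
      by (induction n) (simp_all add: g_def mult.assoc)
    have "u 1 \<le> \<rho>\<^sup>2 * u 0"
    proof (rule log_convex_growth)
      show "u n \<ge> 0" for n by (simp add: u_def)
      show "(u (Suc n))\<^sup>2 \<le> u n * u (Suc (Suc n))" for n
      proof -
        let ?y = "(((*) h) ^^ n) x"
        have "ip (h * ?y) (h * ?y) = ip ?y (h * (h * ?y))" by (simp add: ip_times_left h)
        then show ?thesis unfolding u_def nrm2_sq by (simp add: Re_ip_le)
      qed
      show "u (Suc n) \<le> (K * nrm2 h) * (\<rho>\<^sup>2) ^ n" for n
      proof -
        have "u (Suc n) = nrm2 (adj x * adj (g n))" 
          unfolding u_def gx by (metis nrm2_adj adj_times)
        also have "\<dots> \<le> K * nrm2 (adj (g n))" by (rule bndD[OF K])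
        also have "\<dots> \<le> K * ((\<rho>\<^sup>2) ^ n * nrm2 h)"
          unfolding nrm2_adj using g bnd_nonneg[OF K] by (intro mult_left_mono) auto
        finally show ?thesis by (simp add: mult_ac)
      qed
    qed simp
    have "ip (t * x) (t * x) = ip x (h * x)" by (simp add: ip_times_left h_def mult.assoc)
    then have "(nrm2 (t * x))\<^sup>2 \<le> nrm2 x * nrm2 (h * x)" unfolding nrm2_sq by (simp add: Re_ip_le)
    also have "\<dots> \<le> nrm2 x * (\<rho>\<^sup>2 * nrm2 x)"
      using \<open>u 1 \<le> \<rho>\<^sup>2 * u 0\<close> by (intro mult_left_mono) (auto simp: u_def)
    also have "\<dots> = (\<rho> * nrm2 x)\<^sup>2" by (simp add: power2_eq_square mult_ac)
    finally show "nrm2 (t * x) \<le> \<rho> * nrm2 x" by (rule power2_le_imp_le) (use \<rho> in simp)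
  qed
qed

end

section \<open>Contractive trace-preserving projections are orthogonal\<close>

text \<open>\<open>e\<close> is a unit for \<open>A\<close> only and acts on \<open>bmat\<close> as
  a projection; \<open>ip x e\<close> is the trace of x, normalised by \<open>e_nrm2\<close>.
  Contractivity is expressed through \<open>bnd\<close>, that is, through left multiplication on all
  of \<open>bmat\<close>.\<close>

locale trace_expectation = weighted +
  fixes A S :: "bmat set" and e :: bmat and p :: "bmat \<Rightarrow> bmat"
  assumes A_add: "\<And>x y. x \<in> A \<Longrightarrow> y \<in> A \<Longrightarrow> x + y \<in> A"
    and A_cscale: "\<And>c x. x \<in> A \<Longrightarrow> c *\<^sub>C x \<in> A"
    and A_times: "\<And>x y. x \<in> A \<Longrightarrow> y \<in> A \<Longrightarrow> x * y \<in> A"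
    and A_adj: "\<And>x. x \<in> A \<Longrightarrow> adj x \<in> A"
    and S_A: "S \<subseteq> A"
    and S_add: "\<And>x y. x \<in> S \<Longrightarrow> y \<in> S \<Longrightarrow> x + y \<in> S"
    and S_cscale: "\<And>c x. x \<in> S \<Longrightarrow> c *\<^sub>C x \<in> S"
    and S_times: "\<And>x y. x \<in> S \<Longrightarrow> y \<in> S \<Longrightarrow> x * y \<in> S"
    and S_adj: "\<And>x. x \<in> S \<Longrightarrow> adj x \<in> S"
    and e_S: "e \<in> S" and e_adj: "adj e = e" and e_nrm2: "nrm2 e = 1"
    and e_left: "\<And>x. x \<in> A \<Longrightarrow> e * x = x" and e_right: "\<And>x. x \<in> A \<Longrightarrow> x * e = x"
    and p_S: "\<And>x. x \<in> A \<Longrightarrow> p x \<in> S"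
    and p_add: "\<And>x y. x \<in> A \<Longrightarrow> y \<in> A \<Longrightarrow> p (x + y) = p x + p y"
    and p_cscale: "\<And>c x. x \<in> A \<Longrightarrow> p (c *\<^sub>C x) = c *\<^sub>C p x"
    and p_id: "\<And>x. x \<in> S \<Longrightarrow> p x = x"
    and p_trace: "\<And>x. x \<in> A \<Longrightarrow> ip (p x) e = ip x e"
    and p_bnd: "\<And>c x. x \<in> A \<Longrightarrow> bnd c x \<Longrightarrow> bnd c (p x)"
begin

lemma S_in_A: "x \<in> S \<Longrightarrow> x \<in> A" using S_A by blast

lemma e_A: "e \<in> A" using S_A e_S by blast

lemma ip_e_left: "ip (e * x) y = ip x (e * y)"
  by (simp add: ip_times_left e_adj)

lemma nrm2_e_times: "nrm2 (e * x) \<le> nrm2 x"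
  by (rule nrm2_projection_times) (simp_all add: e_adj e_left e_A)

lemma Im_ip_self_adjoint:
  assumes "adj a = a"
  shows "Im (ip x (a * x)) = 0" "Im (ip (a * x) x) = 0"
proof -
  have "ip (a * x) x = ip x (a * x)" by (simp add: ip_times_left assms)
  moreover have "ip (a * x) x = cnj (ip x (a * x))" by (rule ip_commute)
  ultimately show "Im (ip x (a * x)) = 0" "Im (ip (a * x) x) = 0" by (auto simp: complex_eq_iff)
qed

text \<open>For self-adjoint \<open>a\<close> the cross terms of the squared norm of (e + i
  \<epsilon> a) x cancel, so this perturbation of the unit has norm 1 up to second order in
  \<epsilon>.\<close>

lemma bnd_e_plus_skew:
  assumes a: "a \<in> A" "adj a = a" "bnd \<alpha> a"
  shows "bnd (sqrt (1 + \<epsilon>\<^sup>2 * \<alpha>\<^sup>2)) (e + (\<i> * of_real \<epsilon>) *\<^sub>C a)"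
proof (rule bndI_sq)
  fix x
  have 1: "Im (ip (e * x) (a * x)) = 0"
    using Im_ip_self_adjoint(1)[OF a(2), of x] by (simp add: ip_e_left mult.assoc[symmetric] e_left a)
  have 2: "ip (a * x) (e * x) = cnj (ip (e * x) (a * x))" by (rule ip_commute)
  have "(nrm2 ((e + (\<i> * of_real \<epsilon>) *\<^sub>C a) * x))\<^sup>2 = (nrm2 (e * x))\<^sup>2 + \<epsilon>\<^sup>2 * (nrm2 (a * x))\<^sup>2"
    unfolding nrm2_sq using 1 by (simp add: distrib_right ip_add_left ip_add_right 2 power2_eq_square)
  also have "\<dots> \<le> (nrm2 x)\<^sup>2 + \<epsilon>\<^sup>2 * (\<alpha> * nrm2 x)\<^sup>2"
    using nrm2_e_times bndD[OF a(3)] by (intro add_mono mult_left_mono power_mono) auto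
  finally show "(nrm2 ((e + (\<i> * of_real \<epsilon>) *\<^sub>C a) * x))\<^sup>2 \<le> (1 + \<epsilon>\<^sup>2 * \<alpha>\<^sup>2) * (nrm2 x)\<^sup>2"
    by (simp add: algebra_simps power_mult_distrib)
qed simp

lemma p_e_plus_skew: "a \<in> A \<Longrightarrow> p (e + c *\<^sub>C a) = e + c *\<^sub>C p a"
  by (simp add: p_add p_cscale A_cscale e_A p_id e_S)

text \<open>Contractivity of p at e + i \<epsilon> a leaves no room for a first-order term in
  \<epsilon>, and that term is the imaginary part of <p a W, W>. Thus p a behaves as a self-adjoint
  element on S.\<close>

lemma Im_ip_p_compress:
  assumes a: "a \<in> A" "adj a = a" and W: "W \<in> S"
  shows "Im (ip (p a * W) W) = 0"
proof -
  obtain \<alpha> where \<alpha>: "bnd \<alpha> a" using ex_bnd by blast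
  let ?y = "Im (ip (p a * W) W)"
  have *: "- \<epsilon> * ?y \<le> \<epsilon>\<^sup>2 * (\<alpha>\<^sup>2 / 2 * (nrm2 W)\<^sup>2)" for \<epsilon> :: real
  proof -
    let ?X = "e + (\<i> * of_real \<epsilon>) *\<^sub>C a"
    have "bnd (sqrt (1 + \<epsilon>\<^sup>2 * \<alpha>\<^sup>2)) (p ?X)"
      using a \<alpha> by (intro p_bnd bnd_e_plus_skew A_add A_cscale e_A)
    then have "nrm2 (p ?X * W) \<le> sqrt (1 + \<epsilon>\<^sup>2 * \<alpha>\<^sup>2) * nrm2 W" by (rule bndD)
    also have "\<dots> \<le> (1 + \<epsilon>\<^sup>2 * \<alpha>\<^sup>2 / 2) * nrm2 W"
      by (intro mult_right_mono sqrt_one_plus_le) auto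
    finally have "nrm2 (p ?X * W) * nrm2 W \<le> (1 + \<epsilon>\<^sup>2 * \<alpha>\<^sup>2 / 2) * nrm2 W * nrm2 W"
      by (intro mult_right_mono) auto
    with Re_ip_le[of "p ?X * W" W] have "Re (ip (p ?X * W) W) \<le> (1 + \<epsilon>\<^sup>2 * \<alpha>\<^sup>2 / 2) * nrm2 W * nrm2 W"
      by linarith
    moreover have "Re (ip (p ?X * W) W) = (nrm2 W)\<^sup>2 - \<epsilon> * ?y"
      using a W by (simp add: p_e_plus_skew distrib_right ip_add_left e_left S_in_A nrm2_sq)
    ultimately show ?thesis by (simp add: power2_eq_square algebra_simps)
  qed
  show ?thesis
  proof (rule linear_le_quadratic_imp_zero)
    fix t :: real assume t: "0 < t" "t \<le> 1"
    \<comment> \<open>The sign of \<epsilon>, equal to t or -t, is chosen according to the sign of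
      \<open>?y\<close>.\<close>
    have "t * \<bar>?y\<bar> \<le> t * (t * (\<alpha>\<^sup>2 / 2 * (nrm2 W)\<^sup>2))"
      using *[of t] *[of "-t"] by (cases "?y \<ge> 0") (auto simp: power2_eq_square mult.assoc)
    then show "\<bar>?y\<bar> \<le> t * (\<alpha>\<^sup>2 / 2 * (nrm2 W)\<^sup>2)" using t by simp
  qed
qed

text \<open>Polarisation: 4 b = (e + b)^2 - (e - b)^2. Each square is W * adj W with W in S, so the
  reality of <p a W, W> applies to it.\<close>

lemma Im_ip_p:
  assumes a: "a \<in> A" "adj a = a" and b: "b \<in> S" "adj b = b"
  shows "Im (ip (p a) b) = 0"
proof -
  have W: "Im (ip (p a) ((e + c *\<^sub>C b) * (e + c *\<^sub>C b))) = 0" if "cnj c = c" for c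
    using Im_ip_p_compress[OF a, of "e + c *\<^sub>C b"] b that e_S
    by (simp add: ip_times_right adj_add adj_cscale e_adj S_add S_cscale)
  have "4 *\<^sub>C b = (e + 1 *\<^sub>C b) * (e + 1 *\<^sub>C b) - (e + (-1) *\<^sub>C b) * (e + (-1) *\<^sub>C b)"
    using b e_A by (simp add: distrib_left distrib_right e_left e_right S_in_A)
       (rule bmat_eqI, simp)
  then have "4 * ip (p a) b = ip (p a) ((e + 1 *\<^sub>C b) * (e + 1 *\<^sub>C b)) - ip (p a) ((e + (-1) *\<^sub>C b) * (e + (-1) *\<^sub>C b))"
    by (metis complex_cnj_numeral ip_cscale_right ip_diff_right)
  then have "Im (4 * ip (p a) b) = 0" using W[of 1] W[of "-1"] by simp
  then show ?thesis by simp
qed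

text \<open>\<open>V\<close> agrees with the unitary \<open>exp (\<i> s b)\<close> to second order, and
  \<open>adj V * V = e + O(s\<^sup>4)\<close>. Contractivity of \<open>p\<close> at \<open>V * (e + \<i> \<epsilon> a)\<close>, tested against \<open>V\<close>,
  is compared at order \<open>s\<^sup>3\<close> for \<open>\<epsilon> = \<plusminus> s\<^sup>2\<close>.\<close>
lemma Re_ip_p:
  assumes a: "a \<in> A" "adj a = a" and b: "b \<in> S" "adj b = b"
  shows "Re (ip a b - ip (p a) b) = 0"
proof -
  obtain \<alpha> where \<alpha>: "bnd \<alpha> a" using ex_bnd by blast
  define b2 where "b2 = b * b"
  have b2: "b2 \<in> S" "adj b2 = b2" using b by (auto simp: b2_def S_times adj_times)
  obtain \<kappa> where \<kappa>: "bnd \<kappa> b2" using ex_bnd by blast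
  have A: "b \<in> A" "b2 \<in> A" using b b2 S_in_A by auto
  have baA: "b * a \<in> A" "b2 * a \<in> A" using A a by (auto intro: A_times)
  \<comment> \<open>A bound for the remainder \<open>R\<close> below, uniform in s \<le> 1 and taken
    term by term.\<close>
  define M where "M = cmod (ip (p (b2 * a)) e) / 2 + cmod (ip (p (b * a)) b) + cmod (ip (p a) b2) / 2
    + cmod (ip (p (b2 * a)) b) / 2 + cmod (ip (p (b * a)) b2) / 2 + cmod (ip (p (b2 * a)) b2) / 4"
  define D where "D = Re (ip a b - ip (p a) b)"
  have key: "- \<sigma> * (s * D) \<le> s\<^sup>2 * (M + \<kappa>\<^sup>2 / 4 + \<alpha>\<^sup>2 / 2 + \<kappa>\<^sup>2 * \<alpha>\<^sup>2 / 8)"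
    if s: "0 < s" "s \<le> 1" and \<sigma>: "\<bar>\<sigma>\<bar> = 1" for s \<sigma> :: real
  proof -
    \<comment> \<open>This value cancels the coefficient s^2 - 2 q of \<open>b2\<close> in
      \<open>adj V * V\<close>.\<close>
    define q where "q = s\<^sup>2 / 2"
    define V where "V = e + (\<i> * of_real s) *\<^sub>C b - of_real q *\<^sub>C b2"
    have V_eq: "V = e + (\<i> * of_real s) *\<^sub>C b + (- of_real q) *\<^sub>C b2"
      unfolding V_def by (rule bmat_eqI) simp
    have V: "V \<in> S" unfolding V_eq using b b2 e_S by (intro S_add S_cscale)
    have adjV: "adj V = e + (- \<i> * of_real s) *\<^sub>C b - of_real q *\<^sub>C b2"
      by (simp add: V_def adj_add adj_diff adj_cscale e_adj b b2)
    have "adj V * V = e + of_real (q\<^sup>2) *\<^sub>C (b2 * b2)"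
    proof -
      have 1: "b * b2 = b2 * b" by (simp add: b2_def mult.assoc)
      have 2: "b * b = b2" by (simp add: b2_def)
      have "adj V * V = e + of_real (q\<^sup>2) *\<^sub>C (b2 * b2) + (of_real (s\<^sup>2 - 2 * q)) *\<^sub>C b2"
        unfolding adjV unfolding V_def
        by (simp add: distrib_left distrib_right left_diff_distrib right_diff_distrib
             e_left e_right A e_A 1 2, rule bmat_eqI, simp add: algebra_simps power2_eq_square)
      then show ?thesis by (simp add: q_def)
    qed
    note VV = this
    have nV: "(nrm2 (V * x))\<^sup>2 = (nrm2 (e * x))\<^sup>2 + q\<^sup>2 * (nrm2 (b2 * x))\<^sup>2" for x
    proof -
      have "ip (V * x) (V * x) = ip x (adj V * V * x)" by (simp add: ip_times_left mult.assoc)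
      also have "\<dots> = ip x (e * x) + of_real (q\<^sup>2) * ip x (b2 * (b2 * x))"
        by (simp add: VV distrib_right ip_add_right mult.assoc)
      also have "ip x (e * x) = ip (e * x) (e * x)"
        by (simp add: ip_e_left mult.assoc[symmetric] e_left e_A)
      also have "ip x (b2 * (b2 * x)) = ip (b2 * x) (b2 * x)" by (simp add: ip_times_left b2)
      finally show ?thesis by (simp add: nrm2_sq)
    qed
    have bV: "bnd (sqrt (1 + q\<^sup>2 * \<kappa>\<^sup>2)) V"
    proof (rule bndI_sq)
      fix x
      have "(nrm2 (V * x))\<^sup>2 \<le> (nrm2 x)\<^sup>2 + q\<^sup>2 * (\<kappa> * nrm2 x)\<^sup>2"
        unfolding nV using nrm2_e_times bndD[OF \<kappa>] by (intro add_mono mult_left_mono power_mono) auto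
      then show "(nrm2 (V * x))\<^sup>2 \<le> (1 + q\<^sup>2 * \<kappa>\<^sup>2) * (nrm2 x)\<^sup>2"
        by (simp add: algebra_simps power_mult_distrib)
    qed simp
    \<comment> \<open>The term sought is \<epsilon> s D. With \<epsilon> of order s^2 it has order
      s^3, while the errors from q^2, \<epsilon>^2 and \<epsilon> s^2 R all have order s^4. The sign
      \<sigma> is kept free so that both signs of D can be excluded.\<close>
    define \<epsilon> where "\<epsilon> = \<sigma> * s\<^sup>2"
    have \<epsilon>2: "\<epsilon>\<^sup>2 = s ^ 4" using \<sigma> by (auto simp: \<epsilon>_def abs_if power2_eq_square power4_eq_xxxx split: if_splits)
    let ?Y = "e + (\<i> * of_real \<epsilon>) *\<^sub>C a"
    let ?cV = "sqrt (1 + q\<^sup>2 * \<kappa>\<^sup>2)" and ?cY = "sqrt (1 + \<epsilon>\<^sup>2 * \<alpha>\<^sup>2)"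
    have Va: "V * a \<in> A" using V a S_in_A by (intro A_times)
    have YA: "?Y \<in> A" using a by (intro A_add A_cscale e_A)
    have X: "V * ?Y = V + (\<i> * of_real \<epsilon>) *\<^sub>C (V * a)"
      using V by (simp add: distrib_left e_right S_in_A)
    have pX: "p (V * ?Y) = V + (\<i> * of_real \<epsilon>) *\<^sub>C p (V * a)"
      unfolding X using V Va by (simp add: p_add p_cscale A_cscale S_in_A p_id)
    have "bnd (?cV * ?cY) (p (V * ?Y))"
      using V YA S_in_A by (intro p_bnd A_times bnd_times bV bnd_e_plus_skew a \<alpha>)
    then have "nrm2 (p (V * ?Y) * e) \<le> ?cV * ?cY * nrm2 e" by (rule bndD)
    then have n1: "nrm2 (p (V * ?Y)) \<le> ?cV * ?cY"
      using V YA by (simp add: e_right e_nrm2 S_in_A p_S A_times)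
    have n2: "nrm2 V \<le> ?cV" using bndD[OF bV, of e] V by (simp add: e_right e_nrm2 S_in_A)
    have "Re (ip (p (V * ?Y)) V) \<le> (?cV * ?cY) * ?cV"
      using Re_ip_le[of "p (V * ?Y)" V] mult_mono[OF n1 n2] by simp
    also have "\<dots> = (1 + q\<^sup>2 * \<kappa>\<^sup>2) * ?cY" by simp
    also have "\<dots> \<le> (1 + q\<^sup>2 * \<kappa>\<^sup>2) * (1 + \<epsilon>\<^sup>2 * \<alpha>\<^sup>2 / 2)"
      by (intro mult_left_mono sqrt_one_plus_le) auto
    finally have upper: "Re (ip (p (V * ?Y)) V) \<le> (1 + q\<^sup>2 * \<kappa>\<^sup>2) * (1 + \<epsilon>\<^sup>2 * \<alpha>\<^sup>2 / 2)" .
    have "1 \<le> (nrm2 V)\<^sup>2"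
      using nV[of e] V by (simp add: e_right e_nrm2 S_in_A e_A)
    moreover have "Re (ip (p (V * ?Y)) V) = (nrm2 V)\<^sup>2 - \<epsilon> * Im (ip (p (V * a)) V)"
      unfolding pX by (simp add: ip_add_left nrm2_sq)
    ultimately have lower: "- \<epsilon> * Im (ip (p (V * a)) V) \<le> (1 + q\<^sup>2 * \<kappa>\<^sup>2) * (1 + \<epsilon>\<^sup>2 * \<alpha>\<^sup>2 / 2) - 1"
      using upper by simp
    \<comment> \<open>The terms of <p (V a), V> of order two and higher in s, divided by
      s^2.\<close>
    define R where "R = - ip (p (b2 * a)) e / 2 + ip (p (b * a)) b - ip (p a) b2 / 2
      + of_real s * (\<i> * ip (p (b2 * a)) b / 2 - \<i> * ip (p (b * a)) b2 / 2)
      + of_real (s\<^sup>2) * ip (p (b2 * a)) b2 / 4"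
    have "V * a = a + (\<i> * of_real s) *\<^sub>C (b * a) + (- of_real q) *\<^sub>C (b2 * a)"
      unfolding V_eq by (simp add: distrib_right e_left a)
    then have pVa: "p (V * a) = p a + (\<i> * of_real s) *\<^sub>C p (b * a) + (- of_real q) *\<^sub>C p (b2 * a)"
      by (simp add: p_add p_cscale a baA A_add A_cscale)
    \<comment> \<open>Trace preservation enters here: it evaluates the first-order contribution of
      \<open>p (b * a)\<close>, leaving the difference <a, b> - <p a, b> at that order.\<close>
    have "ip (b * a) e = ip a b" by (simp add: ip_times_left b e_right A)
    then have pe: "ip (p (b * a)) e = ip a b" using baA by (simp add: p_trace)
    \<comment> \<open>The term of order zero is real and so disappears from the imaginary
      part.\<close>
    have "ip a e = cnj (ip a e)"
      using ip_commute[of e a] ip_times_left[of a e e] ip_times_right[of e a e] a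
      by (metis complex_cnj_cnj e_left e_right)
    then have ae: "Im (ip (p a) e) = 0" using a by (simp add: p_trace complex_eq_iff)
    have "ip (p (V * a)) V = ip (p a) e + (\<i> * of_real s) * (ip a b - ip (p a) b) + of_real (s\<^sup>2) * R"
      unfolding pVa unfolding V_eq
      by (simp add: ip_add_left ip_add_right pe q_def R_def field_simps power2_eq_square)
    then have Im: "Im (ip (p (V * a)) V) = s * D + s\<^sup>2 * Im R"
      using ae by (simp add: D_def power2_eq_square)
    have "\<bar>Im R\<bar> \<le> cmod R" by (rule abs_Im_le_cmod)
    also have "\<dots> \<le> M"
    proof -
      have "cmod R \<le> cmod (- ip (p (b2 * a)) e / 2) + cmod (ip (p (b * a)) b) + cmod (ip (p a) b2 / 2)
        + cmod (of_real s * (\<i> * ip (p (b2 * a)) b / 2 - \<i> * ip (p (b * a)) b2 / 2))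
        + cmod (of_real (s\<^sup>2) * ip (p (b2 * a)) b2 / 4)"
      proof -
        have "cmod (u + v - x + y + z) \<le> cmod u + cmod v + cmod x + cmod y + cmod z" for u v x y z
          using norm_triangle_ineq[of "u + v - x + y" z] norm_triangle_ineq[of "u + v - x" y]
            norm_triangle_ineq4[of "u + v" x] norm_triangle_ineq[of u v] by linarith
        then show ?thesis unfolding R_def .
      qed
      also have "cmod (of_real s * (\<i> * ip (p (b2 * a)) b / 2 - \<i> * ip (p (b * a)) b2 / 2))
        \<le> 1 * (cmod (ip (p (b2 * a)) b) / 2 + cmod (ip (p (b * a)) b2) / 2)"
        unfolding norm_mult 
        by (intro mult_mono norm_triangle_le_diff) (use s in \<open>auto simp: norm_mult norm_divide\<close>)
      also have "cmod (of_real (s\<^sup>2) * ip (p (b2 * a)) b2 / 4) \<le> 1 * (cmod (ip (p (b2 * a)) b2) / 4)"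
        unfolding norm_mult norm_divide times_divide_eq_right[symmetric]
        using s by (intro mult_mono) (auto simp: power_le_one norm_power)
      finally show ?thesis by (simp add: M_def norm_divide)
    qed
    finally have R: "\<bar>Im R\<bar> \<le> M" .
    have "s\<^sup>2 * (- \<sigma> * (s * D)) = - \<epsilon> * Im (ip (p (V * a)) V) + \<sigma> * s\<^sup>2 * s\<^sup>2 * Im R"
      by (simp add: Im \<epsilon>_def algebra_simps)
    also have "\<sigma> * s\<^sup>2 * s\<^sup>2 * Im R \<le> s\<^sup>2 * s\<^sup>2 * M"
    proof -
      have "\<sigma> * Im R \<le> M" using R \<sigma> by (auto simp: abs_if split: if_splits)
      then have "s\<^sup>2 * s\<^sup>2 * (\<sigma> * Im R) \<le> s\<^sup>2 * s\<^sup>2 * M" by (intro mult_left_mono) auto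
      then show ?thesis by (simp add: mult_ac)
    qed
    also note lower
    also have "(1 + q\<^sup>2 * \<kappa>\<^sup>2) * (1 + \<epsilon>\<^sup>2 * \<alpha>\<^sup>2 / 2) - 1 \<le> s\<^sup>2 * s\<^sup>2 * (\<kappa>\<^sup>2 / 4 + \<alpha>\<^sup>2 / 2 + \<kappa>\<^sup>2 * \<alpha>\<^sup>2 / 8)"
    proof -
      have q2: "q\<^sup>2 = s ^ 4 / 4" by (simp add: q_def power_divide)
      \<comment> \<open>The product of the two error factors has order s^8 and is absorbed because s
        \<le> 1.\<close>
      have "s ^ 4 * s ^ 4 \<le> 1 * s ^ 4" using s by (intro mult_right_mono) (auto simp: power_le_one)
      then have "s ^ 4 * s ^ 4 * (\<kappa>\<^sup>2 * \<alpha>\<^sup>2 / 8) \<le> s ^ 4 * (\<kappa>\<^sup>2 * \<alpha>\<^sup>2 / 8)"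
        by (intro mult_right_mono) auto
      moreover have "s\<^sup>2 * s\<^sup>2 = s ^ 4" by (simp add: power2_eq_square power4_eq_xxxx)
      ultimately show ?thesis unfolding \<epsilon>2 q2 by (simp add: algebra_simps)
    qed
    finally have "s\<^sup>2 * (- \<sigma> * (s * D)) \<le> s\<^sup>2 * (s\<^sup>2 * (M + \<kappa>\<^sup>2 / 4 + \<alpha>\<^sup>2 / 2 + \<kappa>\<^sup>2 * \<alpha>\<^sup>2 / 8))"
      by (simp add: algebra_simps)
    then show ?thesis by (rule mult_left_le_imp_le) (use s in simp)
  qed
  have "D = 0"
  proof (rule linear_le_quadratic_imp_zero)
    fix t :: real assume t: "0 < t" "t \<le> 1"
    let ?K = "M + \<kappa>\<^sup>2 / 4 + \<alpha>\<^sup>2 / 2 + \<kappa>\<^sup>2 * \<alpha>\<^sup>2 / 8"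
    have "t * \<bar>D\<bar> \<le> t * (t * ?K)"
      using key[OF t, of 1] key[OF t, of "-1"]
      by (cases "D \<ge> 0") (auto simp: power2_eq_square mult.assoc)
    then show "\<bar>D\<bar> \<le> t * ?K" using t by simp
  qed
  then show ?thesis by (simp add: D_def)
qed

lemma ip_p_self_adjoint:
  assumes a: "a \<in> A" "adj a = a" and b: "b \<in> S" "adj b = b"
  shows "ip (p a) b = ip a b"
proof -
  have "ip a b = ip e (b * a)" using ip_times_right[of e a b] a by (simp add: e_left)
  moreover have "ip b a = ip e (b * a)" using ip_times_left[of b e a] b by (simp add: e_right S_in_A)
  ultimately have "ip a b = cnj (ip a b)" using ip_commute[of b a] by simp
  then have "Im (ip a b) = 0" by (simp add: complex_eq_iff)
  then show ?thesis using Re_ip_p[OF assms] Im_ip_p[OF assms] by (simp add: complex_eq_iff)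
qed

lemma self_adjoint_parts:
  obtains x1 x2 where "x = x1 + \<i> *\<^sub>C x2" "adj x1 = x1" "adj x2 = x2"
    "x \<in> A \<Longrightarrow> x1 \<in> A" "x \<in> A \<Longrightarrow> x2 \<in> A" "x \<in> S \<Longrightarrow> x1 \<in> S" "x \<in> S \<Longrightarrow> x2 \<in> S"
proof
  let ?x1 = "(1/2) *\<^sub>C (x + adj x)" and ?x2 = "(-\<i>/2) *\<^sub>C (x + (-1) *\<^sub>C adj x)"
  show "x = ?x1 + \<i> *\<^sub>C ?x2" by (rule bmat_eqI) (simp add: algebra_simps)
  show "adj ?x1 = ?x1" by (rule bmat_eqI) (simp add: algebra_simps)
  show "adj ?x2 = ?x2" by (rule bmat_eqI) (simp add: algebra_simps)
  show "x \<in> A \<Longrightarrow> ?x1 \<in> A" "x \<in> A \<Longrightarrow> ?x2 \<in> A" by (intro A_add A_cscale A_adj; simp)+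
  show "x \<in> S \<Longrightarrow> ?x1 \<in> S" "x \<in> S \<Longrightarrow> ?x2 \<in> S" by (intro S_add S_cscale S_adj; simp)+
qed

text \<open>Both sides are linear in x and antilinear in c, which leaves the self-adjoint case.
  Since p x lies in S, these identities determine it.\<close>

theorem ip_p:
  assumes "x \<in> A" "c \<in> S"
  shows "ip (p x) c = ip x c"
proof -
  obtain x1 x2 where x: "x = x1 + \<i> *\<^sub>C x2" "adj x1 = x1" "adj x2 = x2" "x1 \<in> A" "x2 \<in> A"
    using self_adjoint_parts[of x] assms by metis
  obtain c1 c2 where c: "c = c1 + \<i> *\<^sub>C c2" "adj c1 = c1" "adj c2 = c2" "c1 \<in> S" "c2 \<in> S"
    using self_adjoint_parts[of c] assms by metis
  have "p x = p x1 + \<i> *\<^sub>C p x2" using x by (simp add: p_add p_cscale A_cscale)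
  then show ?thesis
    using x c by (simp add: ip_add_left ip_add_right ip_p_self_adjoint)
qed

end

section \<open>Columns of block algebras\<close>

definition hs_sq :: "complex mat \<Rightarrow> real" where
  "hs_sq A = (\<Sum>i<dim_row A. \<Sum>j<dim_col A. (cmod (A $$ (i, j)))\<^sup>2)"

lemma sum_lessThan_add:
  fixes f :: "nat \<Rightarrow> 'a::comm_monoid_add"
  shows "sum f {..<m + n} = sum f {..<m} + (\<Sum>i<n. f (m + i))"
  by (induction n) (auto simp: add.assoc)

lemma hs_sq_four_block:
  assumes "A \<in> carrier_mat m m" "B \<in> carrier_mat n n"
  shows "hs_sq (four_block_mat A (0\<^sub>m m n) (0\<^sub>m n m) B) = hs_sq A + hs_sq B"
  using assms by (auto simp: hs_sq_def sum_lessThan_add)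

lemma diag_block_mat_replicate_carrier:
  assumes "A \<in> carrier_mat s s"
  shows "diag_block_mat (replicate q A) \<in> carrier_mat (q * s) (q * s)"
  using assms by (intro carrier_matI) (simp_all add: dim_diag_block_mat sum_list_replicate)

lemma diag_block_mat_replicate_Suc:
  assumes A: "A \<in> carrier_mat s s"
  shows "diag_block_mat (replicate (Suc q) A) =
    four_block_mat A (0\<^sub>m s (q * s)) (0\<^sub>m (q * s) s) (diag_block_mat (replicate q A))"
  using A carrier_matD[OF diag_block_mat_replicate_carrier[OF A, of q]] by (simp add: Let_def)

lemma hs_sq_diag_block_mat_replicate:
  assumes A: "A \<in> carrier_mat s s"
  shows "hs_sq (diag_block_mat (replicate q A)) = real q * hs_sq A"
proof (induction q)
  case (Suc q)
  then show ?case
    unfolding diag_block_mat_replicate_Suc[OF A] 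
      hs_sq_four_block[OF A diag_block_mat_replicate_carrier[OF A]] by (simp add: algebra_simps)
qed (simp add: hs_sq_def)

lemma index_diag_block_mat_replicate:
  assumes A: "A \<in> carrier_mat s s" and s: "1 \<le> s"
  shows "a < q * s \<Longrightarrow> b < q * s \<Longrightarrow> diag_block_mat (replicate q A) $$ (a, b) =
    (if a div s = b div s then A $$ (a mod s, b mod s) else 0)"
proof (induction q arbitrary: a b)
  case (Suc q)
  note D = diag_block_mat_replicate_carrier[OF A, of q]
  have shift: "c div s = Suc ((c - s) div s) \<and> c mod s = (c - s) mod s" if "\<not> c < s" for c
    using that s le_div_geq[of s c] le_mod_geq[of s c] by simp
  have less: "c div s = 0 \<and> c mod s = c" if "c < s" for c using that by simp
  show ?case
    unfolding diag_block_mat_replicate_Suc[OF A] 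
    using Suc.prems A D Suc.IH[of "a - s" "b - s"] shift[of a] shift[of b] less[of a] less[of b]
    by (subst index_mat_four_block) auto
qed simp

text \<open>Splits off the first pair of the partition, which is the induction step of
  \<open>block_algebra_column\<close>.\<close>

lemma block_algebra_Cons:
  assumes A: "A \<in> carrier_mat s s" and B: "B \<in> block_algebra \<nu>" "B \<in> carrier_mat n n"
  shows "four_block_mat (diag_block_mat (replicate q A)) (0\<^sub>m (q * s) n) (0\<^sub>m n (q * s)) B
    \<in> block_algebra ((s, q) # \<nu>)"
proof -
  obtain As where As: "B = diag_block_mat (concat (map2 (\<lambda>(s, q) A. replicate q A) \<nu> As))"
    "length As = length \<nu>" "\<forall>i<length \<nu>. As ! i \<in> carrier_mat (fst (\<nu> ! i)) (fst (\<nu> ! i))"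
    using B by (auto simp: block_algebra_def)
  have "four_block_mat (diag_block_mat (replicate q A)) (0\<^sub>m (q * s) n) (0\<^sub>m n (q * s)) B
    = diag_block_mat (concat (map2 (\<lambda>(s, q) A. replicate q A) ((s, q) # \<nu>) (A # As)))"
    using carrier_matD[OF diag_block_mat_replicate_carrier[OF A, of q]] carrier_matD[OF B(2)]
    by (simp add: diag_block_mat_append Let_def As(1))
  moreover have "\<forall>i<length ((s, q) # \<nu>). (A # As) ! i \<in> 
    carrier_mat (fst (((s, q) # \<nu>) ! i)) (fst (((s, q) # \<nu>) ! i))"
    using As A by (auto simp: nth_Cons split: nat.split)
  ultimately show ?thesis using As(2) unfolding block_algebra_def
    by (intro CollectI exI[of _ "A # As"]) simp
qed

lemma zero_in_block_algebra:
  assumes "\<forall>(s, q)\<in>set \<nu>. 1 \<le> s \<and> 1 \<le> q"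
  shows "0\<^sub>m (\<Sum>(s, q)\<leftarrow>\<nu>. q * s) (\<Sum>(s, q)\<leftarrow>\<nu>. q * s) \<in> block_algebra \<nu>"
  using assms
proof (induction \<nu>)
  case Nil
  then show ?case by (auto simp: block_algebra_def)
next
  case (Cons b \<nu>)
  obtain s q where b: "b = (s, q)" by (cases b)
  let ?n = "\<Sum>(s, q)\<leftarrow>\<nu>. q * s"
  have s: "1 \<le> s" using Cons.prems b by auto
  have z: "diag_block_mat (replicate q (0\<^sub>m s s)) = (0\<^sub>m (q * s) (q * s) :: complex mat)"
    using carrier_matD[OF diag_block_mat_replicate_carrier[of "0\<^sub>m s s :: complex mat" s q]] s
    by (intro eq_matI) (auto simp: index_diag_block_mat_replicate[of _ s])
  have "four_block_mat (0\<^sub>m (q * s) (q * s)) (0\<^sub>m (q * s) ?n) (0\<^sub>m ?n (q * s)) (0\<^sub>m ?n ?n)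
    \<in> block_algebra ((s, q) # \<nu>)"
    using block_algebra_Cons[of "0\<^sub>m s s" s "0\<^sub>m ?n ?n" \<nu> ?n q] Cons by (simp add: z)
  moreover have "four_block_mat (0\<^sub>m (q * s) (q * s)) (0\<^sub>m (q * s) ?n) (0\<^sub>m ?n (q * s)) (0\<^sub>m ?n ?n)
    = (0\<^sub>m (q * s + ?n) (q * s + ?n) :: complex mat)"
    by (intro eq_matI) auto
  ultimately show ?case by (simp add: b)
qed

text \<open>\<open>f\<close> sends an index to the diagonal block it belongs to, so the restriction of \<open>y\<close> to one
  block occurs as a column of an element of the block algebra.\<close>
lemma block_algebra_column:
  assumes "\<forall>(s, q)\<in>set \<nu>. 1 \<le> s \<and> 1 \<le> q" "\<forall>(s, q)\<in>set \<nu>. q \<le> L"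
    and "n = (\<Sum>(s, q)\<leftarrow>\<nu>. q * s)"
  shows "\<exists>f. (\<forall>a<n. f a < sum_list (map snd \<nu>)) \<and>
    (\<forall>c<sum_list (map snd \<nu>). \<forall>y. \<exists>W\<in>block_algebra \<nu>. W \<in> carrier_mat n n \<and>
      hs_sq W \<le> real L * (\<Sum>a<n. if f a = c then (cmod (y a))\<^sup>2 else 0) \<and>
      (\<exists>j<n. \<forall>a<n. W $$ (a, j) = (if f a = c then y a else 0)))"
  using assms
proof (induction \<nu> arbitrary: n)
  case Nil
  then show ?case by auto
next
  case (Cons b \<nu>)
  obtain s q where b: "b = (s, q)" by (cases b)
  define n' where "n' = (\<Sum>(s, q)\<leftarrow>\<nu>. q * s)"
  have n: "n = q * s + n'" using Cons.prems by (simp add: b n'_def)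
  have s: "1 \<le> s" and q: "1 \<le> q" "q \<le> L" using Cons.prems b by auto
  let ?R = "sum_list (map snd \<nu>)"
  obtain f where f: "\<And>a. a < n' \<Longrightarrow> f a < ?R"
    and W: "\<And>c y. c < ?R \<Longrightarrow> \<exists>W\<in>block_algebra \<nu>. W \<in> carrier_mat n' n' \<and>
      hs_sq W \<le> real L * (\<Sum>a<n'. if f a = c then (cmod (y a))\<^sup>2 else 0) \<and>
      (\<exists>j<n'. \<forall>a<n'. W $$ (a, j) = (if f a = c then y a else 0))"
  proof -
    have "\<forall>(s, q)\<in>set \<nu>. 1 \<le> s \<and> 1 \<le> q" "\<forall>(s, q)\<in>set \<nu>. q \<le> L" using Cons.prems by auto
    from Cons.IH[OF this n'_def] that show thesis by blast
  qed
  \<comment> \<open>The pair (s, q) contributes the first q diagonal blocks, each of length s; the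
    numbers of the later blocks are shifted by q.\<close>
  define g where "g a = (if a < q * s then a div s else q + f (a - q * s))" for a
  have R: "sum_list (map snd (b # \<nu>)) = q + ?R" by (simp add: b)
  have g: "g a < q + ?R" if "a < n" for a
  proof (cases "a < q * s")
    case True
    then have "a div s < q" using s by (simp add: less_mult_imp_div_less)
    then show ?thesis using True by (simp add: g_def)
  next
    case False
    then show ?thesis using that f[of "a - q * s"] by (simp add: g_def n)
  qed
  have "\<exists>W\<in>block_algebra (b # \<nu>). W \<in> carrier_mat n n \<and>
      hs_sq W \<le> real L * (\<Sum>a<n. if g a = c then (cmod (y a))\<^sup>2 else 0) \<and>
      (\<exists>j<n. \<forall>a<n. W $$ (a, j) = (if g a = c then y a else 0))" if c: "c < q + ?R" for c y
  proof (cases "c < q")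
    case True
    \<comment> \<open>Only the first column of the repeated block is filled, with the segment of y
      belonging to block c. Every copy contains this segment, each in a column of its own.\<close>
    define A where "A = mat s s (\<lambda>(p, p'). if p' = 0 then y (c * s + p) else (0::complex))"
    have A: "A \<in> carrier_mat s s" by (simp add: A_def)
    let ?D = "diag_block_mat (replicate q A)"
    note D = diag_block_mat_replicate_carrier[OF A, of q]
    define W where "W = four_block_mat ?D (0\<^sub>m (q * s) n') (0\<^sub>m n' (q * s)) (0\<^sub>m n' n')"
    have "W \<in> block_algebra (b # \<nu>)" unfolding W_def b
      using zero_in_block_algebra[of \<nu>] Cons.prems A by (intro block_algebra_Cons) (auto simp: n'_def)
    moreover have "W \<in> carrier_mat n n" using D by (simp add: W_def n)
    moreover have "hs_sq W \<le> real L * (\<Sum>a<n. if g a = c then (cmod (y a))\<^sup>2 else 0)"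
    proof -
      have cs: "c * s + p < q * s" if "p < s" for p
      proof -
        have "c * s + p < Suc c * s" using that by simp
        also have "\<dots> \<le> q * s" using True by (intro mult_right_mono) auto
        finally show ?thesis .
      qed
      have "hs_sq A = (\<Sum>p<s. (cmod (y (c * s + p)))\<^sup>2)"
      proof -
        have "(\<Sum>p'<s. (cmod (A $$ (p, p')))\<^sup>2) = (cmod (y (c * s + p)))\<^sup>2" if "p < s" for p
        proof -
          have "(\<Sum>p'<s. (cmod (A $$ (p, p')))\<^sup>2) = (\<Sum>p'<s. if p' = 0 then (cmod (y (c * s + p)))\<^sup>2 else 0)"
            using that by (intro sum.cong) (auto simp: A_def)
          then show ?thesis using s by simp
        qed
        then show ?thesis using A by (simp add: hs_sq_def)
      qed
      also have "\<dots> = (\<Sum>a\<in>(\<lambda>p. c * s + p) ` {..<s}. (cmod (y a))\<^sup>2)"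
        by (subst sum.reindex) (auto simp: inj_on_def)
      also have "\<dots> = (\<Sum>a\<in>(\<lambda>p. c * s + p) ` {..<s}. if g a = c then (cmod (y a))\<^sup>2 else 0)"
        using cs by (intro sum.cong) (auto simp: g_def)
      also have "\<dots> \<le> (\<Sum>a<n. if g a = c then (cmod (y a))\<^sup>2 else 0)"
        using cs by (intro sum_mono2) (auto simp: n intro: trans_less_add1)
      finally have hA: "hs_sq A \<le> (\<Sum>a<n. if g a = c then (cmod (y a))\<^sup>2 else 0)" .
      have "hs_sq W = hs_sq ?D + hs_sq (0\<^sub>m n' n')" 
        unfolding W_def using D by (intro hs_sq_four_block) auto
      \<comment> \<open>The q forced copies multiply the squared Hilbert-Schmidt norm by q; this is
        the origin of the constant l.\<close>
      also have "\<dots> = real q * hs_sq A"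
        by (simp add: hs_sq_diag_block_mat_replicate[OF A]) (simp add: hs_sq_def)
      also have "\<dots> \<le> real L * (\<Sum>a<n. if g a = c then (cmod (y a))\<^sup>2 else 0)"
        using q hA by (intro mult_mono) (auto simp: hs_sq_def intro!: sum_nonneg)
      finally show ?thesis .
    qed
    moreover have "\<exists>j<n. \<forall>a<n. W $$ (a, j) = (if g a = c then y a else 0)"
    proof -
      \<comment> \<open>The first column of copy number c; the other copies have no entries in
        it.\<close>
      define j where "j = c * s"
      have j: "j < q * s" "j div s = c" "j mod s = 0" using True s by (auto simp: j_def)
      have "W $$ (a, j) = (if g a = c then y a else 0)" if a: "a < n" for a
      proof (cases "a < q * s")
        case True
        have "W $$ (a, j) = ?D $$ (a, j)"
          unfolding W_def using True D j(1) by (subst index_mat_four_block) auto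
        also have "\<dots> = (if a div s = c then A $$ (a mod s, 0) else 0)"
          using True j by (subst index_diag_block_mat_replicate[OF A s]) auto
        also have "\<dots> = (if g a = c then y a else 0)"
          using s True by (auto simp: A_def g_def)
        finally show ?thesis .
      next
        case False
        then have "W $$ (a, j) = 0"
          unfolding W_def using D j(1) a n by (subst index_mat_four_block) auto
        then show ?thesis using False \<open>c < q\<close> by (simp add: g_def)
      qed
      moreover have "j < n" using j by (simp add: n)
      ultimately show ?thesis by blast
    qed
    ultimately show ?thesis by blast
  next
    case False
    define y' where "y' a = y (q * s + a)" for a
    obtain B j where B: "B \<in> block_algebra \<nu>" "B \<in> carrier_mat n' n'"
      and hB: "hs_sq B \<le> real L * (\<Sum>a<n'. if f a = c - q then (cmod (y' a))\<^sup>2 else 0)"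
      and j: "j < n'" "\<forall>a<n'. B $$ (a, j) = (if f a = c - q then y' a else 0)"
    proof -
      have "c - q < ?R" using c False by linarith
      from W[OF this, of y'] that show thesis by blast
    qed
    let ?D = "diag_block_mat (replicate q (0\<^sub>m s s :: complex mat))"
    note D = diag_block_mat_replicate_carrier[of "0\<^sub>m s s :: complex mat" s q, OF zero_carrier_mat]
    define W where "W = four_block_mat ?D (0\<^sub>m (q * s) n') (0\<^sub>m n' (q * s)) B"
    have "W \<in> block_algebra (b # \<nu>)" unfolding W_def b using B by (intro block_algebra_Cons) auto
    moreover have "W \<in> carrier_mat n n" using B D by (simp add: W_def n)
    moreover have "hs_sq W \<le> real L * (\<Sum>a<n. if g a = c then (cmod (y a))\<^sup>2 else 0)"
    proof -
      have "hs_sq W = hs_sq ?D + hs_sq B"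
        unfolding W_def using D B by (intro hs_sq_four_block) auto
      also have "\<dots> = hs_sq B"
        by (simp add: hs_sq_diag_block_mat_replicate[OF zero_carrier_mat]) (simp add: hs_sq_def)
      also note hB
      also have "(\<Sum>a<n'. if f a = c - q then (cmod (y' a))\<^sup>2 else 0)
        = (\<Sum>a<n'. if g (q * s + a) = c then (cmod (y (q * s + a)))\<^sup>2 else 0)"
        using False by (intro sum.cong) (auto simp: g_def y'_def)
      also have "\<dots> \<le> (\<Sum>a<n. if g a = c then (cmod (y a))\<^sup>2 else 0)"
        unfolding n sum_lessThan_add by (simp add: sum_nonneg)
      finally show ?thesis by (simp add: mult_left_mono)
    qed
    moreover have "\<exists>j<n. \<forall>a<n. W $$ (a, j) = (if g a = c then y a else 0)"
    proof (intro exI[of _ "q * s + j"] conjI allI impI)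
      show "q * s + j < n" using j by (simp add: n)
      fix a assume a: "a < n"
      show "W $$ (a, q * s + j) = (if g a = c then y a else 0)"
      proof (cases "a < q * s")
        case True
        then have "a div s < q" using s by (simp add: less_mult_imp_div_less)
        moreover have "W $$ (a, q * s + j) = 0"
          unfolding W_def using True B D j by (subst index_mat_four_block) auto
        ultimately show ?thesis using True False by (auto simp: g_def)
      next
        case 1: False
        then have "W $$ (a, q * s + j) = B $$ (a - q * s, j)"
          unfolding W_def using B D j a n by (subst index_mat_four_block) auto
        also have "\<dots> = (if g a = c then y a else 0)"
          using j 1 a n False by (auto simp: g_def y'_def)
        finally show ?thesis .
      qed
    qed
    ultimately show ?thesis by blast
  qed
  then show ?case unfolding R using g by (intro exI[of _ g]) blast
qed

section \<open>Embedding the direct sum\<close>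

lemma mat_adjoint_index:
  fixes A :: "complex mat"
  assumes "A \<in> carrier_mat n n" "i < n" "j < n"
  shows "mat_adjoint A $$ (i, j) = cnj (A $$ (j, i))"
  using assms unfolding mat_adjoint_def by (simp add: mat_of_rows_index)

lemma mat_adjoint_carrier: "(A :: complex mat) \<in> carrier_mat n n \<Longrightarrow> mat_adjoint A \<in> carrier_mat n n"
  unfolding mat_adjoint_def by (auto simp: mat_of_rows_def)

lemma mult_mat_vec_index:
  assumes "A \<in> carrier_mat n n" "y \<in> carrier_vec n" "i < n"
  shows "(A *\<^sub>v y) $ i = (\<Sum>l<n. A $$ (i, l) * y $ l)"
  using assms by (simp add: scalar_prod_def lessThan_atLeast0)

lemma cscalar_prod_sum:
  fixes y z :: "complex vec"
  assumes "y \<in> carrier_vec n" "z \<in> carrier_vec n"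
  shows "y \<bullet>c z = (\<Sum>i<n. y $ i * cnj (z $ i))"
  using assms by (simp add: scalar_prod_def lessThan_atLeast0)

lemma euclid_norm_sq:
  assumes "y \<in> carrier_vec n"
  shows "(euclid_norm y)\<^sup>2 = (\<Sum>i<n. (cmod (y $ i))\<^sup>2)"
  using assms by (simp add: euclid_norm_def L2_set_def sum_nonneg)

lemma euclid_norm_nonneg [simp]: "0 \<le> euclid_norm y"
  by (simp add: euclid_norm_def)

lemma cscalar_prod_self: 
  assumes "y \<in> carrier_vec n"
  shows "y \<bullet>c y = complex_of_real ((euclid_norm y)\<^sup>2)"
  unfolding cscalar_prod_sum[OF assms assms] euclid_norm_sq[OF assms] of_real_sum complex_norm_square ..

lemma euclid_norm_smult: "euclid_norm (c \<cdot>\<^sub>v y) = cmod c * euclid_norm y"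
proof (rule power2_eq_imp_eq)
  have y: "y \<in> carrier_vec (dim_vec y)" "c \<cdot>\<^sub>v y \<in> carrier_vec (dim_vec y)" by simp_all
  have "(\<Sum>i<dim_vec y. (cmod ((c \<cdot>\<^sub>v y) $ i))\<^sup>2) = (\<Sum>i<dim_vec y. (cmod c)\<^sup>2 * (cmod (y $ i))\<^sup>2)"
    by (intro sum.cong) (auto simp: norm_mult power_mult_distrib)
  then show "(euclid_norm (c \<cdot>\<^sub>v y))\<^sup>2 = (cmod c * euclid_norm y)\<^sup>2"
    unfolding power_mult_distrib euclid_norm_sq[OF y(1)] euclid_norm_sq[OF y(2)] sum_distrib_left .
qed simp_all

lemma euclid_norm_0: "euclid_norm (0\<^sub>v n) = 0"
  by (simp add: euclid_norm_def L2_set_def)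

lemma op_norm_le:
  assumes A: "A \<in> carrier_mat n n"
    and "\<And>y. y \<in> carrier_vec n \<Longrightarrow> euclid_norm (A *\<^sub>v y) \<le> c * euclid_norm y" "0 \<le> c"
  shows "op_norm A \<le> c"
  unfolding op_norm_def
proof (rule cSUP_least)
  show "{x \<in> carrier_vec (dim_col A). euclid_norm x \<le> 1} \<noteq> {}"
    using A euclid_norm_0 by (intro ex_in_conv[THEN iffD1] exI[of _ "0\<^sub>v n"]) auto
  fix y assume y: "y \<in> {x \<in> carrier_vec (dim_col A). euclid_norm x \<le> 1}"
  then have "euclid_norm (A *\<^sub>v y) \<le> c * euclid_norm y" using assms A by auto
  also have "\<dots> \<le> c * 1" using y assms by (intro mult_left_mono) auto
  finally show "euclid_norm (A *\<^sub>v y) \<le> c" by simp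
qed

text \<open>The supremum in \<open>op_norm\<close> is informative only over a bounded set. Some
  bound K is therefore assumed here; it is later supplied by \<open>ex_bnd\<close>.\<close>

lemma euclid_norm_le_op_norm:
  assumes A: "A \<in> carrier_mat n n"
    and K: "\<And>y. y \<in> carrier_vec n \<Longrightarrow> euclid_norm (A *\<^sub>v y) \<le> K * euclid_norm y"
    and y: "y \<in> carrier_vec n"
  shows "euclid_norm (A *\<^sub>v y) \<le> op_norm A * euclid_norm y"
proof (cases "euclid_norm y = 0")
  case True
  then show ?thesis using K[OF y] by simp
next
  case False
  then have pos: "0 < euclid_norm y" using euclid_norm_nonneg[of y] by linarith
  have bdd: "bdd_above ((\<lambda>x. euclid_norm (A *\<^sub>v x)) ` {x \<in> carrier_vec (dim_col A). euclid_norm x \<le> 1})"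
  proof (rule bdd_aboveI2)
    fix x assume x: "x \<in> {x \<in> carrier_vec (dim_col A). euclid_norm x \<le> 1}"
    then have "euclid_norm (A *\<^sub>v x) \<le> K * euclid_norm x" using K A by auto
    also have "\<dots> \<le> \<bar>K\<bar> * 1" using x by (intro mult_mono) auto
    finally show "euclid_norm (A *\<^sub>v x) \<le> \<bar>K\<bar> * 1" .
  qed
  let ?z = "complex_of_real (1 / euclid_norm y) \<cdot>\<^sub>v y"
  have z: "?z \<in> {x \<in> carrier_vec (dim_col A). euclid_norm x \<le> 1}"
    using y A pos by (simp add: euclid_norm_smult norm_divide)
  have "A *\<^sub>v ?z = complex_of_real (1 / euclid_norm y) \<cdot>\<^sub>v (A *\<^sub>v y)"
    using A y by (simp add: mult_mat_vec)
  then have "euclid_norm (A *\<^sub>v y) / euclid_norm y = euclid_norm (A *\<^sub>v ?z)"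
    using pos by (simp add: euclid_norm_smult norm_divide)
  also have "\<dots> \<le> op_norm A" unfolding op_norm_def by (rule cSUP_upper[OF z bdd])
  finally show ?thesis using pos by (simp add: field_simps)
qed

section \<open>The direct sum as a corner of \<open>bmat\<close>\<close>

locale msum_weights =
  fixes N :: nat and d :: "nat \<Rightarrow> nat" and v :: "nat \<Rightarrow> real"
  assumes N: "1 \<le> N" and d: "\<And>k. k \<in> {1..N} \<Longrightarrow> 1 \<le> d k" and v: "weight_vector N v"
begin

text \<open>The value outside \<open>{1..N}\<close> only serves to keep the inner product definite on all of
  \<^typ>\<open>bmat\<close>.\<close>
definition wt :: "nat \<Rightarrow> real" where
  "wt k = (if k \<in> {1..N} then v k / real (d k) else 1)"

lemma v_pos: "k \<in> {1..N} \<Longrightarrow> 0 < v k"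
  using v by (auto simp: weight_vector_def split: if_splits)

lemma sum_v: "(\<Sum>k=1..N. v k) = 1"
  using v N by (auto simp: weight_vector_def split: if_splits)

sublocale weighted wt
proof
  fix k show "0 < wt k"
    using v_pos[of k] d[of k] by (auto simp: wt_def)
qed

definition emb :: "msum \<Rightarrow> bmat" where
  "emb A = Bmat (\<lambda>k i j. if k \<in> {1..N} \<and> i < d k \<and> j < d k then A k $$ (i, j) else 0)"

definition corner :: "bmat set" where
  "corner = {x. \<forall>k i j. entry x k i j \<noteq> 0 \<longrightarrow> k \<in> {1..N} \<and> i < d k \<and> j < d k}"

definition unemb :: "bmat \<Rightarrow> msum" where
  "unemb x = (\<lambda>k\<in>{1..N}. mat (d k) (d k) (\<lambda>(i, j). entry x k i j))"

text \<open>One number above all k \<le> N and all sizes, because \<open>inside\<close> bounds the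
  three indices at once.\<close>

definition size_bound :: nat where
  "size_bound = Suc N + (\<Sum>k=1..N. d k)"

lemma size_bound: "k \<in> {1..N} \<Longrightarrow> d k \<le> size_bound" "k \<in> {1..N} \<Longrightarrow> k < size_bound"
proof -
  assume k: "k \<in> {1..N}"
  have "d k \<le> (\<Sum>k=1..N. d k)" using k by (intro member_le_sum) auto
  then show "d k \<le> size_bound" "k < size_bound" using k by (auto simp: size_bound_def)
qed

lemma entry_emb: "entry (emb A) k i j = (if k \<in> {1..N} \<and> i < d k \<and> j < d k then A k $$ (i, j) else 0)"
  unfolding emb_def
  by (subst entry_Bmat[of size_bound]) (use size_bound in \<open>fastforce simp: inside_def split: if_splits\<close>)+

lemma emb_corner [simp]: "emb A \<in> corner"
  by (auto simp: corner_def entry_emb split: if_splits)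

lemma cornerD: "x \<in> corner \<Longrightarrow> entry x k i j \<noteq> 0 \<Longrightarrow> k \<in> {1..N} \<and> i < d k \<and> j < d k"
  by (auto simp: corner_def)

lemma corner_inside: "x \<in> corner \<Longrightarrow> inside size_bound (entry x)"
  unfolding inside_def using size_bound cornerD by (meson order_less_le_trans)

lemma unemb_carrier: "unemb x \<in> msum_carrier N d"
  by (auto simp: unemb_def msum_carrier_def)

lemma emb_unemb: "x \<in> corner \<Longrightarrow> emb (unemb x) = x"
  by (rule bmat_eqI) (auto simp: entry_emb unemb_def dest: cornerD)

lemma carrierD: "A \<in> msum_carrier N d \<Longrightarrow> k \<in> {1..N} \<Longrightarrow> A k \<in> carrier_mat (d k) (d k)"
  by (auto simp: msum_carrier_def)

lemma msum_eqI:
  assumes "A \<in> msum_carrier N d" "B \<in> msum_carrier N d"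
    and "\<And>k i j. k \<in> {1..N} \<Longrightarrow> i < d k \<Longrightarrow> j < d k \<Longrightarrow> A k $$ (i, j) = B k $$ (i, j)"
  shows "A = B"
proof
  fix k show "A k = B k"
  proof (cases "k \<in> {1..N}")
    case True
    then show ?thesis using assms carrierD[OF assms(1) True] carrierD[OF assms(2) True]
      by (intro eq_matI) auto
  next
    case False
    then show ?thesis using assms by (auto simp: msum_carrier_def PiE_def extensional_def)
  qed
qed

lemma emb_inj:
  assumes "A \<in> msum_carrier N d" "B \<in> msum_carrier N d" "emb A = emb B"
  shows "A = B"
proof (rule msum_eqI[OF assms(1,2)])
  fix k i j assume "k \<in> {1..N}" "i < d k" "j < d k"
  then show "A k $$ (i, j) = B k $$ (i, j)"
    using arg_cong[OF assms(3), of "\<lambda>x. entry x k i j"] by (simp add: entry_emb)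
qed

lemma unemb_emb: "A \<in> msum_carrier N d \<Longrightarrow> unemb (emb A) = A"
  by (rule emb_inj) (auto simp: unemb_carrier emb_unemb)

lemma msum_add_carrier: "A \<in> msum_carrier N d \<Longrightarrow> B \<in> msum_carrier N d \<Longrightarrow> msum_add N A B \<in> msum_carrier N d"
  and msum_smult_carrier: "A \<in> msum_carrier N d \<Longrightarrow> msum_smult N c A \<in> msum_carrier N d"
  and msum_mult_carrier: "A \<in> msum_carrier N d \<Longrightarrow> B \<in> msum_carrier N d \<Longrightarrow> msum_mult N A B \<in> msum_carrier N d"
  and msum_adjoint_carrier: "A \<in> msum_carrier N d \<Longrightarrow> msum_adjoint N A \<in> msum_carrier N d"
  and msum_one_carrier: "msum_one N d \<in> msum_carrier N d"
  by (auto simp: msum_carrier_def msum_add_def msum_smult_def msum_mult_def msum_adjoint_def 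
      msum_one_def PiE_iff intro!: add_carrier_mat mult_carrier_mat mat_adjoint_carrier)

lemma emb_add: "A \<in> msum_carrier N d \<Longrightarrow> B \<in> msum_carrier N d \<Longrightarrow> emb (msum_add N A B) = emb A + emb B"
  by (rule bmat_eqI) (auto simp: entry_emb msum_add_def dest: carrierD)

lemma emb_smult: "A \<in> msum_carrier N d \<Longrightarrow> emb (msum_smult N c A) = c *\<^sub>C emb A"
  by (rule bmat_eqI) (auto simp: entry_emb msum_smult_def dest: carrierD)

lemma emb_adjoint: "A \<in> msum_carrier N d \<Longrightarrow> emb (msum_adjoint N A) = adj (emb A)"
  by (rule bmat_eqI) (auto simp: entry_emb msum_adjoint_def mat_adjoint_index dest: carrierD)

lemma emb_mult:
  assumes "A \<in> msum_carrier N d" "B \<in> msum_carrier N d"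
  shows "emb (msum_mult N A B) = emb A * emb B"
proof (rule bmat_eqI)
  fix k i j
  have "entry (emb A * emb B) k i j = (\<Sum>l<d k. entry (emb A) k i l * entry (emb B) k l j)"
    by (rule entry_times) (auto simp: entry_emb split: if_splits)
  then show "entry (emb (msum_mult N A B)) k i j = entry (emb A * emb B) k i j"
    using carrierD[OF assms(1), of k] carrierD[OF assms(2), of k]
    by (auto simp: entry_emb msum_mult_def scalar_prod_def lessThan_atLeast0 intro!: sum.neutral)
qed

lemma emb_lincomb: "emb (msum_lincomb N d f U) = (\<Sum>b\<in>U. f b *\<^sub>C emb b)"
  by (rule bmat_eqI) (auto simp: entry_emb msum_lincomb_def)

lemma corner_add: "x \<in> corner \<Longrightarrow> y \<in> corner \<Longrightarrow> x + y \<in> corner"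
  and corner_cscale: "x \<in> corner \<Longrightarrow> c *\<^sub>C x \<in> corner"
  and corner_times: "x \<in> corner \<Longrightarrow> y \<in> corner \<Longrightarrow> x * y \<in> corner"
  and corner_adj: "x \<in> corner \<Longrightarrow> adj x \<in> corner"
  by (metis emb_corner emb_add emb_unemb unemb_carrier)
     (metis emb_corner emb_smult emb_unemb unemb_carrier,
      metis emb_corner emb_mult emb_unemb unemb_carrier,
      metis emb_corner emb_adjoint emb_unemb unemb_carrier)

abbreviation one :: bmat where "one \<equiv> emb (msum_one N d)"

lemma entry_one: "entry one k i j = (if k \<in> {1..N} \<and> i < d k \<and> i = j then 1 else 0)"
  by (auto simp: entry_emb msum_one_def)

lemma one_left: "x \<in> corner \<Longrightarrow> one * x = x"
proof (rule bmat_eqI)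
  fix k i j assume x: "x \<in> corner"
  have "entry (one * x) k i j = (\<Sum>l<d k. entry one k i l * entry x k l j)"
    by (rule entry_times) (auto simp: entry_one split: if_splits)
  also have "\<dots> = (\<Sum>l<d k. if l = i then (if k \<in> {1..N} then entry x k i j else 0) else 0)"
    by (intro sum.cong) (auto simp: entry_one)
  also have "\<dots> = entry x k i j" using cornerD[OF x, of k i j] by auto
  finally show "entry (one * x) k i j = entry x k i j" .
qed

lemma one_adj: "adj one = one"
  by (rule bmat_eqI) (auto simp: entry_one)

lemma one_right: "x \<in> corner \<Longrightarrow> x * one = x"
  by (metis adj_adj adj_times corner_adj one_adj one_left)

lemma ip_corner:
  assumes x: "x \<in> corner"
  shows "ip x y = (\<Sum>k=1..N. \<Sum>j<d k. \<Sum>i<d k. of_real (wt k) * (entry x k i j * cnj (entry y k i j)))"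
proof -
  let ?t = "\<lambda>k i j. of_real (wt k) * (entry x k i j * cnj (entry y k i j))"
  let ?n = size_bound
  have 0: "?t k i j = 0" if "\<not> (k \<in> {1..N} \<and> i < d k \<and> j < d k)" for k i j
    using cornerD[OF x, of k i j] that by auto
  have "ip x y = (\<Sum>k<?n. \<Sum>j<?n. \<Sum>i<?n. ?t k i j)"
    by (rule ip_inside) (simp add: corner_inside x)
  also have "\<dots> = (\<Sum>k=1..N. \<Sum>j<?n. \<Sum>i<?n. ?t k i j)"
    proof (intro sum.mono_neutral_right ballI)
    fix k assume "k \<in> {..<?n} - {1..N}"
    then show "(\<Sum>j<?n. \<Sum>i<?n. ?t k i j) = 0" by (intro sum.neutral ballI 0) auto
  qed (use size_bound(2) in auto)
  also have "\<dots> = (\<Sum>k=1..N. \<Sum>j<d k. \<Sum>i<d k. ?t k i j)"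
  proof (rule sum.cong[OF refl])
    fix k assume k: "k \<in> {1..N}"
    have "(\<Sum>j<?n. \<Sum>i<?n. ?t k i j) = (\<Sum>j<d k. \<Sum>i<?n. ?t k i j)"
    proof (intro sum.mono_neutral_right ballI)
      fix j assume "j \<in> {..<?n} - {..<d k}"
      then show "(\<Sum>i<?n. ?t k i j) = 0" by (intro sum.neutral ballI 0) auto
    qed (use size_bound[OF k] in auto)
    also have "\<dots> = (\<Sum>j<d k. \<Sum>i<d k. ?t k i j)"
    proof (rule sum.cong[OF refl])
      fix j
      show "(\<Sum>i<?n. ?t k i j) = (\<Sum>i<d k. ?t k i j)"
        by (intro sum.mono_neutral_right ballI 0) (use size_bound[OF k] in auto)
    qed
    finally show "(\<Sum>j<?n. \<Sum>i<?n. ?t k i j) = (\<Sum>j<d k. \<Sum>i<d k. ?t k i j)" .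
  qed
  finally show ?thesis .
qed

lemma tracial_state_eq_ip:
  assumes A: "A \<in> msum_carrier N d"
  shows "tracial_state N d v A = ip (emb A) one"
proof -
  have "(\<Sum>j<d k. \<Sum>i<d k. complex_of_real (wt k) * (entry (emb A) k i j * cnj (entry one k i j)))
    = complex_of_real (v k / real (d k)) * mat_trace (A k)" if k: "k \<in> {1..N}" for k
  proof -
    have "(\<Sum>i<d k. complex_of_real (wt k) * (entry (emb A) k i j * cnj (entry one k i j)))
      = complex_of_real (wt k) * A k $$ (j, j)" if j: "j < d k" for j
    proof -
      have "(\<Sum>i<d k. complex_of_real (wt k) * (entry (emb A) k i j * cnj (entry one k i j)))
        = (\<Sum>i<d k. if i = j then complex_of_real (wt k) * A k $$ (j, j) else 0)"
        unfolding entry_one using k j by (intro sum.cong) (auto simp: entry_emb)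
      then show ?thesis using j by simp
    qed
    then show ?thesis using k carrierD[OF A k] by (simp add: mat_trace_def wt_def sum_distrib_left)
  qed
  then show ?thesis unfolding ip_corner[OF emb_corner] tracial_state_def by simp
qed

lemma nrm2_one: "nrm2 one = 1"
proof -
  have "ip one one = tracial_state N d v (msum_one N d)" by (simp add: tracial_state_eq_ip msum_one_carrier)
  also have "\<dots> = (\<Sum>k=1..N. complex_of_real (v k))"
    unfolding tracial_state_def
  proof (rule sum.cong[OF refl])
    fix k assume k: "k \<in> {1..N}"
    have "mat_trace (msum_one N d k) = of_nat (d k)" using k by (simp add: mat_trace_def msum_one_def)
    then show "complex_of_real (v k / real (d k)) * mat_trace (msum_one N d k) = complex_of_real (v k)"
      using d[OF k] by simp
  qed
  also have "\<dots> = 1" using sum_v by (metis of_real_1 of_real_sum)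
  finally show ?thesis by (simp add: nrm2_def)
qed

section \<open>Columns, and the operator norm as the norm of left multiplication\<close>

definition colv :: "bmat \<Rightarrow> nat \<Rightarrow> nat \<Rightarrow> complex vec" where
  "colv y k j = vec (d k) (\<lambda>l. entry y k l j)"

lemma colv_carrier [simp]: "colv y k j \<in> carrier_vec (d k)"
  by (simp add: colv_def)

lemma entry_emb_times:
  assumes A: "A \<in> msum_carrier N d" and k: "k \<in> {1..N}" "i < d k"
  shows "entry (emb A * y) k i j = (A k *\<^sub>v colv y k j) $ i"
proof -
  have "entry (emb A * y) k i j = (\<Sum>l<d k. entry (emb A) k i l * entry y k l j)"
    by (rule entry_times) (auto simp: entry_emb split: if_splits)
  then show ?thesis using k mult_mat_vec_index[OF carrierD[OF A k(1)] colv_carrier k(2), of y j]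
    by (simp add: entry_emb colv_def)
qed

lemma entry_emb_times_eq_0: "\<not> (k \<in> {1..N} \<and> i < d k) \<Longrightarrow> entry (emb A * y) k i j = 0"
  by (subst entry_times[of _ _ _ _ _ 0]) (auto simp: entry_emb)

lemma colv_emb_times:
  assumes A: "A \<in> msum_carrier N d" and k: "k \<in> {1..N}"
  shows "colv (emb A * y) k j = A k *\<^sub>v colv y k j"
  using carrierD[OF A k] k by (intro eq_vecI) (simp_all add: colv_def entry_emb_times[OF A])

text \<open>Left multiplication acts column by column. The element y need not lie in the corner,
  hence the separate bound n for its columns.\<close>

lemma ip_emb_times:
  assumes A: "A \<in> msum_carrier N d" and n: "inside n (entry y)"
  shows "ip (emb A * y) z = (\<Sum>k=1..N. \<Sum>j<n. of_real (wt k) * ((A k *\<^sub>v colv y k j) \<bullet>c colv z k j))"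
proof -
  let ?t = "\<lambda>k i j. of_real (wt k) * (entry (emb A * y) k i j * cnj (entry z k i j))"
  let ?n = size_bound
  have 0: "?t k i j = 0" if "\<not> (k \<in> {1..N} \<and> i < d k)" for k i j
    using that by (simp add: entry_emb_times_eq_0)
  have "ip (emb A * y) z = (\<Sum>k<?n. \<Sum>j<n. \<Sum>i<?n. ?t k i j)"
  proof (rule ip_inside_gen)
    fix k i j assume "entry (emb A * y) k i j * entry z k i j \<noteq> 0"
    then have *: "entry (emb A * y) k i j \<noteq> 0" by auto
    then have ki: "k \<in> {1..N} \<and> i < d k" using entry_emb_times_eq_0 by blast
    from * obtain l where "entry y k l j \<noteq> 0"
      unfolding entry_times_bsize by (metis (no_types, lifting) mult_zero_right sum.neutral)
    then show "k < ?n \<and> j < n \<and> i < ?n" using ki n size_bound[of k] by (auto simp: inside_def)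
  qed
  also have "\<dots> = (\<Sum>k=1..N. \<Sum>j<n. \<Sum>i<?n. ?t k i j)"
    proof (intro sum.mono_neutral_right ballI)
    fix k assume "k \<in> {..<?n} - {1..N}"
    then show "(\<Sum>j<n. \<Sum>i<?n. ?t k i j) = 0" by (intro sum.neutral ballI 0) auto
  qed (use size_bound(2) in auto)
  also have "\<dots> = (\<Sum>k=1..N. \<Sum>j<n. of_real (wt k) * ((A k *\<^sub>v colv y k j) \<bullet>c colv z k j))"
  proof (intro sum.cong refl)
    fix k j assume k: "k \<in> {1..N}"
    have Ac: "A k *\<^sub>v colv y k j \<in> carrier_vec (d k)"
      using carrierD[OF A k] by (rule mult_mat_vec_carrier) simp
    have "(\<Sum>i<?n. ?t k i j) = (\<Sum>i<d k. ?t k i j)"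
      by (intro sum.mono_neutral_right ballI 0) (use size_bound[OF k] in auto)
    also have "\<dots> = of_real (wt k) * ((A k *\<^sub>v colv y k j) \<bullet>c colv z k j)"
      unfolding cscalar_prod_sum[OF Ac colv_carrier] sum_distrib_left
      using k by (intro sum.cong) (auto simp: entry_emb_times[OF A] colv_def)
    finally show "(\<Sum>i<?n. ?t k i j) = of_real (wt k) * ((A k *\<^sub>v colv y k j) \<bullet>c colv z k j)" .
  qed
  finally show ?thesis .
qed

lemma nrm2_emb_times:
  assumes A: "A \<in> msum_carrier N d" and n: "inside n (entry y)"
  shows "(nrm2 (emb A * y))\<^sup>2 = (\<Sum>k=1..N. \<Sum>j<n. wt k * (euclid_norm (A k *\<^sub>v colv y k j))\<^sup>2)"
proof -
  have "ip (emb A * y) (emb A * y) = (\<Sum>k=1..N. \<Sum>j<n. of_real (wt k * (euclid_norm (A k *\<^sub>v colv y k j))\<^sup>2))"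
    unfolding ip_emb_times[OF A n]
  proof (intro sum.cong refl)
    fix k j assume k: "k \<in> {1..N}"
    have Ac: "A k *\<^sub>v colv y k j \<in> carrier_vec (d k)"
      using carrierD[OF A k] by (rule mult_mat_vec_carrier) simp
    show "of_real (wt k) * ((A k *\<^sub>v colv y k j) \<bullet>c colv (emb A * y) k j)
      = of_real (wt k * (euclid_norm (A k *\<^sub>v colv y k j))\<^sup>2)"
      unfolding colv_emb_times[OF A k] cscalar_prod_self[OF Ac] by simp
  qed
  then show ?thesis unfolding nrm2_sq by simp
qed

lemma nrm2_one_times: "nrm2 (one * x) \<le> nrm2 x"
  by (rule nrm2_projection_times) (simp_all add: one_adj one_left)

lemma nrm2_one_times_sq:
  assumes n: "inside n (entry y)"
  shows "(nrm2 (one * y))\<^sup>2 = (\<Sum>k=1..N. \<Sum>j<n. wt k * (euclid_norm (colv y k j))\<^sup>2)"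
  unfolding nrm2_emb_times[OF msum_one_carrier n]
  by (intro sum.cong refl) (simp add: msum_one_def)

text \<open>Turns a vector of the k-th summand into an element of \<open>bmat\<close>, so that
  applying a matrix to it becomes a left multiplication. The choice of column 0 is
  arbitrary.\<close>

definition colm :: "nat \<Rightarrow> complex vec \<Rightarrow> bmat" where
  "colm k y = Bmat (\<lambda>k' i j. if k' = k \<and> j = 0 \<and> i < dim_vec y then y $ i else 0)"

lemma entry_colm: "entry (colm k y) k' i j = (if k' = k \<and> j = 0 \<and> i < dim_vec y then y $ i else 0)"
  unfolding colm_def
  by (subst entry_Bmat[of "Suc k + dim_vec y"]) (auto simp: inside_def split: if_splits)

lemma ip_colm:
  assumes y: "y \<in> carrier_vec n" and z: "z \<in> carrier_vec n"
  shows "ip (colm k y) (colm k z) = of_real (wt k) * (y \<bullet>c z)"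
proof -
  have "ip (colm k y) (colm k z) = (\<Sum>k'<Suc k. \<Sum>j<1. \<Sum>i<n. 
      of_real (wt k') * (entry (colm k y) k' i j * cnj (entry (colm k z) k' i j)))"
    by (rule ip_inside_gen) (use y in \<open>auto simp: entry_colm split: if_splits\<close>)
  also have "\<dots> = (\<Sum>k'<Suc k. if k' = k then (\<Sum>i<n. of_real (wt k) * (y $ i * cnj (z $ i))) else 0)"
    using y z by (intro sum.cong) (auto simp: entry_colm)
  also have "\<dots> = of_real (wt k) * (y \<bullet>c z)"
    unfolding cscalar_prod_sum[OF y z] by (simp add: sum_distrib_left)
  finally show ?thesis .
qed

lemma nrm2_colm: "(nrm2 (colm k y))\<^sup>2 = wt k * (euclid_norm y)\<^sup>2"
  unfolding nrm2_sq ip_colm[OF carrier_vec_dim_vec carrier_vec_dim_vec]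
    cscalar_prod_self[OF carrier_vec_dim_vec] by simp

lemma colv_colm: "y \<in> carrier_vec (d k) \<Longrightarrow> colv (colm k y) k 0 = y"
  by (intro eq_vecI) (auto simp: colv_def entry_colm)

lemma emb_times_colm:
  assumes A: "A \<in> msum_carrier N d" and k: "k \<in> {1..N}" and y: "y \<in> carrier_vec (d k)"
  shows "emb A * colm k y = colm k (A k *\<^sub>v y)"
proof (rule bmat_eqI)
  fix k' i j
  show "entry (emb A * colm k y) k' i j = entry (colm k (A k *\<^sub>v y)) k' i j"
  proof (cases "k' = k \<and> j = 0")
    case True
    then show ?thesis
      using entry_emb_times[OF A k, of i "colm k y" 0] colv_colm[OF y] carrierD[OF A k]
        entry_emb_times_eq_0[of k i A "colm k y" 0] k
      by (auto simp: entry_colm)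
  next
    case False
    then show ?thesis by (auto simp: entry_times_bsize entry_colm)
  qed
qed

lemma bnd_emb_column:
  assumes A: "A \<in> msum_carrier N d" and c: "bnd c (emb A)" and k: "k \<in> {1..N}" and y: "y \<in> carrier_vec (d k)"
  shows "euclid_norm (A k *\<^sub>v y) \<le> c * euclid_norm y"
proof -
  have w: "wt k > 0" by (rule w_pos)
  have "nrm2 (colm k (A k *\<^sub>v y)) \<le> c * nrm2 (colm k y)"
    using bndD[OF c, of "colm k y"] emb_times_colm[OF A k y] by simp
  then have "(nrm2 (colm k (A k *\<^sub>v y)))\<^sup>2 \<le> (c * nrm2 (colm k y))\<^sup>2"
    by (rule power_mono) simp
  then have "wt k * (euclid_norm (A k *\<^sub>v y))\<^sup>2 \<le> wt k * (c * euclid_norm y)\<^sup>2"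
    unfolding power_mult_distrib nrm2_colm by (simp add: mult_ac)
  then have "(euclid_norm (A k *\<^sub>v y))\<^sup>2 \<le> (c * euclid_norm y)\<^sup>2" using w by simp
  then show ?thesis by (rule power2_le_imp_le) (simp add: bnd_nonneg[OF c])
qed

lemma msum_norm_le_iff: "msum_norm N A \<le> c \<longleftrightarrow> (\<forall>k\<in>{1..N}. op_norm (A k) \<le> c)"
  unfolding msum_norm_def using N by (subst Max_le_iff) auto

lemma op_norm_bound:
  assumes A: "A \<in> msum_carrier N d" and k: "k \<in> {1..N}" and y: "y \<in> carrier_vec (d k)"
  shows "euclid_norm (A k *\<^sub>v y) \<le> op_norm (A k) * euclid_norm y"
proof -
  obtain K where K: "bnd K (emb A)" using ex_bnd by blast
  show ?thesis by (rule euclid_norm_le_op_norm[OF carrierD[OF A k] bnd_emb_column[OF A K k] y])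
qed

text \<open>Together with \<open>bnd_msum_norm\<close> this identifies the norm of the direct sum
  with the norm of left multiplication: here single columns are the test elements, there a general
  element is split into its columns.\<close>

lemma msum_norm_le_of_bnd:
  assumes A: "A \<in> msum_carrier N d" and c: "bnd c (emb A)"
  shows "msum_norm N A \<le> c"
  unfolding msum_norm_le_iff
  using bnd_emb_column[OF A c] bnd_nonneg[OF c] by (auto intro!: op_norm_le carrierD[OF A])

lemma op_norm_nonneg:
  assumes A: "A \<in> msum_carrier N d" and k: "k \<in> {1..N}"
  shows "0 \<le> op_norm (A k)"
proof -
  define y where "y = vec (d k) (\<lambda>i. if i = 0 then 1 else (0::complex))"
  have y: "y \<in> carrier_vec (d k)" by (simp add: y_def)
  have "(euclid_norm y)\<^sup>2 = (\<Sum>i<d k. if i = 0 then 1 else 0)"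
    unfolding euclid_norm_sq[OF y] by (intro sum.cong) (auto simp: y_def)
  also have "\<dots> = 1" using d[OF k] by simp
  finally have "euclid_norm y = 1" using euclid_norm_nonneg[of y] by (simp add: power2_eq_1_iff)
  then have "euclid_norm (A k *\<^sub>v y) \<le> op_norm (A k)" using op_norm_bound[OF A k y] by simp
  then show ?thesis by (rule order_trans[OF euclid_norm_nonneg])
qed

lemma msum_norm_nonneg:
  assumes "A \<in> msum_carrier N d"
  shows "0 \<le> msum_norm N A"
proof -
  have "1 \<in> {1..N}" using N by simp
  then have "0 \<le> op_norm (A 1)" "op_norm (A 1) \<le> msum_norm N A"
    using op_norm_nonneg[OF assms] msum_norm_le_iff[of A "msum_norm N A"] by auto
  then show ?thesis by linarith
qed

lemma bnd_msum_norm: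
  assumes A: "A \<in> msum_carrier N d"
  shows "bnd (msum_norm N A) (emb A)"
  unfolding bnd_def
proof (intro conjI allI)
  let ?c = "msum_norm N A"
  show c: "0 \<le> ?c" using A by (rule msum_norm_nonneg)
  fix y
  obtain n where n: "inside n (entry y)" using ex_inside by blast
  have "(nrm2 (emb A * y))\<^sup>2 \<le> (\<Sum>k=1..N. \<Sum>j<n. wt k * (?c * euclid_norm (colv y k j))\<^sup>2)"
    unfolding nrm2_emb_times[OF A n]
  proof (intro sum_mono mult_left_mono power_mono)
    fix k j assume k: "k \<in> {1..N}"
    have "euclid_norm (A k *\<^sub>v colv y k j) \<le> op_norm (A k) * euclid_norm (colv y k j)"
      by (rule op_norm_bound[OF A k colv_carrier])
    also have "\<dots> \<le> ?c * euclid_norm (colv y k j)"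
      using msum_norm_le_iff[of A ?c] k by (intro mult_right_mono) auto
    finally show "euclid_norm (A k *\<^sub>v colv y k j) \<le> ?c * euclid_norm (colv y k j)" .
  qed (auto intro: less_imp_le[OF w_pos])
  \<comment> \<open>\<open>one * y\<close> is the part of y whose rows belong to the direct sum;
    \<open>emb A\<close> annihilates the rest.\<close>
  also have "\<dots> = (?c * nrm2 (one * y))\<^sup>2"
    unfolding power_mult_distrib nrm2_one_times_sq[OF n] by (simp add: sum_distrib_left mult_ac)
  also have "\<dots> \<le> (?c * nrm2 y)\<^sup>2"
    using c nrm2_one_times[of y] by (intro power_mono mult_left_mono) auto
  finally show "nrm2 (emb A * y) \<le> ?c * nrm2 y" by (rule power2_le_imp_le) (simp add: c)
qed

end

section \<open>Standard subalgebras\<close>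

context weighted
begin

text \<open>Positivity at u i - u j bounds each pair of cross terms by the sum of the two diagonal
  terms; adding up all pairs produces the factor \<open>card I\<close>, from which r arises.\<close>

lemma psd_sum_le:
  assumes psd: "\<And>y. 0 \<le> Re (ip (x * y) y)"
  shows "Re (ip (x * (\<Sum>i\<in>I. u i)) (\<Sum>i\<in>I. u i)) \<le> real (card I) * (\<Sum>i\<in>I. Re (ip (x * u i) (u i)))"
proof -
  let ?q = "\<lambda>i. Re (ip (x * u i) (u i))" and ?B = "\<lambda>i j. Re (ip (x * u i) (u j))"
  have pair: "?B i j + ?B j i \<le> ?q i + ?q j" for i j
    using psd[of "u i - u j"] by (simp add: right_diff_distrib ip_diff_left ip_diff_right)
  have "Re (ip (x * (\<Sum>i\<in>I. u i)) (\<Sum>i\<in>I. u i)) = (\<Sum>i\<in>I. \<Sum>j\<in>I. ?B i j)"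
    by (simp add: sum_distrib_left ip_sum_left ip_sum_right) (rule sum.swap)
  then have "2 * Re (ip (x * (\<Sum>i\<in>I. u i)) (\<Sum>i\<in>I. u i))
    = (\<Sum>i\<in>I. \<Sum>j\<in>I. ?B i j) + (\<Sum>i\<in>I. \<Sum>j\<in>I. ?B j i)"
    using sum.swap[of ?B I I] by simp
  also have "\<dots> = (\<Sum>i\<in>I. \<Sum>j\<in>I. ?B i j + ?B j i)" by (simp add: sum.distrib)
  also have "\<dots> \<le> (\<Sum>i\<in>I. \<Sum>j\<in>I. ?q i + ?q j)" by (intro sum_mono pair)
  also have "\<dots> = 2 * (real (card I) * (\<Sum>i\<in>I. ?q i))"
    by (simp add: sum.distrib sum_distrib_left)
  finally show ?thesis by simp
qed

text \<open>The quadratic form of \<open>x\<close> at \<open>K *\<^sub>C u - x * u\<close> is nonnegative.\<close>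
lemma nrm2_psd_times_le:
  assumes psd: "\<And>y. 0 \<le> Re (ip (x * y) y)" and x: "adj x = x" and K: "0 \<le> K"
    and u: "Re (ip (x * u) u) \<le> K * (nrm2 u)\<^sup>2"
    and xu: "Re (ip (x * (x * u)) (x * u)) \<le> K * (nrm2 (x * u))\<^sup>2"
  shows "nrm2 (x * u) \<le> K * nrm2 u"
proof -
  let ?z = "x * u"
  have *: "0 \<le> s\<^sup>2 * Re (ip (x * u) u) + Re (ip (x * ?z) ?z) - 2 * s * (nrm2 ?z)\<^sup>2" for s :: real
  proof -
    have "ip (x * ?z) u = ip ?z ?z" by (simp add: ip_times_left x)
    then have "Re (ip (x * (of_real s *\<^sub>C u - ?z)) (of_real s *\<^sub>C u - ?z))
      = s\<^sup>2 * Re (ip (x * u) u) + Re (ip (x * ?z) ?z) - 2 * s * (nrm2 ?z)\<^sup>2"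
      unfolding nrm2_sq
      by (simp add: right_diff_distrib ip_diff_left ip_diff_right power2_eq_square algebra_simps)
    then show ?thesis using psd by metis
  qed
  have "(nrm2 ?z)\<^sup>2 \<le> (K * nrm2 u)\<^sup>2"
  \<comment> \<open>The choice s = K is void when K = 0; there s = 1 already forces the norm to
    vanish.\<close>
  proof (cases "K = 0")
    case True
    then have "Re (ip (x * u) u) \<le> 0" "Re (ip (x * ?z) ?z) \<le> 0" using u xu by simp_all
    moreover have "0 \<le> Re (ip (x * u) u) + Re (ip (x * ?z) ?z) - 2 * (nrm2 ?z)\<^sup>2" using *[of 1] by simp
    ultimately have "(nrm2 ?z)\<^sup>2 \<le> 0" by linarith
    then show ?thesis by (rule order_trans) simp
  next
    case False
    have "2 * K * (nrm2 ?z)\<^sup>2 \<le> K\<^sup>2 * (K * (nrm2 u)\<^sup>2) + K * (nrm2 ?z)\<^sup>2"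
      using *[of K] xu mult_left_mono[OF u, of "K\<^sup>2"] by simp
    then have "K * (nrm2 ?z)\<^sup>2 \<le> K * (K * nrm2 u)\<^sup>2"
      by (simp add: power2_eq_square algebra_simps)
    then show ?thesis using False K by simp
  qed
  then show ?thesis by (rule power2_le_imp_le) (simp add: K)
qed

lemma bnd_mono: "bnd c a \<Longrightarrow> c \<le> c' \<Longrightarrow> bnd c' a"
  unfolding bnd_def by (meson dual_order.trans mult_right_mono nrm2_ge)

end

lemma index_matrix_unit:
  assumes "k \<in> {1..N}" "i < d k" "j < d k"
  shows "matrix_unit N d k0 i0 j0 k $$ (i, j) = (if k = k0 \<and> i = i0 \<and> j = j0 then 1 else 0)"
  using assms by (simp add: matrix_unit_def)

lemma finite_matrix_units: "finite (matrix_units N d)"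
proof -
  have "matrix_units N d \<subseteq> (\<lambda>(k, i, j). matrix_unit N d k i j) ` (SIGMA k:{1..N}. {..<d k} \<times> {..<d k})"
    by (force simp: matrix_units_def)
  then show ?thesis by (rule finite_subset) auto
qed

lemma index_sum_matrix_units:
  assumes U: "U \<subseteq> matrix_units N d" and k: "k \<in> {1..N}" "i < d k" "j < d k"
  shows "msum_lincomb N d (\<lambda>_. 1) U k $$ (i, j) = (if matrix_unit N d k i j \<in> U then 1 else 0)"
proof -
  have "u k $$ (i, j) = (if u = matrix_unit N d k i j then 1 else 0)" if u: "u \<in> U" for u
  proof -
    obtain k0 i0 j0 where u: "u = matrix_unit N d k0 i0 j0" using u U by (auto simp: matrix_units_def)
    have 1: "matrix_unit N d k i j k $$ (i, j) = 1" using k by (simp add: index_matrix_unit)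
    show ?thesis
    proof (cases "(k, i, j) = (k0, i0, j0)")
      case True
      then show ?thesis using 1 by (simp add: u)
    next
      case False
      then have "u k $$ (i, j) = 0" using k by (auto simp: u index_matrix_unit)
      then show ?thesis using 1 by auto
    qed
  qed
  then have "(\<Sum>u\<in>U. 1 * u k $$ (i, j)) = (\<Sum>u\<in>U. if u = matrix_unit N d k i j then 1 else 0)"
    by (intro sum.cong) auto
  also have "\<dots> = (if matrix_unit N d k i j \<in> U then 1 else 0)"
    using finite_subset[OF U finite_matrix_units] by simp
  finally show ?thesis using k by (simp add: msum_lincomb_def)
qed

section \<open>The standard basis as an orthogonal basis\<close>

locale standard_msum = msum_weights +
  fixes \<B> \<beta> :: "msum set" and \<nu> :: "nat \<Rightarrow> (nat \<times> nat) list"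
  assumes std: "standard_subalgebra N d \<B> \<nu> \<beta>"
begin

definition S :: "bmat set" where "S = emb ` \<B>"

lemma B_carrier: "\<B> \<subseteq> msum_carrier N d"
  using std by (simp add: standard_subalgebra_def unital_cstar_subalgebra_def)

lemma carrier_of_B: "A \<in> \<B> \<Longrightarrow> A \<in> msum_carrier N d"
  using B_carrier by blast

lemma B_closed:
  shows "msum_one N d \<in> \<B>"
    and "A \<in> \<B> \<Longrightarrow> B \<in> \<B> \<Longrightarrow> msum_add N A B \<in> \<B>"
    and "A \<in> \<B> \<Longrightarrow> msum_smult N c A \<in> \<B>"
    and "A \<in> \<B> \<Longrightarrow> B \<in> \<B> \<Longrightarrow> msum_mult N A B \<in> \<B>"
    and "A \<in> \<B> \<Longrightarrow> msum_adjoint N A \<in> \<B>"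
  using std unfolding standard_subalgebra_def unital_cstar_subalgebra_def by blast+

lemma S_corner: "S \<subseteq> corner"
  by (auto simp: S_def)

lemma one_in_S: "one \<in> S"
  using B_closed(1) by (simp add: S_def)

lemma S_add: "x \<in> S \<Longrightarrow> y \<in> S \<Longrightarrow> x + y \<in> S"
  unfolding S_def using B_closed(2) by (force simp: emb_add[symmetric] carrier_of_B)

lemma S_cscale: "x \<in> S \<Longrightarrow> c *\<^sub>C x \<in> S"
  unfolding S_def using B_closed(3) by (force simp: emb_smult[symmetric] carrier_of_B)

lemma S_times: "x \<in> S \<Longrightarrow> y \<in> S \<Longrightarrow> x * y \<in> S"
  unfolding S_def using B_closed(4) by (force simp: emb_mult[symmetric] carrier_of_B)

lemma S_adj: "x \<in> S \<Longrightarrow> adj x \<in> S"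
  unfolding S_def using B_closed(5) by (force simp: emb_adjoint[symmetric] carrier_of_B)

lemma \<beta>: "finite \<beta>" "\<beta> \<subseteq> \<B>" "\<B> = {msum_lincomb N d c \<beta> | c. True}"
  using std by (auto simp: standard_subalgebra_def standard_basis_def)

lemma S_iff: "s \<in> S \<longleftrightarrow> (\<exists>c. s = (\<Sum>b\<in>\<beta>. c b *\<^sub>C emb b))"
proof -
  have "s \<in> S \<longleftrightarrow> (\<exists>c. s = emb (msum_lincomb N d c \<beta>))"
    unfolding S_def by (subst \<beta>(3)) auto
  then show ?thesis by (simp only: emb_lincomb)
qed

lemma basis_carrier: "b \<in> \<beta> \<Longrightarrow> b \<in> msum_carrier N d"
  using \<beta>(2) carrier_of_B by blast

lemma basis_entry:
  assumes "b \<in> \<beta>"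
  shows "entry (emb b) k i j = 0 \<or> entry (emb b) k i j = 1"
    and "emb b \<noteq> 0"
proof -
  obtain U where U: "U \<noteq> {}" "U \<subseteq> matrix_units N d" "b = msum_lincomb N d (\<lambda>_. 1) U"
    using std assms unfolding standard_subalgebra_def standard_basis_def by meson
  show "entry (emb b) k i j = 0 \<or> entry (emb b) k i j = 1"
    unfolding entry_emb U(3) by (auto simp: index_sum_matrix_units[OF U(2)])
  obtain k0 i0 j0 where "matrix_unit N d k0 i0 j0 \<in> U" "k0 \<in> {1..N}" "i0 < d k0" "j0 < d k0"
    using U by (force simp: matrix_units_def)
  then have "entry (emb b) k0 i0 j0 = 1"
    unfolding entry_emb U(3) by (simp add: index_sum_matrix_units[OF U(2)])
  then show "emb b \<noteq> 0" by auto
qed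

lemma msum_supp_iff:
  assumes "b \<in> msum_carrier N d"
  shows "(k, i, j) \<in> msum_supp N b \<longleftrightarrow> entry (emb b) k i j \<noteq> 0"
  using carrierD[OF assms, of k] by (auto simp: msum_supp_def entry_emb)

lemma basis_disjoint:
  assumes "b \<in> \<beta>" "b' \<in> \<beta>" "entry (emb b) k i j \<noteq> 0" "entry (emb b') k i j \<noteq> 0"
  shows "b = b'"
proof (rule ccontr)
  assume "b \<noteq> b'"
  then have "msum_supp N b \<inter> msum_supp N b' = {}"
    using std assms by (auto simp: standard_subalgebra_def standard_basis_def disjoint_family_on_def)
  then show False using assms msum_supp_iff[OF basis_carrier] by blast
qed

text \<open>The quantity maximised in \<gamma>. By \<open>ip_basis\<close> it is \<tau>(b* b), the
  squared norm of the basis element.\<close>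

definition wcount :: "msum \<Rightarrow> real" where
  "wcount b = (\<Sum>k=1..N. real (supp_count N k b) * v k / real (d k))"

text \<open>Disjoint supports give orthogonality, and entries 0 and 1 turn the squared norm into a
  weighted count of positions.\<close>

lemma ip_basis:
  assumes b: "b \<in> \<beta>" and b': "b' \<in> \<beta>"
  shows "ip (emb b) (emb b') = (if b = b' then of_real (wcount b) else 0)"
proof (cases "b = b'")
  case True
  have "(\<Sum>j<d k. \<Sum>i<d k. of_real (wt k) * (entry (emb b) k i j * cnj (entry (emb b) k i j)))
    = complex_of_real (real (supp_count N k b) * v k / real (d k))" if k: "k \<in> {1..N}" for k
  proof -
    let ?P = "{(j, i). j < d k \<and> i < d k \<and> entry (emb b) k i j \<noteq> 0}"
    have "(\<Sum>j<d k. \<Sum>i<d k. of_real (wt k) * (entry (emb b) k i j * cnj (entry (emb b) k i j)))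
      = (\<Sum>j<d k. \<Sum>i<d k. if entry (emb b) k i j \<noteq> 0 then complex_of_real (wt k) else 0)"
    proof (intro sum.cong refl)
      fix i j
      show "of_real (wt k) * (entry (emb b) k i j * cnj (entry (emb b) k i j))
        = (if entry (emb b) k i j \<noteq> 0 then complex_of_real (wt k) else 0)"
        using basis_entry(1)[OF b, of k i j] by auto
    qed
    also have "\<dots> = (\<Sum>(j, i)\<in>{..<d k} \<times> {..<d k}. if entry (emb b) k i j \<noteq> 0 then complex_of_real (wt k) else 0)"
      by (simp add: sum.cartesian_product)
    also have "\<dots> = (\<Sum>(j, i)\<in>?P. complex_of_real (wt k))"
      by (rule sum.mono_neutral_cong_right) auto
    also have "\<dots> = of_nat (card ?P) * complex_of_real (wt k)" by (simp add: case_prod_unfold)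
    also have "card ?P = supp_count N k b"
      unfolding supp_count_def
    proof (rule bij_betw_same_card[of prod.swap])
      have "{(i, j). (k, i, j) \<in> msum_supp N b} = prod.swap ` ?P"
        using cornerD[OF emb_corner, of b k]
        by (force simp: msum_supp_iff[OF basis_carrier[OF b]] image_iff)
      then show "bij_betw prod.swap ?P {(i, j). (k, i, j) \<in> msum_supp N b}"
        by (simp add: bij_betw_def)
    qed
    finally show ?thesis using k by (simp add: wt_def)
  qed
  then have "ip (emb b) (emb b) = (\<Sum>k=1..N. complex_of_real (real (supp_count N k b) * v k / real (d k)))"
    unfolding ip_corner[OF emb_corner] by (intro sum.cong) auto
  then show ?thesis using True by (simp add: wcount_def)
next
  case False
  then have "entry (emb b) k i j * cnj (entry (emb b') k i j) = 0" for k i j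
    using basis_disjoint[OF b b', of k i j] by auto
  then show ?thesis using False unfolding ip_corner[OF emb_corner] by simp
qed

lemma wcount_pos: "b \<in> \<beta> \<Longrightarrow> 0 < wcount b"
  using ip_basis[of b b] basis_entry(2)[of b] ip_self_eq_0[of "emb b"] ip_self_ge[of "emb b"]
  by auto

lemma nrm2_lincomb:
  assumes T: "T \<subseteq> \<beta>"
  shows "(nrm2 (\<Sum>b\<in>T. c b *\<^sub>C emb b))\<^sup>2 = (\<Sum>b\<in>T. (cmod (c b))\<^sup>2 * wcount b)"
proof -
  have fin: "finite T" using T \<beta>(1) by (rule finite_subset)
  have "ip (\<Sum>b\<in>T. c b *\<^sub>C emb b) (\<Sum>b\<in>T. c b *\<^sub>C emb b)
    = (\<Sum>b\<in>T. \<Sum>b'\<in>T. cnj (c b') * (c b * ip (emb b) (emb b')))"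
    by (simp add: ip_sum_left ip_sum_right sum_distrib_left mult.left_commute) (rule sum.swap)
  also have "\<dots> = (\<Sum>b\<in>T. \<Sum>b'\<in>T. if b = b' then c b * cnj (c b) * of_real (wcount b) else 0)"
    using T by (intro sum.cong refl) (auto simp: ip_basis subset_iff)
  also have "\<dots> = (\<Sum>b\<in>T. of_real ((cmod (c b))\<^sup>2 * wcount b))"
    unfolding of_real_mult complex_norm_square using fin by (intro sum.cong refl) (simp add: sum.delta')
  finally show ?thesis unfolding nrm2_sq by simp
qed

section \<open>The orthogonal projection and its identification with the conditional
  expectation\<close>

text \<open>The Fourier expansion in the orthogonal standard basis, which makes the orthogonal
  projection onto S explicit.\<close>

definition expect :: "bmat \<Rightarrow> bmat" where
  "expect x = (\<Sum>b\<in>\<beta>. (ip x (emb b) / ip (emb b) (emb b)) *\<^sub>C emb b)"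

lemma expect_in_S: "expect x \<in> S"
  unfolding S_iff expect_def by (rule exI) (rule refl)

lemma ip_expect:
  assumes "s \<in> S"
  shows "ip (expect x) s = ip x s"
proof -
  have b: "ip (expect x) (emb b') = ip x (emb b')" if b': "b' \<in> \<beta>" for b'
  proof -
    have "ip (expect x) (emb b') = (\<Sum>b\<in>\<beta>. ip x (emb b) / ip (emb b) (emb b) * ip (emb b) (emb b'))"
      by (simp add: expect_def ip_sum_left)
    also have "\<dots> = (\<Sum>b\<in>\<beta>. if b = b' then ip x (emb b') else 0)"
      using b' wcount_pos[OF b'] by (intro sum.cong) (auto simp: ip_basis)
    also have "\<dots> = ip x (emb b')" using b' \<beta>(1) by simp
    finally show ?thesis .
  qed
  obtain c where "s = (\<Sum>b\<in>\<beta>. c b *\<^sub>C emb b)" using assms S_iff by auto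
  then show ?thesis using b by (simp add: ip_sum_right)
qed

lemma S_eqI:
  assumes "s \<in> S" "t \<in> S" "\<And>c. c \<in> S \<Longrightarrow> ip s c = ip t c"
  shows "s = t"
proof -
  have eq: "s - t = s + (-1) *\<^sub>C t" by (rule bmat_eqI) simp
  have "s - t \<in> S" unfolding eq using assms(1,2) by (intro S_add S_cscale)
  then have "ip (s - t) (s - t) = 0" using assms(3) by (simp add: ip_diff_left)
  then show ?thesis by (simp add: ip_self_eq_0)
qed

text \<open>Restricted to the carrier because \<open>is_cond_exp\<close> asks for an extensional
  function; equality with \<open>cond_exp\<close> must hold at every argument.\<close>

definition basis_exp :: "msum \<Rightarrow> msum" where
  "basis_exp = (\<lambda>A\<in>msum_carrier N d. unemb (expect (emb A)))"

lemma emb_basis_exp: "A \<in> msum_carrier N d \<Longrightarrow> emb (basis_exp A) = expect (emb A)"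
  unfolding basis_exp_def using emb_unemb expect_in_S S_corner by auto

lemma basis_exp_in_B:
  assumes "A \<in> msum_carrier N d"
  shows "basis_exp A \<in> \<B>"
proof -
  obtain B where B: "B \<in> \<B>" "expect (emb A) = emb B" using expect_in_S by (auto simp: S_def)
  then have "basis_exp A = B" using assms by (simp add: basis_exp_def unemb_emb carrier_of_B)
  then show ?thesis using B by simp
qed

lemma basis_exp_carrier: "A \<in> msum_carrier N d \<Longrightarrow> basis_exp A \<in> msum_carrier N d"
  using basis_exp_in_B carrier_of_B by blast

lemma is_cond_exp_basis_exp: "is_cond_exp N d \<B> basis_exp"
  unfolding is_cond_exp_def
proof (intro conjI ballI allI)
  show "basis_exp \<in> msum_carrier N d \<rightarrow>\<^sub>E \<B>"
    using basis_exp_in_B by (auto simp: PiE_iff basis_exp_def extensional_def)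
  fix A assume A: "A \<in> msum_carrier N d"
  show "basis_exp (msum_add N A B) = msum_add N (basis_exp A) (basis_exp B)" if B: "B \<in> msum_carrier N d" for B
    by (rule emb_inj)
       (simp_all add: A B msum_add_carrier basis_exp_carrier emb_add emb_basis_exp expect_def ip_add_left
          add_divide_distrib cscale_add_left sum.distrib)
  show "basis_exp (msum_smult N c A) = msum_smult N c (basis_exp A)" for c
    by (rule emb_inj)
       (simp_all add: A msum_smult_carrier basis_exp_carrier emb_smult emb_basis_exp,
        rule S_eqI, simp_all add: expect_in_S S_cscale ip_expect)
  show "msum_norm N (basis_exp A) \<le> msum_norm N A"
  proof (rule msum_norm_le_of_bnd[OF basis_exp_carrier[OF A]])
    show "bnd (msum_norm N A) (emb (basis_exp A))"
      unfolding emb_basis_exp[OF A]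
      by (rule bnd_projection[OF expect_in_S S_times S_adj ip_expect bnd_msum_norm[OF A]])
  qed
next
  fix B assume B: "B \<in> \<B>"
  have "expect (emb B) = emb B"
    by (rule S_eqI) (use B expect_in_S in \<open>auto simp: ip_expect S_def\<close>)
  then show "basis_exp B = B"
    using B by (intro emb_inj) (simp_all add: carrier_of_B basis_exp_carrier emb_basis_exp)
qed

text \<open>P is transported to the corner as \<open>emb\<close> after P after \<open>unemb\<close>.
  Its contractivity for \<open>msum_norm\<close> becomes preservation of \<open>bnd\<close>, since
  both norms agree.\<close>

lemma ip_cond_exp:
  assumes P: "is_cond_exp N d \<B> P"
    and tr: "\<forall>A\<in>msum_carrier N d. tracial_state N d v (P A) = tracial_state N d v A"
    and A: "A \<in> msum_carrier N d" and s: "s \<in> S"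
  shows "ip (emb (P A)) s = ip (emb A) s"
proof -
  have PB: "P A \<in> \<B>" if "A \<in> msum_carrier N d" for A
    using P that by (auto simp: is_cond_exp_def)
  have PC: "P A \<in> msum_carrier N d" if "A \<in> msum_carrier N d" for A
    using PB[OF that] carrier_of_B by blast
  interpret trace_expectation wt corner S one "\<lambda>x. emb (P (unemb x))"
  proof
    fix x y c assume x: "x \<in> corner"
    obtain X where X: "x = emb X" "X \<in> msum_carrier N d" using emb_unemb[OF x] unemb_carrier by metis
    note X = X unemb_emb[OF X(2)]
    show "emb (P (unemb x)) \<in> S" using PB X by (simp add: S_def)
    show "ip (emb (P (unemb x))) one = ip x one"
      using tr X by (simp add: tracial_state_eq_ip[symmetric] PC)
    show "emb (P (unemb (c *\<^sub>C x))) = c *\<^sub>C emb (P (unemb x))"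
      using P X by (simp add: is_cond_exp_def emb_smult[symmetric] unemb_emb msum_smult_carrier PC)
    show "emb (P (unemb (x + y))) = emb (P (unemb x)) + emb (P (unemb y))" if y: "y \<in> corner"
    proof -
      obtain Y where Y: "y = emb Y" "Y \<in> msum_carrier N d" using emb_unemb[OF y] unemb_carrier by metis
      show ?thesis
        using P X Y by (simp add: is_cond_exp_def emb_add[symmetric] unemb_emb msum_add_carrier PC)
    qed
  next
    fix x c assume x: "x \<in> corner" "bnd c x"
    obtain X where X: "x = emb X" "X \<in> msum_carrier N d" using emb_unemb[OF x(1)] unemb_carrier by metis
    have "msum_norm N (P X) \<le> msum_norm N X" using P X by (auto simp: is_cond_exp_def)
    also have "\<dots> \<le> c" using X x by (intro msum_norm_le_of_bnd) auto
    finally have "bnd c (emb (P X))" using bnd_msum_norm[OF PC[OF X(2)]] bnd_mono by blast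
    then show "bnd c (emb (P (unemb x)))" using X by (simp add: unemb_emb)
  next
    fix x assume "x \<in> S"
    then show "emb (P (unemb x)) = x" 
      using P by (auto simp: S_def is_cond_exp_def unemb_emb carrier_of_B)
  qed (auto simp: corner_add corner_cscale corner_times corner_adj S_add S_cscale S_times S_adj
        one_in_S one_adj nrm2_one one_left one_right subsetD[OF S_corner])
  show ?thesis using ip_p[of "emb A" s] A s by (simp add: unemb_emb)
qed

text \<open>Existence is the projection onto the basis; uniqueness holds because any candidate has
  the same inner products with S and takes its values there.\<close>

lemma cond_exp_eq: "cond_exp N d v \<B> = basis_exp"
  unfolding cond_exp_def
proof (rule the_equality)
  have "tracial_state N d v (basis_exp A) = tracial_state N d v A" if "A \<in> msum_carrier N d" for A
    using that by (simp add: tracial_state_eq_ip basis_exp_carrier emb_basis_exp ip_expect one_in_S)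
  then show E: "is_cond_exp N d \<B> basis_exp \<and>
      (\<forall>A\<in>msum_carrier N d. tracial_state N d v (basis_exp A) = tracial_state N d v A)"
    using is_cond_exp_basis_exp by blast
  fix P assume P: "is_cond_exp N d \<B> P \<and>
      (\<forall>A\<in>msum_carrier N d. tracial_state N d v (P A) = tracial_state N d v A)"
  show "P = basis_exp"
  proof
    fix A
    show "P A = basis_exp A"
    proof (cases "A \<in> msum_carrier N d")
      case True
      have PB: "P A \<in> \<B>" using P True by (auto simp: is_cond_exp_def)
      have "emb (P A) = emb (basis_exp A)"
        by (rule S_eqI)
           (use P True PB expect_in_S in \<open>auto simp: S_def ip_cond_exp emb_basis_exp ip_expect\<close>)
      then show ?thesis using True PB by (intro emb_inj) (auto simp: carrier_of_B basis_exp_carrier)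
    next
      case False
      then show ?thesis using P by (auto simp: is_cond_exp_def PiE_iff extensional_def basis_exp_def)
    qed
  qed
qed

section \<open>The lower bound for the expectation of a positive element\<close>

text \<open>The form at y is the sum of the forms at its columns, all nonnegative, so it dominates
  each of them.\<close>

lemma Re_ip_column_le:
  assumes X: "X \<in> msum_carrier N d" and psd: "\<And>y. 0 \<le> Re (ip (emb X * y) y)" and k: "k \<in> {1..N}"
  shows "Re (ip (emb X * colm k (colv y k j)) (colm k (colv y k j))) \<le> Re (ip (emb X * y) y)"
proof -
  let ?q = "\<lambda>k j. Re (ip (emb X * colm k (colv y k j)) (colm k (colv y k j)))"
  have q: "?q k j = Re (of_real (wt k) * ((X k *\<^sub>v colv y k j) \<bullet>c colv y k j))" if k: "k \<in> {1..N}" for k j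
  proof -
    have "X k *\<^sub>v colv y k j \<in> carrier_vec (d k)" 
      using carrierD[OF X k] by (rule mult_mat_vec_carrier) simp
    then show ?thesis by (simp add: emb_times_colm[OF X k] ip_colm[of _ "d k"])
  qed
  obtain n where n: "inside n (entry y)" using ex_inside by blast
  \<comment> \<open>Enlarged so that column j is among the summands even if y vanishes
    there.\<close>
  have n: "inside (max n (Suc j)) (entry y)" using n by (rule inside_mono) simp
  let ?n = "max n (Suc j)"
  have "Re (ip (emb X * y) y) = (\<Sum>k=1..N. \<Sum>j<?n. ?q k j)"
    unfolding ip_emb_times[OF X n] Re_sum by (intro sum.cong refl) (simp only: q)
  moreover have "?q k j \<le> (\<Sum>j<?n. ?q k j)"
    using psd by (intro member_le_sum) auto
  moreover have "\<dots> \<le> (\<Sum>k=1..N. \<Sum>j<?n. ?q k j)"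
    using k psd by (intro member_le_sum[of k "{1..N}" "\<lambda>k. \<Sum>j<?n. ?q k j"]) (auto intro!: sum_nonneg)
  ultimately show ?thesis by linarith
qed

text \<open>Discarding the basis elements that vanish in the \<open>k\<close>-th summand keeps the \<open>k\<close>-th
  coordinate and makes the remaining coefficients entries of \<open>W\<close> at distinct positions.\<close>
lemma ex_lift:
  assumes k: "k \<in> {1..N}" and W: "W \<in> block_algebra (\<nu> k)" and Wc: "W \<in> carrier_mat (d k) (d k)"
    and G: "\<And>b. b \<in> \<beta> \<Longrightarrow> wcount b \<le> G" "0 \<le> G"
  shows "\<exists>C\<in>S. (\<forall>i<d k. \<forall>j<d k. entry C k i j = W $$ (i, j)) \<and> (nrm2 C)\<^sup>2 \<le> G * hs_sq W"
proof -
  have "W \<in> (\<lambda>A. A k) ` \<B>" using std k W by (simp add: standard_subalgebra_def)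
  then obtain B where B: "B \<in> \<B>" "B k = W" by blast
  then obtain c where c: "emb B = (\<Sum>b\<in>\<beta>. c b *\<^sub>C emb b)" using S_iff[of "emb B"] by (auto simp: S_def)
  \<comment> \<open>An element of \<B> with k-th coordinate W may have arbitrarily large other
    coordinates, carried by basis elements invisible in the k-th summand; no bound by W would hold
    for it.\<close>
  define T where "T = {b \<in> \<beta>. \<exists>p. entry (emb b) k (fst p) (snd p) \<noteq> 0}"
  have T: "T \<subseteq> \<beta>" "finite T" using \<beta>(1) by (auto simp: T_def)
  define C where "C = (\<Sum>b\<in>T. c b *\<^sub>C emb b)"
  have "C = (\<Sum>b\<in>\<beta>. (if b \<in> T then c b else 0) *\<^sub>C emb b)"
    unfolding C_def using T \<beta>(1) by (intro sum.mono_neutral_cong_left) auto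
  then have CS: "C \<in> S" unfolding S_iff by (rule exI[of _ "\<lambda>b. if b \<in> T then c b else 0"])
  have entry_C: "entry C k i j = W $$ (i, j)" if "i < d k" "j < d k" for i j
  proof -
    have "entry C k i j = (\<Sum>b\<in>\<beta>. c b * entry (emb b) k i j)"
      unfolding C_def entry_sum entry_cscale using T \<beta>(1)
      by (intro sum.mono_neutral_left) (auto simp: T_def)
    also have "\<dots> = entry (emb B) k i j" unfolding c by simp
    finally show ?thesis using that k B by (simp add: entry_emb)
  qed
  have "\<forall>b\<in>T. \<exists>p. entry (emb b) k (fst p) (snd p) \<noteq> 0" by (auto simp: T_def)
  then obtain pos where pos: "\<And>b. b \<in> T \<Longrightarrow> entry (emb b) k (fst (pos b)) (snd (pos b)) \<noteq> 0" by metis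
  have range: "pos b \<in> {..<d k} \<times> {..<d k}" if "b \<in> T" for b
    using cornerD[OF emb_corner pos[OF that]] by (auto simp: mem_Times_iff)
  have inj: "inj_on pos T"
  proof (rule inj_onI)
    fix b b' assume "b \<in> T" "b' \<in> T" "pos b = pos b'"
    then show "b = b'" using basis_disjoint[of b b' k] pos[of b] pos[of b'] T by auto
  qed
  have cW: "c b = W $$ (pos b)" if b: "b \<in> T" for b
  proof -
    have "entry C k (fst (pos b)) (snd (pos b)) = (\<Sum>b'\<in>T. if b' = b then c b else 0)"
      unfolding C_def entry_sum entry_cscale
    proof (intro sum.cong refl)
      fix b' assume b': "b' \<in> T"
      show "c b' * entry (emb b') k (fst (pos b)) (snd (pos b)) = (if b' = b then c b else 0)"
        using basis_disjoint[of b b'] b b' T pos[OF b] basis_entry(1)[of b k "fst (pos b)" "snd (pos b)"]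
        by auto
    qed
    also have "\<dots> = c b" using b T by simp
    finally show ?thesis using entry_C range[OF b] by (auto simp: mem_Times_iff)
  qed
  have "(nrm2 C)\<^sup>2 = (\<Sum>b\<in>T. (cmod (c b))\<^sup>2 * wcount b)"
    unfolding C_def by (rule nrm2_lincomb[OF T(1)])
  also have "\<dots> \<le> (\<Sum>b\<in>T. (cmod (c b))\<^sup>2 * G)"
    using T G by (intro sum_mono mult_left_mono) auto
  also have "\<dots> = G * (\<Sum>b\<in>T. (cmod (W $$ (pos b)))\<^sup>2)"
    using cW by (simp add: sum_distrib_left mult.commute)
  also have "(\<Sum>b\<in>T. (cmod (W $$ (pos b)))\<^sup>2) = (\<Sum>p\<in>pos ` T. (cmod (W $$ p))\<^sup>2)"
    using inj by (simp add: sum.reindex)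
  also have "G * \<dots> \<le> G * (\<Sum>p\<in>{..<d k} \<times> {..<d k}. (cmod (W $$ p))\<^sup>2)"
    using range by (intro mult_left_mono sum_mono2 image_subsetI G) auto
  also have "(\<Sum>p\<in>{..<d k} \<times> {..<d k}. (cmod (W $$ p))\<^sup>2) = hs_sq W"
    using Wc by (simp add: hs_sq_def sum.cartesian_product case_prod_unfold)
  finally show ?thesis using CS entry_C by blast
qed

text \<open>By traciality the form at C is the pairing of X with C * adj C, which lies in S; there X
  may be replaced by its projection.\<close>

lemma Re_ip_expect_le:
  assumes X: "X \<in> msum_carrier N d" and C: "C \<in> S"
  shows "Re (ip (emb X * C) C) \<le> msum_norm N (basis_exp X) * (nrm2 C)\<^sup>2"
proof -
  have "ip (emb X * C) C = ip (emb X) (C * adj C)" by (simp add: ip_times_right)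
  also have "\<dots> = ip (emb (basis_exp X)) (C * adj C)"
    using C by (simp add: emb_basis_exp[OF X] ip_expect S_times S_adj)
  also have "\<dots> = ip (emb (basis_exp X) * C) C" by (simp add: ip_times_right)
  finally have "Re (ip (emb X * C) C) \<le> nrm2 (emb (basis_exp X) * C) * nrm2 C" by (simp add: Re_ip_le)
  also have "\<dots> \<le> msum_norm N (basis_exp X) * nrm2 C * nrm2 C"
    by (intro mult_right_mono bndD bnd_msum_norm basis_exp_carrier X) simp
  finally show ?thesis by (simp add: power2_eq_square mult_ac)
qed

text \<open>The constants appear as arbitrary bounds L, R, G and a, so that lowest common multiples
  enter only through their size.\<close>

lemma msum_norm_le_cond_exp:
  assumes X: "X \<in> msum_carrier N d" and sa: "adj (emb X) = emb X"
    and psd: "\<And>y. 0 \<le> Re (ip (emb X * y) y)"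
    and L: "\<And>k s q. k \<in> {1..N} \<Longrightarrow> (s, q) \<in> set (\<nu> k) \<Longrightarrow> q \<le> L"
    and R: "\<And>k. k \<in> {1..N} \<Longrightarrow> sum_list (map snd (\<nu> k)) \<le> R"
    and G: "\<And>b. b \<in> \<beta> \<Longrightarrow> wcount b \<le> G" "0 \<le> G"
    and a: "\<And>k. k \<in> {1..N} \<Longrightarrow> a \<le> wt k" "0 < a"
  shows "msum_norm N X \<le> real R * (real L * G / a) * msum_norm N (cond_exp N d v \<B> X)"
proof -
  define \<rho> where "\<rho> = msum_norm N (basis_exp X)"
  have \<rho>: "0 \<le> \<rho>" unfolding \<rho>_def by (rule msum_norm_nonneg[OF basis_exp_carrier[OF X]])
  let ?x = "emb X" and ?M = "real L * G / a * \<rho>"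
  let ?K = "real R * ?M"
  have M: "0 \<le> ?M" using G a \<rho> by simp
  have op: "op_norm (X k) \<le> ?K" if k: "k \<in> {1..N}" for k
  proof -
    let ?n = "d k" and ?r = "sum_list (map snd (\<nu> k))"
    have rp: "refined_partition (d k) (\<nu> k)" using std k by (simp add: standard_subalgebra_def)
    have "\<exists>f. (\<forall>a<?n. f a < ?r) \<and>
      (\<forall>c<?r. \<forall>y. \<exists>W\<in>block_algebra (\<nu> k). W \<in> carrier_mat ?n ?n \<and>
        hs_sq W \<le> real L * (\<Sum>a<?n. if f a = c then (cmod (y a))\<^sup>2 else 0) \<and>
        (\<exists>j<?n. \<forall>a<?n. W $$ (a, j) = (if f a = c then y a else 0)))"
      by (rule block_algebra_column) (use rp L[OF k] in \<open>auto simp: refined_partition_def\<close>)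
    then obtain f where f: "\<And>a. a < ?n \<Longrightarrow> f a < ?r"
      and W: "\<And>c y. c < ?r \<Longrightarrow> \<exists>W\<in>block_algebra (\<nu> k). W \<in> carrier_mat ?n ?n \<and>
        hs_sq W \<le> real L * (\<Sum>a<?n. if f a = c then (cmod (y a))\<^sup>2 else 0) \<and>
        (\<exists>j<?n. \<forall>a<?n. W $$ (a, j) = (if f a = c then y a else 0))" by blast
    have quad: "Re (ip (?x * colm k y) (colm k y)) \<le> ?K * (nrm2 (colm k y))\<^sup>2"
      if y: "y \<in> carrier_vec ?n" for y
    proof -
      define part where "part c = vec ?n (\<lambda>a. if f a = c then y $ a else 0)" for c
      have part: "part c \<in> carrier_vec ?n" for c by (simp add: part_def)
      have en: "(euclid_norm (part c))\<^sup>2 = (\<Sum>a<?n. if f a = c then (cmod (y $ a))\<^sup>2 else 0)" for c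
        unfolding euclid_norm_sq[OF part] by (intro sum.cong) (auto simp: part_def)
      have qpart: "Re (ip (?x * colm k (part c)) (colm k (part c))) \<le> ?M * (nrm2 (colm k (part c)))\<^sup>2"
        if c: "c < ?r" for c
      proof -
        obtain V j where V: "V \<in> block_algebra (\<nu> k)" "V \<in> carrier_mat ?n ?n"
          "hs_sq V \<le> real L * (euclid_norm (part c))\<^sup>2" 
          and j: "j < ?n" "\<And>a. a < ?n \<Longrightarrow> V $$ (a, j) = (if f a = c then y $ a else 0)"
          using W[OF c, of "\<lambda>a. y $ a"] unfolding en by blast
        obtain C where C: "C \<in> S" "\<And>i j. i < ?n \<Longrightarrow> j < ?n \<Longrightarrow> entry C k i j = V $$ (i, j)"
          "(nrm2 C)\<^sup>2 \<le> G * hs_sq V"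
          using ex_lift[OF k V(1,2) G] by blast
        \<comment> \<open>The chosen piece is a column of C, so the form of X at it is controlled by
          the form at C.\<close>
        have "colv C k j = part c" using C(2) j by (intro eq_vecI) (auto simp: colv_def part_def)
        then have "Re (ip (?x * colm k (part c)) (colm k (part c))) \<le> Re (ip (?x * C) C)"
          using Re_ip_column_le[OF X psd k, of C j] by simp
        also have "\<dots> \<le> \<rho> * (nrm2 C)\<^sup>2" unfolding \<rho>_def by (rule Re_ip_expect_le[OF X C(1)])
        also have "\<dots> \<le> \<rho> * (G * (real L * (euclid_norm (part c))\<^sup>2))"
          using C(3) mult_left_mono[OF V(3) G(2)] by (intro mult_left_mono \<rho>) linarith
        also have "\<dots> = ?M * (a * (euclid_norm (part c))\<^sup>2)" using a by simp
        \<comment> \<open>The division by a in \<open>?M\<close> pays for restoring the weight of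
          the k-th summand.\<close>
        also have "\<dots> \<le> ?M * (wt k * (euclid_norm (part c))\<^sup>2)"
          using a(1)[OF k] by (intro mult_left_mono M mult_right_mono) auto
        finally show ?thesis unfolding nrm2_colm .
      qed
      have sum_part: "colm k y = (\<Sum>c<?r. colm k (part c))"
      proof (rule bmat_eqI)
        fix k' i j
        have "(\<Sum>c<?r. if f i = c then y $ i else 0) = y $ i" if "i < ?n" using f[OF that] by simp
        then show "entry (colm k y) k' i j = entry (\<Sum>c<?r. colm k (part c)) k' i j"
          using y by (auto simp: entry_colm part_def)
      qed
      \<comment> \<open>The pieces have disjoint supports, so their squared norms add up
        exactly.\<close>
      have nrm_part: "(\<Sum>c<?r. (nrm2 (colm k (part c)))\<^sup>2) = (nrm2 (colm k y))\<^sup>2"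
      proof -
        have "(\<Sum>c<?r. \<Sum>a<?n. if f a = c then (cmod (y $ a))\<^sup>2 else 0)
          = (\<Sum>a<?n. \<Sum>c<?r. if f a = c then (cmod (y $ a))\<^sup>2 else 0)" by (rule sum.swap)
        also have "\<dots> = (\<Sum>a<?n. (cmod (y $ a))\<^sup>2)" using f by simp
        finally show ?thesis
          unfolding nrm2_colm en euclid_norm_sq[OF y] sum_distrib_left[symmetric] by simp
      qed
      have "Re (ip (?x * colm k y) (colm k y)) \<le> real ?r * (\<Sum>c<?r. Re (ip (?x * colm k (part c)) (colm k (part c))))"
        unfolding sum_part using psd_sum_le[OF psd, where I = "{..<?r}" and u = "\<lambda>c. colm k (part c)"] by simp
      also have "\<dots> \<le> real ?r * (\<Sum>c<?r. ?M * (nrm2 (colm k (part c)))\<^sup>2)"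
        by (intro mult_left_mono sum_mono qpart) auto
      also have "\<dots> = real ?r * (?M * (nrm2 (colm k y))\<^sup>2)"
        unfolding sum_distrib_left[symmetric] nrm_part ..
      also have "\<dots> \<le> real R * (?M * (nrm2 (colm k y))\<^sup>2)"
        using R[OF k] by (intro mult_right_mono mult_nonneg_nonneg[OF M]) auto
      finally show ?thesis by (simp add: mult_ac)
    qed
    show ?thesis
    proof (rule op_norm_le[OF carrierD[OF X k]])
      show K: "0 \<le> ?K" by (rule mult_nonneg_nonneg[OF _ M]) simp
      fix y :: "complex vec" assume y: "y \<in> carrier_vec ?n"
      have Xy: "X k *\<^sub>v y \<in> carrier_vec ?n" using carrierD[OF X k] y by (rule mult_mat_vec_carrier)
      \<comment> \<open>The form bound at the two vectors y and X y is what turns it into a norm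
        bound.\<close>
      have "nrm2 (colm k (X k *\<^sub>v y)) \<le> ?K * nrm2 (colm k y)"
        using nrm2_psd_times_le[OF psd sa K quad[OF y]] quad[OF Xy] by (simp add: emb_times_colm[OF X k] y)
      then have "(nrm2 (colm k (X k *\<^sub>v y)))\<^sup>2 \<le> (?K * nrm2 (colm k y))\<^sup>2"
        by (rule power_mono) simp
      then have "wt k * (euclid_norm (X k *\<^sub>v y))\<^sup>2 \<le> wt k * (?K * euclid_norm y)\<^sup>2"
        unfolding power_mult_distrib[of ?K] nrm2_colm by (simp only: mult_ac)
      then have "(euclid_norm (X k *\<^sub>v y))\<^sup>2 \<le> (?K * euclid_norm y)\<^sup>2"
        by (rule mult_left_le_imp_le) (rule w_pos)
      then show "euclid_norm (X k *\<^sub>v y) \<le> ?K * euclid_norm y"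
        by (rule power2_le_imp_le) (intro mult_nonneg_nonneg K euclid_norm_nonneg)
    qed
  qed
  then show ?thesis unfolding cond_exp_eq \<rho>_def[symmetric] msum_norm_le_iff by (simp only: mult.assoc) blast
qed

end

section \<open>Positivity, the C*-inequality and the constants\<close>

context standard_msum
begin

lemma emb_self_adjoint:
  assumes X: "X \<in> msum_carrier N d" and pos: "msum_positive N X"
  shows "adj (emb X) = emb X"
proof -
  have "adj (emb X) = emb (msum_adjoint N X)" by (simp add: emb_adjoint X)
  also have "\<dots> = emb X"
    using pos by (intro bmat_eqI) (auto simp: entry_emb msum_adjoint_def msum_positive_def psd_mat_def)
  finally show ?thesis .
qed

lemma Re_ip_positive:
  assumes X: "X \<in> msum_carrier N d" and pos: "msum_positive N X"
  shows "0 \<le> Re (ip (emb X * y) y)"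
proof -
  obtain n where n: "inside n (entry y)" using ex_inside by blast
  have "0 \<le> Re (of_real (wt k) * ((X k *\<^sub>v colv y k j) \<bullet>c colv y k j))" if k: "k \<in> {1..N}" for k j
  proof -
    have "0 \<le> (X k *\<^sub>v colv y k j) \<bullet>c colv y k j"
      using pos k carrierD[OF X k] by (auto simp: msum_positive_def psd_mat_def)
    then show ?thesis using less_imp_le[OF w_pos] by (simp add: less_eq_complex_def)
  qed
  then show ?thesis unfolding ip_emb_times[OF X n] Re_sum by (intro sum_nonneg) auto
qed

text \<open>Half of the C*-identity: the squared norm of X y equals <y, X* X y>, and Cauchy-Schwarz
  finishes.\<close>

lemma msum_norm_sq_le:
  assumes X: "X \<in> msum_carrier N d"
  shows "(msum_norm N X)\<^sup>2 \<le> msum_norm N (msum_mult N (msum_adjoint N X) X)"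
proof -
  let ?Y = "msum_mult N (msum_adjoint N X) X"
  have Y: "?Y \<in> msum_carrier N d" by (intro msum_mult_carrier msum_adjoint_carrier X)
  have "bnd (sqrt (msum_norm N ?Y)) (emb X)"
  proof (rule bndI_sq)
    show "0 \<le> msum_norm N ?Y" using Y by (rule msum_norm_nonneg)
    fix y
    have "ip (emb X * y) (emb X * y) = ip y (emb ?Y * y)"
      by (simp add: ip_times_left emb_mult emb_adjoint X msum_adjoint_carrier mult.assoc)
    then have "(nrm2 (emb X * y))\<^sup>2 \<le> nrm2 y * nrm2 (emb ?Y * y)" unfolding nrm2_sq by (simp add: Re_ip_le)
    also have "\<dots> \<le> nrm2 y * (msum_norm N ?Y * nrm2 y)"
      by (intro mult_left_mono bndD bnd_msum_norm Y) simp
    finally show "(nrm2 (emb X * y))\<^sup>2 \<le> msum_norm N ?Y * (nrm2 y)\<^sup>2" by (simp add: power2_eq_square mult_ac)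
  qed
  then have "msum_norm N X \<le> sqrt (msum_norm N ?Y)" by (rule msum_norm_le_of_bnd[OF X])
  then have "(msum_norm N X)\<^sup>2 \<le> (sqrt (msum_norm N ?Y))\<^sup>2"
    using msum_norm_nonneg[OF X] by (rule power_mono)
  then show ?thesis using msum_norm_nonneg[OF Y] by simp
qed

lemma alpha_props:
  shows "0 < const_alpha N d v" and "k \<in> {1..N} \<Longrightarrow> const_alpha N d v \<le> wt k"
proof -
  have "const_alpha N d v \<in> (\<lambda>k. v k / real (d k)) ` {1..N}"
    unfolding const_alpha_def using N by (intro Min_in) auto
  then obtain k where k: "k \<in> {1..N}" "const_alpha N d v = wt k" by (auto simp: wt_def)
  then show "0 < const_alpha N d v" using w_pos by simp
  show "k \<in> {1..N} \<Longrightarrow> const_alpha N d v \<le> wt k" for k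
    unfolding const_alpha_def by (auto simp: wt_def)
qed

lemma gamma_props:
  shows "0 < const_gamma N d v \<beta>" and "b \<in> \<beta> \<Longrightarrow> wcount b \<le> const_gamma N d v \<beta>"
proof -
  show le: "b \<in> \<beta> \<Longrightarrow> wcount b \<le> const_gamma N d v \<beta>" for b
    unfolding const_gamma_def wcount_def using \<beta>(1) by (intro Max_ge) auto
  have "\<beta> \<noteq> {}"
  proof
    assume "\<beta> = {}"
    then have "one = 0" using one_in_S S_iff[of one] by simp
    then have "entry one 1 0 0 = 0" by simp
    then show False using N d[of 1] by (simp add: entry_one)
  qed
  then obtain b where "b \<in> \<beta>" by blast
  then show "0 < const_gamma N d v \<beta>" using le[of b] wcount_pos[of b] by linarith
qed

lemma msum_norm_le_cond_exp_const:
  assumes X: "X \<in> msum_carrier N d" and sa: "adj (emb X) = emb X"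
    and psd: "\<And>y. 0 \<le> Re (ip (emb X * y) y)"
  shows "const_alpha N d v / (real (const_r N \<nu>) * real (const_l N \<nu>) * real (const_m N \<beta>) * const_gamma N d v \<beta>)
      * msum_norm N X \<le> msum_norm N (cond_exp N d v \<B> X)"
proof -
  let ?r = "const_r N \<nu>" and ?l = "const_l N \<nu>" and ?m = "const_m N \<beta>"
  let ?\<alpha> = "const_alpha N d v" and ?\<gamma> = "const_gamma N d v \<beta>"
  let ?P = "msum_norm N (cond_exp N d v \<B> X)"
  have P: "0 \<le> ?P" unfolding cond_exp_eq by (rule msum_norm_nonneg[OF basis_exp_carrier[OF X]])
  show ?thesis
  \<comment> \<open>If one of the three were 0, the quotient would be 0 by the convention for
    division by zero, and only nonnegativity of the norm would remain.\<close>
  proof (cases "?r = 0 \<or> ?l = 0 \<or> ?m = 0")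
    case True
    then show ?thesis using P by auto
  next
    case False
    then have pos: "0 < ?r" "0 < ?l" "1 \<le> ?m" by auto
    have "msum_norm N X \<le> real ?r * (real ?l * ?\<gamma> / ?\<alpha>) * ?P"
    proof (rule msum_norm_le_cond_exp[OF X sa psd _ _ gamma_props(2) less_imp_le[OF gamma_props(1)]
          alpha_props(2,1)])
      fix k assume k: "k \<in> {1..N}"
      \<comment> \<open>A nonzero lowest common multiple is at least as large as each of its
        divisors.\<close>
      show "sum_list (map snd (\<nu> k)) \<le> ?r"
        using k pos(1) unfolding const_r_def by (intro dvd_imp_le dvd_Lcm) auto
      show "q \<le> ?l" if "(s, q) \<in> set (\<nu> k)" for s q
        using k pos(2) that unfolding const_l_def by (intro dvd_imp_le dvd_Lcm) force+
    qed
    \<comment> \<open>The factor m is inserted by m \<ge> 1.\<close>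
    also have "\<dots> \<le> real ?m * (real ?r * (real ?l * ?\<gamma> / ?\<alpha>) * ?P)"
    proof -
      have "0 \<le> real ?r * (real ?l * ?\<gamma> / ?\<alpha>) * ?P"
        using P gamma_props(1) alpha_props(1) by simp
      then have "1 * (real ?r * (real ?l * ?\<gamma> / ?\<alpha>) * ?P) \<le> real ?m * (real ?r * (real ?l * ?\<gamma> / ?\<alpha>) * ?P)"
        using pos(3) by (intro mult_right_mono) auto
      then show ?thesis by simp
    qed
    also have "\<dots> = ?P / (?\<alpha> / (real ?r * real ?l * real ?m * ?\<gamma>))" by simp
    finally have le: "msum_norm N X \<le> ?P / (?\<alpha> / (real ?r * real ?l * real ?m * ?\<gamma>))" .
    have "0 < ?\<alpha> / (real ?r * real ?l * real ?m * ?\<gamma>)"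
      using pos alpha_props(1) gamma_props(1) by (intro divide_pos_pos mult_pos_pos) auto
    then show ?thesis using le by (simp only: pos_le_divide_eq mult.commute)
  qed
qed

end

theorem theorem4p10:
  fixes N :: nat and d :: "nat \<Rightarrow> nat" and v :: "nat \<Rightarrow> real"
    and \<B> \<beta> :: "msum set" and \<nu> :: "nat \<Rightarrow> (nat \<times> nat) list"
    and r l m :: nat and \<alpha> \<gamma> :: real
  assumes "1 \<le> N"
    and "\<forall>k\<in>{1..N}. 1 \<le> d k"
    and "weight_vector N v"
    and "standard_subalgebra N d \<B> \<nu> \<beta>"
    and "r = const_r N \<nu>"
    and "l = const_l N \<nu>"
    and "m = const_m N \<beta>"
    and "\<alpha> = const_alpha N d v"
    and "\<gamma> = const_gamma N d v \<beta>"
  shows "(\<forall>X\<in>msum_carrier N d. msum_positive N X \<longrightarrow>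
            \<alpha> / (real r * real l * real m * \<gamma>) * msum_norm N X
              \<le> msum_norm N (cond_exp N d v \<B> X)) \<and>
         (\<forall>X\<in>msum_carrier N d.
            sqrt \<alpha> / sqrt (real r * real l * real m * \<gamma>) * msum_norm N X
              \<le> fr_norm N d v \<B> X)"
proof -
  interpret standard_msum N d v \<B> \<beta> \<nu>
    using assms(1-4) by unfold_locales auto
  let ?c = "\<alpha> / (real r * real l * real m * \<gamma>)"
  \<comment> \<open>Positivity is phrased through \<open>ip\<close>, so that X* X qualifies at once:
    its form at y is the squared norm of X y.\<close>
  have main: "?c * msum_norm N X \<le> msum_norm N (cond_exp N d v \<B> X)"
    if "X \<in> msum_carrier N d" "adj (emb X) = emb X" "\<And>y. 0 \<le> Re (ip (emb X * y) y)" for X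
    using msum_norm_le_cond_exp_const[OF that] unfolding assms(5-9) .
  have "0 \<le> ?c"
    using alpha_props(1) gamma_props(1) unfolding assms(8,9) by simp
  have "sqrt \<alpha> / sqrt (real r * real l * real m * \<gamma>) * msum_norm N X \<le> fr_norm N d v \<B> X"
    if X: "X \<in> msum_carrier N d" for X
  proof -
    let ?Y = "msum_mult N (msum_adjoint N X) X"
    have Y: "?Y \<in> msum_carrier N d" by (intro msum_mult_carrier msum_adjoint_carrier X)
    have emb_Y: "emb ?Y = adj (emb X) * emb X" by (simp add: emb_mult emb_adjoint X msum_adjoint_carrier)
    have "?c * (msum_norm N X)\<^sup>2 \<le> ?c * msum_norm N ?Y"
      by (rule mult_left_mono[OF msum_norm_sq_le[OF X] \<open>0 \<le> ?c\<close>])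
    also have "\<dots> \<le> msum_norm N (cond_exp N d v \<B> ?Y)"
    proof (rule main[OF Y])
      show "adj (emb ?Y) = emb ?Y" by (simp add: emb_Y adj_times)
      have "ip (emb ?Y * y) y = ip (emb X * y) (emb X * y)" for y
        by (simp add: emb_Y ip_times_left adj_times mult.assoc)
      then show "0 \<le> Re (ip (emb ?Y * y) y)" for y by (simp add: ip_self_ge)
    qed
    finally have "sqrt (?c * (msum_norm N X)\<^sup>2) \<le> fr_norm N d v \<B> X"
      unfolding fr_norm_def by (rule real_sqrt_le_mono)
    then show ?thesis
      using msum_norm_nonneg[OF X] by (simp add: real_sqrt_mult real_sqrt_divide)
  qed
  then show ?thesis using main emb_self_adjoint Re_ip_positive by blast
qed

end
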